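(* Let $d\ge 1$ and let $\gamma\colon [0,1] \to \mathbb{R}^d$ be a rectifiable loop. For a prime $r \ge 2$, let $n = (r-1)(d+1)$. Let $C_1, \dots, C_m$ be a partition of $[n+1]$ with $|C_i| \le r-1$ for every $i$. Then there exist a partition of $[0,1]$ into $n+1$ intervals $I_1, \dots, I_{n+1}$ by $n$ cuts and a partition of the index set $[n+1]$ into subsets $T_1, \dots, T_r$ with $|C_i \cap T_k| \le 1$ for all $i$ and $k$ such that, for each $k \in \{1, \dots, r\}$, the restrictions $\gamma|_{I_j}$, $j \in T_k$, can be rearranged by translations to form a loop, and these $r$ loops all have the same length.
   Context: Here a loop in $\mathbb{R}^d$ is a continuous map $\gamma\colon[0,1]\to\mathbb{R}^d$ with $\gamma(0)=\gamma(1)$ (a closed curve, not required to be injective). A curve $\gamma\colon [0,1] \to \mathbb{R}^d$ is rectifiable if there is a constant $C>0$ such that $\sum_{j=1}^{n-1} |\gamma(x_{j+1}) - \gamma(x_j)| < C$ for any $n$ and any points $x_1 < x_2 < \dots < x_n$ in $[0,1]$; its length is then well-defined. $[N]=\{1,\dots,N\}$. A partition of $[0,1]$ into $n+1$ intervals by $n$ cuts is given by points $0=t_0\le t_1\le\dots\le t_n\le t_{n+1}=1$ with $I_j=[t_{j-1},t_j]$ (so the intervals are indexed in order from left to right); intervals may be degenerate (of length zero), and the parts $T_k$ of the partition of $[n+1]$ are pairwise disjoint with union $[n+1]$ and may be empty. Curve pieces $\gamma|_{I_j}$, $j\in T_k$, can be rearranged by translations to form a loop if suitable translates of these pieces, traversed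 in their original directions and concatenated one after another in some order, form a continuous closed curve; the length of that loop is the sum of the lengths of its pieces. *)

theory Defs
  imports
    "HOL-Analysis.Analysis"
    "HOL-Computational_Algebra.Primes"
begin

definition inscribed_sums :: "(real \<Rightarrow> 'a::real_normed_vector) \<Rightarrow> real set" where
  "inscribed_sums \<gamma> =
     {(\<Sum>j\<in>{1..<n}. norm (\<gamma> (x (Suc j)) - \<gamma> (x j))) | (n::nat) (x::nat \<Rightarrow> real).
        strict_mono_on {1..n} x \<and> x ` {1..n} \<subseteq> {0..1}}"

definition rectifiable :: "(real \<Rightarrow> 'a::real_normed_vector) \<Rightarrow> bool" where
  "rectifiable \<gamma> \<longleftrightarrow> (\<exists>C>0. \<forall>s\<in>inscribed_sums \<gamma>. s < C)"

text \<open>The length is meaningful only for rectifiable curves, where the supremum below is over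
  a bounded nonempty set.\<close>

definition curve_length :: "(real \<Rightarrow> 'a::real_normed_vector) \<Rightarrow> real" where
  "curve_length \<gamma> = Sup (inscribed_sums \<gamma>)"

definition is_loop :: "(real \<Rightarrow> 'a::topological_space) \<Rightarrow> bool" where
  "is_loop \<gamma> \<longleftrightarrow> path \<gamma> \<and> pathfinish \<gamma> = pathstart \<gamma>"

text \<open>The function \<open>p +++ q\<close> does not presuppose that \<open>p\<close> ends where \<open>q\<close> starts;
  for paths \<open>p\<close> and \<open>q\<close> it is continuous exactly if this is the case.  Concatenating no
  curves at all gives a constant curve, of length zero.\<close>

fun concat_curves :: "(real \<Rightarrow> 'a::real_normed_vector) list \<Rightarrow> real \<Rightarrow> 'a" where
  "concat_curves [] = (\<lambda>_. 0)"
| "concat_curves [p] = p"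
| "concat_curves (p # q # ps) = p +++ concat_curves (q # ps)"

text \<open>\<open>cuts n t\<close>: the points \<open>t 0, \<dots>, t (n + 1)\<close> cut \<open>[0,1]\<close> into the \<open>n + 1\<close> possibly
  degenerate intervals \<open>I\<^sub>j = [t (j - 1), t j]\<close>, where \<open>1 \<le> j \<le> n + 1\<close>.\<close>

definition cuts :: "nat \<Rightarrow> (nat \<Rightarrow> real) \<Rightarrow> bool" where
  "cuts n t \<longleftrightarrow> t 0 = 0 \<and> t (n + 1) = 1 \<and> (\<forall>j\<le>n. t j \<le> t (j + 1))"

definition curve_piece :: "(real \<Rightarrow> 'a::real_normed_vector) \<Rightarrow> (nat \<Rightarrow> real) \<Rightarrow> nat \<Rightarrow> real \<Rightarrow> 'a" where
  "curve_piece \<gamma> t j = subpath (t (j - 1)) (t j) \<gamma>"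

text \<open>\<open>\<delta>\<close> runs through the pieces \<open>\<gamma>|I\<^sub>j\<close> with \<open>j \<in> T\<close>, each exactly once and in its original
  direction, in the order given by the list \<open>js\<close>, the \<open>j\<close>-th piece being translated by \<open>v j\<close>.\<close>

definition translation_rearrangement ::
  "(real \<Rightarrow> 'a::real_normed_vector) \<Rightarrow> (nat \<Rightarrow> real) \<Rightarrow> nat set \<Rightarrow> (real \<Rightarrow> 'a) \<Rightarrow> bool" where
  "translation_rearrangement \<gamma> t T \<delta> \<longleftrightarrow>
     (\<exists>js v. distinct js \<and> set js = T \<and>
        \<delta> = concat_curves (map (\<lambda>j. (\<lambda>y. v j + y) \<circ> curve_piece \<gamma> t j) js))"

text \<open>The parts are labelled \<open>P 1, \<dots>, P m\<close> and may be empty.\<close>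

definition indexed_partition :: "nat \<Rightarrow> (nat \<Rightarrow> 'a set) \<Rightarrow> 'a set \<Rightarrow> bool" where
  "indexed_partition m P A \<longleftrightarrow> disjoint_family_on P {1..m} \<and> (\<Union>i\<in>{1..m}. P i) = A"

end

theory Submission
  imports Defs "HOL-Number_Theory.Cong"
begin

text \<open>Let \<open>d = CARD('d)\<close>.  The increments of the \<open>d\<close> coordinates of \<open>\<gamma>\<close> and of its arc length are to be split
equally among \<open>r\<close> recipients (\<open>rainbow_splitting\<close> with \<open>D = d + 1\<close>).  The coordinate increments of the whole
loop are zero, so equal shares are zero, and the pieces of each recipient can be translated and
concatenated to a loop; equal shares of arc length mean equal lengths.

All ways to cut and to distribute the pieces, with at most one piece of each class for every
recipient, form a simplicial complex: a join of chessboard complexes with \<open>r\<close> rows.  After adding auxiliary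
columns one may assume that there are \<open>m\<close> boards with exactly \<open>r - 1\<close> columns and one board with a single
column.  This complex \<open>K\<close> has dimension \<open>N = m (r - 1)\<close>, the cyclic group of order \<open>r\<close> acts freely on it by
rotating the rows, and the shares define an equivariant map \<open>f\<close> from \<open>K\<close> to \<open>m\<close>-tuples of vectors with \<open>r\<close>
entries.  A fair distribution is a point where all \<open>m\<close> vectors are constant (\<open>equivariant_zero\<close>).

That such a point exists is a degree argument modulo \<open>r\<close>.  The boards with \<open>r - 1\<close> columns are
oriented pseudomanifolds; the cone over a fundamental cycle of their join is a cycle modulo \<open>r\<close> in the quotient of
\<open>K\<close>.  A cohomology class of the cyclic group in degree \<open>N\<close> detects it.  In bar coordinates this
class is represented by \<open>theta\<close>, a cup power of the Vandermonde determinant, which modulo \<open>r\<close> is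
translation invariant and a cocycle.  Its pairing with the cycle factors over the boards and is a power of
\<open>(r - 1)!\<close> times the square of a Vandermonde determinant, so \<open>r\<close> does not divide it (\<open>sum_facet_weight_theta\<close>).
If \<open>f\<close> had no zero, a fine subdivision of \<open>K\<close> could be labelled by the positions at which the vectors are maximal.
No vector has its maximum everywhere, so these label sets have at most \<open>N\<close> elements on every simplex with \<open>N + 1\<close>
vertices, and the resulting equivariant chain map would make the pairing zero
(\<open>equivariant_approximate_zero\<close>).  But the pairing is the same for any two equivariant chain maps, because they are
equivariantly homotopic (\<open>equivariant_chain_op_top_degree\<close>).\<close>

section \<open>Cochains on lists\<close>

definition drop_nth :: "nat \<Rightarrow> 'a list \<Rightarrow> 'a list" where
  "drop_nth i l = take i l @ drop (Suc i) l"

lemma length_drop_nth [simp]: "i < length l \<Longrightarrow> length (drop_nth i l) = length l - 1"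
  by (simp add: drop_nth_def)

lemma set_drop_nth: "set (drop_nth i l) \<subseteq> set l"
  by (auto simp: drop_nth_def dest: in_set_takeD in_set_dropD)

lemma drop_nth_0 [simp]: "drop_nth 0 (a # l) = l"
  and drop_nth_Suc [simp]: "drop_nth (Suc i) (a # l) = a # drop_nth i l"
  by (simp_all add: drop_nth_def)

lemma map_drop_nth: "map h (drop_nth i l) = drop_nth i (map h l)"
  by (simp add: drop_nth_def take_map drop_map)

lemma drop_nth_append: "drop_nth (length u) (u @ x # v) = u @ v"
  by (simp add: drop_nth_def)

text \<open>The simplicial machinery is carried by functions on lists.  A list is an ordered, possibly
degenerate simplex, an integer-valued function on lists is a cochain, and \<open>cobd\<close> is the coboundary.
The empty list is a face of every one-element list, so this is the augmented complex; the
augmentation then needs no separate bookkeeping.\<close>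

definition cobd :: "('a list \<Rightarrow> int) \<Rightarrow> 'a list \<Rightarrow> int" where
  "cobd \<eta> l = (\<Sum>i<length l. (-1)^i * \<eta> (drop_nth i l))"

lemma cobd_Nil [simp]: "cobd \<eta> [] = 0"
  by (simp add: cobd_def)

text \<open>Prepending a vertex is a contraction of the complex of all lists; this is the formula for
that contraction, and it lets the coboundary be computed by recursion on lists.\<close>

lemma cobd_Cons: "cobd \<eta> (a # l) = \<eta> l - cobd (\<lambda>f. \<eta> (a # f)) l"
  by (simp add: cobd_def sum.lessThan_Suc_shift sum_negf del: sum.lessThan_Suc)

lemma cobd_cong:
  "(\<And>i. i < length l \<Longrightarrow> \<eta> (drop_nth i l) = \<eta>' (drop_nth i l)) \<Longrightarrow> cobd \<eta> l = cobd \<eta>' l"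
  by (simp add: cobd_def)

lemma cobd_diff: "cobd (\<lambda>f. \<eta> f - \<eta>' f) l = cobd \<eta> l - cobd \<eta>' l"
  by (simp add: cobd_def sum_subtractf algebra_simps)

lemma cobd_scale: "cobd (\<lambda>f. c * \<eta> f) l = c * cobd \<eta> l"
  by (simp add: cobd_def sum_distrib_left mult_ac)

lemma cobd_zero [simp]: "cobd (\<lambda>f. 0) l = 0"
  by (simp add: cobd_def)

lemma cobd_map: "cobd (\<lambda>f. \<eta> (map h f)) l = cobd \<eta> (map h l)"
  by (simp add: cobd_def map_drop_nth)

lemma cobd_append:
  "cobd \<eta> (xs @ ys) = cobd (\<lambda>f. \<eta> (f @ ys)) xs + (-1) ^ length xs * cobd (\<lambda>f. \<eta> (xs @ f)) ys"
  by (induction xs arbitrary: \<eta>) (simp_all add: cobd_Cons)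

lemma cobd_cobd: "cobd (cobd \<eta>) l = 0"
proof (induction l arbitrary: \<eta>)
  case (Cons a l)
  have "cobd (\<lambda>f. cobd \<eta> (a # f)) l = cobd \<eta> l - cobd (cobd (\<lambda>f. \<eta> (a # f))) l"
    by (simp add: cobd_Cons cobd_diff)
  then show ?case
    by (simp add: cobd_Cons[of "cobd \<eta>"] Cons.IH)
qed simp

text \<open>A \<open>chain_op\<close> is the dual of an augmented chain map: it pulls cochains on \<open>'b\<close>-lists back to
cochains on \<open>'a\<close>-lists.  Working dually means that formal sums of simplices never occur.\<close>

definition chain_op :: "(('b list \<Rightarrow> int) \<Rightarrow> 'a list \<Rightarrow> int) \<Rightarrow> bool" where
  "chain_op P \<longleftrightarrow>
     (\<forall>\<eta> l. P (cobd \<eta>) l = cobd (P \<eta>) l) \<and>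
     (\<forall>\<eta>. P \<eta> [] = \<eta> []) \<and>
     (\<forall>\<eta> \<eta>' l. P (\<lambda>f. \<eta> f - \<eta>' f) l = P \<eta> l - P \<eta>' l) \<and>
     (\<forall>c \<eta> l. P (\<lambda>f. c * \<eta> f) l = c * P \<eta> l)"

lemma chain_opD:
  assumes "chain_op P"
  shows chain_op_cobd: "P (cobd \<eta>) l = cobd (P \<eta>) l"
    and chain_op_Nil: "P \<eta> [] = \<eta> []"
    and chain_op_diff: "P (\<lambda>f. \<eta> f - \<eta>' f) l = P \<eta> l - P \<eta>' l"
    and chain_op_scale: "P (\<lambda>f. c * \<eta> f) l = c * P \<eta> l"
  using assms unfolding chain_op_def by blast+

lemma chain_op_map: "chain_op (\<lambda>\<eta> l. \<eta> (map h l))"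
  by (simp add: chain_op_def cobd_map)

lemma chain_op_compose:
  assumes P: "chain_op P" and Q: "chain_op Q"
  shows "chain_op (\<lambda>\<eta>. P (Q \<eta>))"
proof -
  have "P (Q (cobd \<eta>)) l = cobd (P (Q \<eta>)) l" for \<eta> l
  proof -
    have "Q (cobd \<eta>) = cobd (Q \<eta>)" using chain_op_cobd[OF Q] by blast
    then show ?thesis by (simp add: chain_op_cobd[OF P])
  qed
  moreover have "P (Q (\<lambda>f. \<eta> f - \<eta>' f)) l = P (Q \<eta>) l - P (Q \<eta>') l" for \<eta> \<eta>' l
  proof -
    have "Q (\<lambda>f. \<eta> f - \<eta>' f) = (\<lambda>f. Q \<eta> f - Q \<eta>' f)" using chain_op_diff[OF Q] by blast
    then show ?thesis by (simp add: chain_op_diff[OF P])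
  qed
  moreover have "P (Q (\<lambda>f. c * \<eta> f)) l = c * P (Q \<eta>) l" for c \<eta> l
  proof -
    have "Q (\<lambda>f. c * \<eta> f) = (\<lambda>f. c * Q \<eta> f)" using chain_op_scale[OF Q] by blast
    then show ?thesis by (simp add: chain_op_scale[OF P])
  qed
  ultimately show ?thesis
    unfolding chain_op_def by (simp add: chain_op_Nil[OF P] chain_op_Nil[OF Q])
qed

lemma chain_op_funpow:
  fixes P :: "('a list \<Rightarrow> int) \<Rightarrow> 'a list \<Rightarrow> int"
  shows "chain_op P \<Longrightarrow> chain_op (P ^^ j)"
proof (induction j)
  case 0
  show ?case by (simp add: chain_op_def)
next
  case (Suc j)
  then show ?case using chain_op_compose[of P "P ^^ j"] by (simp add: comp_def)
qed

text \<open>\<open>subdiv \<beta>\<close> is dual to the chain map \<open>sd(l) = \<beta>(l) * sd(\<partial>l)\<close>, where \<open>*\<close> is the cone.  For \<open>\<beta>\<close> the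
barycentre this is barycentric subdivision.  Every \<open>\<beta>\<close> gives a chain map, so the same
operator also turns a labelling of simplices into a chain map.\<close>

function subdiv :: "('a list \<Rightarrow> 'b) \<Rightarrow> ('b list \<Rightarrow> int) \<Rightarrow> 'a list \<Rightarrow> int" where
  "subdiv \<beta> \<eta> l = (if l = [] then \<eta> []
     else (\<Sum>i<length l. (-1)^i * subdiv \<beta> (\<lambda>f. \<eta> (\<beta> l # f)) (drop_nth i l)))"
  by pat_completeness auto
termination by (relation "Wellfounded.measure (\<lambda>(\<beta>, \<eta>, l). length l)") auto

declare subdiv.simps [simp del]

lemma subdiv_Nil [simp]: "subdiv \<beta> \<eta> [] = \<eta> []"
  by (simp add: subdiv.simps)

lemma subdiv_nonempty: "l \<noteq> [] \<Longrightarrow> subdiv \<beta> \<eta> l = cobd (subdiv \<beta> (\<lambda>f. \<eta> (\<beta> l # f))) l"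
  by (subst subdiv.simps) (simp add: cobd_def)

lemma subdiv_diff: "subdiv \<beta> (\<lambda>f. \<eta> f - \<eta>' f) l = subdiv \<beta> \<eta> l - subdiv \<beta> \<eta>' l"
proof (induction "length l" arbitrary: l \<eta> \<eta>' rule: less_induct)
  case less
  show ?case
  proof (cases "l = []")
    case False
    have "subdiv \<beta> (\<lambda>f. \<eta> f - \<eta>' f) l =
        cobd (\<lambda>x. subdiv \<beta> (\<lambda>f. \<eta> (\<beta> l # f)) x - subdiv \<beta> (\<lambda>f. \<eta>' (\<beta> l # f)) x) l"
      unfolding subdiv_nonempty[OF False] by (rule cobd_cong) (simp add: less)
    then show ?thesis by (simp add: cobd_diff subdiv_nonempty[OF False])
  qed simp
qed

lemma subdiv_scale: "subdiv \<beta> (\<lambda>f. c * \<eta> f) l = c * subdiv \<beta> \<eta> l"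
proof (induction "length l" arbitrary: l \<eta> rule: less_induct)
  case less
  show ?case
  proof (cases "l = []")
    case False
    have "subdiv \<beta> (\<lambda>f. c * \<eta> f) l = cobd (\<lambda>x. c * subdiv \<beta> (\<lambda>f. \<eta> (\<beta> l # f)) x) l"
      unfolding subdiv_nonempty[OF False] by (rule cobd_cong) (simp add: less)
    then show ?thesis by (simp add: cobd_scale subdiv_nonempty[OF False])
  qed simp
qed

text \<open>Dually, \<open>\<partial>(\<beta>(l) * sd(\<partial>l)) = sd(\<partial>l) - \<beta>(l) * \<partial>sd(\<partial>l)\<close>, and the last term vanishes by induction
because \<open>\<partial>\<partial> = 0\<close>.\<close>

lemma subdiv_cobd: "subdiv \<beta> (cobd \<eta>) l = cobd (subdiv \<beta> \<eta>) l"
proof (induction "length l" arbitrary: l \<eta> rule: less_induct)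
  case less
  show ?case
  proof (cases "l = []")
    case False
    let ?h = "\<lambda>f. \<eta> (\<beta> l # f)"
    have "subdiv \<beta> (cobd \<eta>) l = cobd (subdiv \<beta> (\<lambda>f. \<eta> f - cobd ?h f)) l"
      by (simp add: subdiv_nonempty[OF False] cobd_Cons)
    also have "\<dots> = cobd (subdiv \<beta> \<eta>) l - cobd (subdiv \<beta> (cobd ?h)) l"
      by (simp add: subdiv_diff[abs_def] cobd_diff)
    also have "cobd (subdiv \<beta> (cobd ?h)) l = cobd (cobd (subdiv \<beta> ?h)) l"
      by (rule cobd_cong) (simp add: less)
    finally show ?thesis by (simp add: cobd_cobd)
  qed simp
qed

lemma chain_op_subdiv: "chain_op (subdiv \<beta>)"
  by (simp add: chain_op_def subdiv_cobd subdiv_diff subdiv_scale)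

text \<open>The simplices that occur in \<open>sd(l)\<close>: the values of \<open>\<beta>\<close> along a descending chain of faces of \<open>l\<close>.\<close>

inductive is_flag :: "('a list \<Rightarrow> 'b) \<Rightarrow> 'a list \<Rightarrow> 'b list \<Rightarrow> bool" for \<beta> where
  is_flag_Nil: "is_flag \<beta> [] []"
| is_flag_step: "i < length l \<Longrightarrow> is_flag \<beta> (drop_nth i l) f \<Longrightarrow> is_flag \<beta> l (\<beta> l # f)"

lemma subdiv_cong:
  "(\<And>f. is_flag \<beta> l f \<Longrightarrow> \<eta> f = \<eta>' f) \<Longrightarrow> subdiv \<beta> \<eta> l = subdiv \<beta> \<eta>' l"
proof (induction "length l" arbitrary: l \<eta> \<eta>' rule: less_induct)
  case less
  show ?case
  proof (cases "l = []")
    case True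
    then show ?thesis using less.prems by (simp add: is_flag_Nil)
  next
    case False
    show ?thesis
      unfolding subdiv_nonempty[OF False]
      by (rule cobd_cong) (auto intro!: less.hyps less.prems intro: is_flag_step)
  qed
qed

lemma subdiv_map:
  assumes "\<And>l'. l' \<noteq> [] \<Longrightarrow> set l' \<subseteq> set l \<Longrightarrow> \<beta> (map s l') = s' (\<beta> l')"
  shows "subdiv \<beta> \<eta> (map s l) = subdiv \<beta> (\<lambda>f. \<eta> (map s' f)) l"
  using assms
proof (induction "length l" arbitrary: l \<eta> rule: less_induct)
  case less
  show ?case
  proof (cases "l = []")
    case False
    then have ne: "map s l \<noteq> []" by simp
    have "subdiv \<beta> \<eta> (map s l) = cobd (\<lambda>x. subdiv \<beta> (\<lambda>f. \<eta> (s' (\<beta> l) # f)) (map s x)) l"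
      using less.prems[of l] False by (simp add: subdiv_nonempty[OF ne] cobd_map)
    also have "\<dots> = cobd (subdiv \<beta> (\<lambda>f. \<eta> (s' (\<beta> l) # map s' f))) l"
      using set_drop_nth False
      by (intro cobd_cong less.hyps less.prems) (auto, fastforce)
    finally show ?thesis by (simp add: subdiv_nonempty[OF False])
  qed simp
qed

text \<open>The target complex of all lists is contracted by prepending a vertex.  Two chain maps into it are
therefore homotopic; the homotopy is built by recursion, coning with the vertex \<open>a (hd l)\<close>, which depends
on \<open>l\<close> only through its first vertex.  If \<open>a\<close> is equivariant, so is the homotopy (\<open>homot_map\<close>), which a cone
point chosen once and for all would not give.\<close>

function homot :: "(('b list \<Rightarrow> int) \<Rightarrow> 'a list \<Rightarrow> int) \<Rightarrow> (('b list \<Rightarrow> int) \<Rightarrow> 'a list \<Rightarrow> int) \<Rightarrow>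
    ('a \<Rightarrow> 'b) \<Rightarrow> ('b list \<Rightarrow> int) \<Rightarrow> 'a list \<Rightarrow> int" where
  "homot P Q a \<eta> l = (if l = [] then 0 else
     P (\<lambda>f. \<eta> (a (hd l) # f)) l - Q (\<lambda>f. \<eta> (a (hd l) # f)) l -
     (\<Sum>i<length l. (-1)^i * homot P Q a (\<lambda>f. \<eta> (a (hd l) # f)) (drop_nth i l)))"
  by pat_completeness auto
termination by (relation "Wellfounded.measure (\<lambda>(P, Q, a, \<eta>, l). length l)") auto

declare homot.simps [simp del]

lemma homot_Nil [simp]: "homot P Q a \<eta> [] = 0"
  by (simp add: homot.simps)

lemma homot_nonempty: "l \<noteq> [] \<Longrightarrow> homot P Q a \<eta> l =
     P (\<lambda>f. \<eta> (a (hd l) # f)) l - Q (\<lambda>f. \<eta> (a (hd l) # f)) l -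
     cobd (homot P Q a (\<lambda>f. \<eta> (a (hd l) # f))) l"
  by (subst homot.simps) (simp add: cobd_def)

context
  fixes P Q :: "('b list \<Rightarrow> int) \<Rightarrow> 'a list \<Rightarrow> int" and a :: "'a \<Rightarrow> 'b"
  assumes P: "chain_op P" and Q: "chain_op Q"
begin

lemma homot_diff: "homot P Q a (\<lambda>f. \<eta> f - \<eta>' f) l = homot P Q a \<eta> l - homot P Q a \<eta>' l"
proof (induction "length l" arbitrary: l \<eta> \<eta>' rule: less_induct)
  case less
  show ?case
  proof (cases "l = []")
    case False
    let ?h = "\<lambda>\<eta> f. \<eta> (a (hd l) # f)"
    have "cobd (homot P Q a (\<lambda>f. ?h \<eta> f - ?h \<eta>' f)) l =
        cobd (\<lambda>x. homot P Q a (?h \<eta>) x - homot P Q a (?h \<eta>') x) l"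
      by (rule cobd_cong) (simp add: less)
    then show ?thesis
      by (simp add: homot_nonempty[OF False] chain_op_diff[OF P] chain_op_diff[OF Q] cobd_diff)
  qed simp
qed

lemma homot_scale: "homot P Q a (\<lambda>f. c * \<eta> f) l = c * homot P Q a \<eta> l"
proof (induction "length l" arbitrary: l \<eta> rule: less_induct)
  case less
  show ?case
  proof (cases "l = []")
    case False
    let ?h = "\<lambda>\<eta> f. \<eta> (a (hd l) # f)"
    have "cobd (homot P Q a (\<lambda>f. c * ?h \<eta> f)) l = cobd (\<lambda>x. c * homot P Q a (?h \<eta>) x) l"
      by (rule cobd_cong) (simp add: less)
    then show ?thesis
      by (simp add: homot_nonempty[OF False] chain_op_scale[OF P] chain_op_scale[OF Q] cobd_scale
            algebra_simps)
  qed simp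
qed

lemma homot_cong_mod:
  assumes "\<And>f. [\<eta> f = \<eta>' f] (mod q)"
  shows "[homot P Q a \<eta> l = homot P Q a \<eta>' l] (mod q)"
proof -
  define \<zeta> where "\<zeta> f = (\<eta> f - \<eta>' f) div q" for f
  have "(\<lambda>f. \<eta> f - \<eta>' f) = (\<lambda>f. q * \<zeta> f)"
    using assms by (auto simp: \<zeta>_def cong_iff_dvd_diff)
  then have "homot P Q a \<eta> l - homot P Q a \<eta>' l = q * homot P Q a \<zeta> l"
    using homot_diff[of \<eta> \<eta>' l] homot_scale[of q \<zeta> l] by simp
  then show ?thesis by (simp add: cong_iff_dvd_diff)
qed

lemma homot_is_homotopy:
  "homot P Q a (cobd \<eta>) l + cobd (homot P Q a \<eta>) l = P \<eta> l - Q \<eta> l"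
proof (induction "length l" arbitrary: l \<eta> rule: less_induct)
  case less
  show ?case
  proof (cases "l = []")
    case True
    then show ?thesis by (simp add: chain_op_Nil[OF P] chain_op_Nil[OF Q])
  next
    case False
    let ?h = "\<lambda>f. \<eta> (a (hd l) # f)"
    have h: "(\<lambda>f. cobd \<eta> (a (hd l) # f)) = (\<lambda>f. \<eta> f - cobd ?h f)"
      by (simp add: cobd_Cons)
    have "cobd (homot P Q a (cobd ?h)) l =
        cobd (\<lambda>x. (P ?h x - Q ?h x) - cobd (homot P Q a ?h) x) l"
    proof (rule cobd_cong)
      fix i assume "i < length l"
      then have "length (drop_nth i l) < length l" by simp
      from less[OF this, of ?h]
      show "homot P Q a (cobd ?h) (drop_nth i l) =
          (P ?h (drop_nth i l) - Q ?h (drop_nth i l)) - cobd (homot P Q a ?h) (drop_nth i l)"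
        by simp
    qed
    also have "\<dots> = P (cobd ?h) l - Q (cobd ?h) l"
      by (simp add: cobd_diff cobd_cobd chain_op_cobd[OF P] chain_op_cobd[OF Q])
    finally show ?thesis
      unfolding homot_nonempty[OF False] h
      by (simp add: chain_op_diff[OF P] chain_op_diff[OF Q] homot_diff[abs_def] cobd_diff)
  qed
qed

lemma homot_map:
  assumes L: "L l" "\<And>l i. L l \<Longrightarrow> i < length l \<Longrightarrow> L (drop_nth i l)"
    and "\<And>l \<eta>. L l \<Longrightarrow> P \<eta> (map s l) = P (\<lambda>f. \<eta> (map s' f)) l"
    and "\<And>l \<eta>. L l \<Longrightarrow> Q \<eta> (map s l) = Q (\<lambda>f. \<eta> (map s' f)) l"
    and a: "\<And>l x. L l \<Longrightarrow> x \<in> set l \<Longrightarrow> a (s x) = s' (a x)"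
  shows "homot P Q a \<eta> (map s l) = homot P Q a (\<lambda>f. \<eta> (map s' f)) l"
  using L(1)
proof (induction "length l" arbitrary: l \<eta> rule: less_induct)
  case less
  show ?case
  proof (cases "l = []")
    case False
    then have ne: "map s l \<noteq> []" by simp
    have hd: "a (hd (map s l)) = s' (a (hd l))"
      using a[OF less.prems] False by (simp add: hd_map)
    let ?h = "\<lambda>f. \<eta> (s' (a (hd l)) # f)"
    have "cobd (homot P Q a ?h) (map s l) = cobd (\<lambda>x. homot P Q a ?h (map s x)) l"
      by (simp add: cobd_map)
    also have "\<dots> = cobd (homot P Q a (\<lambda>f. ?h (map s' f))) l"
      by (rule cobd_cong, rule less.hyps) (auto intro: L less.prems)
    finally show ?thesis
      unfolding homot_nonempty[OF False] homot_nonempty[OF ne] hd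
      by (simp add: assms(3,4)[OF less.prems])
  qed simp
qed

end

section \<open>A Vandermonde cocycle and its cup powers\<close>

text \<open>The Vandermonde product, read as a cochain on lists of residues modulo \<open>r\<close>.  It is invariant
under translation and alternating, and on lists of length \<open>r\<close> it is not divisible by the prime \<open>r\<close>
exactly if the list contains every residue.\<close>

fun vand :: "int list \<Rightarrow> int" where
  "vand [] = 1"
| "vand (x # l) = (\<Prod>y\<leftarrow>l. y - x) * vand l"

lemma vand_cong_mod:
  assumes "list_all2 (\<lambda>x y. [x = y] (mod q)) l l'"
  shows "[vand l = vand l'] (mod q)"
  using assms
proof induction
  case (Cons x l y l')
  have "[(\<Prod>z\<leftarrow>l. z - x) = (\<Prod>z\<leftarrow>l'. z - y)] (mod q)"
    using Cons(2,1) by induction (auto intro!: cong_mult cong_diff)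
  then show ?case using Cons.IH by (auto intro: cong_mult)
qed simp

lemma vand_swap: "vand (xs @ a # b # ys) = - vand (xs @ b # a # ys)"
proof (induction xs)
  case Nil
  show ?case by (simp add: algebra_simps)
qed (simp add: mult_ac)

lemma vand_not_distinct: "\<not> distinct l \<Longrightarrow> vand l = 0"
proof (induction l)
  case (Cons a l)
  then show ?case
    by (cases "a \<in> set l") (auto simp: prod_list_zero_iff image_iff)
qed simp

lemma vand_move: "vand (xs @ a # ms @ ys) = (-1) ^ length ms * vand (xs @ ms @ a # ys)"
proof (induction ms arbitrary: xs)
  case (Cons c ms)
  have "vand (xs @ a # (c # ms) @ ys) = - vand ((xs @ [c]) @ a # ms @ ys)"
    using vand_swap[of xs a c "ms @ ys"] by simp
  also have "vand ((xs @ [c]) @ a # ms @ ys) = (-1) ^ length ms * vand ((xs @ [c]) @ ms @ a # ys)"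
    by (rule Cons.IH)
  finally show ?case by simp
qed simp

lemma vand_transpose: "vand (xs @ a # ms @ b # ys) = - vand (xs @ b # ms @ a # ys)"
proof -
  have "vand (xs @ a # ms @ b # ys) = (-1) ^ length ms * vand (xs @ ms @ a # b # ys)"
    by (rule vand_move)
  also have "\<dots> = - ((-1) ^ length ms * vand (xs @ ms @ b # a # ys))"
    using vand_swap[of "xs @ ms" a b ys] by simp
  also have "(-1) ^ length ms * vand (xs @ ms @ b # a # ys) = vand (xs @ b # ms @ a # ys)"
    by (rule vand_move[symmetric])
  finally show ?thesis .
qed

lemma vand_square_mset:
  assumes "mset l = mset l'"
  shows "(vand l)\<^sup>2 = (vand l')\<^sup>2"
  using assms
proof (induction l arbitrary: l')
  case (Cons a l)
  then have "a \<in> set l'" by (metis list.set_intros(1) set_mset_mset)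
  then obtain us vs where l': "l' = us @ a # vs" by (meson split_list)
  then have m: "mset l = mset (us @ vs)" using Cons.prems by simp
  have "vand l' = (-1) ^ length us * vand (a # us @ vs)"
    using vand_move[of "[]" a us vs] by (simp add: l' flip: power_mult_distrib mult.assoc)
  then have "(vand l')\<^sup>2 = (vand (a # us @ vs))\<^sup>2"
    by (simp add: power_mult_distrib flip: power_mult)
  also have "vand (a # us @ vs) = (\<Prod>y\<leftarrow>us @ vs. y - a) * vand (us @ vs)" by simp
  also have "(\<Prod>y\<leftarrow>us @ vs. y - a) = (\<Prod>y\<leftarrow>l. y - a)"
    using m by (metis mset_map prod_mset_prod_list)
  finally have "(vand l')\<^sup>2 = ((\<Prod>y\<leftarrow>l. y - a) * vand (us @ vs))\<^sup>2" .
  then show ?case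
    using Cons.IH[OF m] by (simp add: power_mult_distrib)
qed simp

text \<open>If two entries agree, deleting any third one leaves a repetition, and deleting either of the two
gives lists that differ by a cyclic move; the signs cancel.\<close>

lemma cobd_vand_not_distinct: "\<not> distinct l \<Longrightarrow> cobd vand l = 0"
proof -
  assume "\<not> distinct l"
  then obtain xs ms ys a where l: "l = xs @ [a] @ ms @ [a] @ ys"
    using not_distinct_decomp by blast
  have z: "vand f = 0" if "count (mset f) a \<ge> 2" for f
    by (rule vand_not_distinct) (use that in \<open>force simp: distinct_count_atmost_1 split: if_splits\<close>)
  have "cobd vand l = cobd (\<lambda>f. vand (f @ a # ms @ a # ys)) xs +
      (-1) ^ length xs * (vand (xs @ ms @ a # ys)
        - (cobd (\<lambda>f. vand (xs @ a # f @ a # ys)) ms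
           + (-1) ^ length ms * (vand (xs @ a # ms @ ys) - cobd (\<lambda>f. vand (xs @ a # ms @ a # f)) ys)))"
    by (simp add: l cobd_append cobd_Cons)
  also have "cobd (\<lambda>f. vand (f @ a # ms @ a # ys)) xs = 0"
    by (simp add: z)
  also have "cobd (\<lambda>f. vand (xs @ a # f @ a # ys)) ms = 0"
    by (simp add: z)
  also have "cobd (\<lambda>f. vand (xs @ a # ms @ a # f)) ys = 0"
    by (simp add: z)
  finally show ?thesis
    by (simp add: vand_move)
qed

text \<open>The generator of the cyclic group acting on the labels \<open>0, \<dots>, r - 1\<close>.\<close>

definition rot :: "nat \<Rightarrow> int \<Rightarrow> int" where
  "rot r x = (x + 1) mod int r"

lemma vand_rot: "[vand (map (rot r) l) = vand l] (mod int r)"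
proof -
  have "vand (map (\<lambda>x. x + 1) l) = vand l"
    by (induction l) (simp_all add: comp_def)
  moreover have "[vand (map (rot r) l) = vand (map (\<lambda>x. x + 1) l)] (mod int r)"
    by (rule vand_cong_mod) (simp add: list_all2_conv_all_nth rot_def)
  ultimately show ?thesis by simp
qed

text \<open>By the pigeonhole principle \<open>r + 1\<close> residues contain a repetition, so \<open>vand\<close> is a cocycle in
degree \<open>r - 1\<close>.\<close>

lemma cobd_vand_mod:
  assumes "length l = Suc r" "r > 0"
  shows "[cobd vand l = 0] (mod int r)"
proof -
  let ?l = "map (\<lambda>x. x mod int r) l"
  have "[cobd vand ?l = cobd vand l] (mod int r)"
    unfolding cobd_def length_map
    by (rule cong_sum, rule cong_scalar_left, rule vand_cong_mod)
      (simp add: list_all2_conv_all_nth flip: map_drop_nth)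
  moreover have "\<not> distinct ?l"
  proof
    assume "distinct ?l"
    then have "Suc r = card (set ?l)" using assms(1) distinct_card[of ?l] by simp
    also have "\<dots> \<le> card {0..<int r}"
      by (rule card_mono) (use assms in auto)
    finally show False by simp
  qed
  ultimately show ?thesis
    by (simp add: cobd_vand_not_distinct cong_sym_eq)
qed

text \<open>The \<open>m\<close>-fold cup power of \<open>vand\<close>: consecutive windows of length \<open>r\<close> overlap in one entry.  It has
degree \<open>m (r - 1)\<close> and represents a nonzero class of the cyclic group of order \<open>r\<close> modulo \<open>r\<close>; the
nonvanishing is made explicit by \<open>sum_facet_weight_theta\<close> below.\<close>

fun theta :: "nat \<Rightarrow> nat \<Rightarrow> int list \<Rightarrow> int" where
  "theta r 0 l = (if length l = 1 then 1 else 0)"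
| "theta r (Suc m) l = vand (take r l) * theta r m (drop (r - 1) l)"

lemma theta_length: "r > 1 \<Longrightarrow> theta r m l \<noteq> 0 \<Longrightarrow> length l = m * (r - 1) + 1"
proof (induction m arbitrary: l)
  case (Suc m)
  then have "length (drop (r - 1) l) = m * (r - 1) + 1"
    by (intro Suc.IH) auto
  then show ?case by simp
qed (auto split: if_splits)

text \<open>Two neighbouring positions always lie in a common window, because the windows overlap.\<close>

lemma theta_repeat: "r > 1 \<Longrightarrow> theta r m (us @ x # x # ws) = 0"
proof (induction m arbitrary: us)
  case (Suc m)
  show ?case
  proof (cases "length us < r - 1")
    case True
    then have "vand (take r (us @ x # x # ws)) = 0"
      by (intro vand_not_distinct) (auto simp: take_Cons' not_less)
    then show ?thesis by simp
  next
    case False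
    then have "drop (r - 1) (us @ x # x # ws) = drop (r - 1) us @ x # x # ws" by simp
    then show ?thesis
      using Suc.IH[OF Suc.prems, of "drop (r - 1) us"] by simp
  qed
qed simp

lemma theta_rot: "[theta r m (map (rot r) l) = theta r m l] (mod int r)"
proof (induction m arbitrary: l)
  case (Suc m)
  show ?case
    by (simp add: take_map drop_map cong_mult[OF vand_rot Suc])
qed simp

text \<open>The Leibniz rule for the cup product of \<open>vand\<close> with a cocycle.\<close>

lemma cobd_theta: "[cobd (theta r m) l = 0] (mod int r)" if r: "r > 1"
proof (induction m arbitrary: l)
  case 0
  show ?case
  proof (cases "length l = 2")
    case True
    then obtain a b where "l = [a, b]" by (metis (no_types) length_0_conv length_Suc_conv numeral_2_eq_2)
    then show ?thesis by (simp add: cobd_Cons)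
  next
    case False
    then have "cobd (theta r 0) l = cobd (\<lambda>f. 0) l"
      by (intro cobd_cong) auto
    then show ?thesis by (simp del: theta.simps)
  qed
next
  case (Suc m)
  show ?case
  proof (cases "length l = Suc m * (r - 1) + 2")
    case False
    have "cobd (theta r (Suc m)) l = cobd (\<lambda>f. 0) l"
    proof (rule cobd_cong, rule ccontr)
      fix i assume "i < length l" "theta r (Suc m) (drop_nth i l) \<noteq> 0"
      then have "length l - 1 = Suc m * (r - 1) + 1"
        using theta_length[OF r, of "Suc m" "drop_nth i l"] by (simp del: theta.simps)
      then show False using False by simp
    qed
    then show ?thesis by (simp del: theta.simps)
  next
    case True
    define xs a zs where "xs = take (r - 1) l" and "a = l ! (r - 1)" and "zs = drop r l"
    have "r - 1 < length l" using True by simp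
    then have l: "l = (xs @ [a]) @ zs"
      using r id_take_nth_drop[of "r - 1" l] by (simp add: xs_def a_def zs_def)
    have len: "length xs = r - 1" "length zs = m * (r - 1) + 1"
      using True r by (simp_all add: xs_def zs_def)
    then obtain b zs' where zs: "zs = b # zs'" by (cases zs) auto
    let ?t = "theta r m zs" and ?v = "vand (xs @ [a])"
    have 1: "theta r (Suc m) (f @ zs) = ?t * vand (f @ [b])" if "length f = r - 1" for f
      using that r by (simp add: zs take_Cons')
    have 2: "theta r (Suc m) ((xs @ [a]) @ f) = ?v * theta r m (a # f)" for f
      using len r by simp
    have "cobd (\<lambda>f. theta r (Suc m) (f @ zs)) (xs @ [a]) = ?t * cobd (\<lambda>f. vand (f @ [b])) (xs @ [a])"
      unfolding cobd_scale[symmetric] by (rule cobd_cong, rule 1) (use len r in simp)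
    moreover have "cobd (\<lambda>f. theta r (Suc m) ((xs @ [a]) @ f)) zs =
        ?v * (?t - cobd (theta r m) (a # zs))"
      unfolding 2 cobd_scale by (simp add: cobd_Cons)
    moreover have "cobd vand ((xs @ [a]) @ [b]) =
        cobd (\<lambda>f. vand (f @ [b])) (xs @ [a]) + (-1) ^ r * ?v"
      using cobd_append[of vand "xs @ [a]" "[b]"] len r by (simp add: cobd_Cons)
    ultimately have "cobd (theta r (Suc m)) l =
        ?t * (cobd vand ((xs @ [a]) @ [b]) - (-1) ^ r * ?v)
         + (-1) ^ r * (?v * (?t - cobd (theta r m) (a # zs)))"
      unfolding l cobd_append[of _ "xs @ [a]" zs] using len r by simp
    also have "\<dots> = ?t * cobd vand ((xs @ [a]) @ [b]) - (-1) ^ r * ?v * cobd (theta r m) (a # zs)"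
      by (simp add: algebra_simps)
    also have "[\<dots> = ?t * 0 - (-1) ^ r * ?v * 0] (mod int r)"
      by (intro cong_diff cong_scalar_left Suc cobd_vand_mod) (use len r in auto)
    finally show ?thesis by (simp del: theta.simps)
  qed
qed

section \<open>The fundamental cycle of a join of chessboards\<close>

text \<open>A word of length \<open>m (r - 1)\<close> assigns to each of the first \<open>m (r - 1)\<close> columns a row; its \<open>m\<close> consecutive
blocks of length \<open>r - 1\<close> stand for \<open>m\<close> chessboards with \<open>r\<close> rows and \<open>r - 1\<close> columns.\<close>

definition words :: "nat \<Rightarrow> nat \<Rightarrow> int list set" where
  "words r n = {g. length g = n \<and> set g \<subseteq> {0..<int r}}"

lemma words_0 [simp]: "words r 0 = {[]}"
  by (auto simp: words_def)

lemma finite_words [simp]: "finite (words r n)"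
proof -
  have "words r n = {g. set g \<subseteq> {0..<int r} \<and> length g = n}" by (auto simp: words_def)
  then show ?thesis by (simp add: finite_lists_length_eq)
qed

lemma sum_words_Suc: "(\<Sum>g\<in>words r (Suc n). H g) = (\<Sum>x\<in>{0..<int r}. \<Sum>g\<in>words r n. H (x # g))"
  for H :: "int list \<Rightarrow> 'b::comm_monoid_add"
proof -
  have "(\<Sum>p\<in>{0..<int r} \<times> words r n. H (fst p # snd p)) = (\<Sum>g\<in>words r (Suc n). H g)"
    by (rule sum.reindex_bij_witness[of _ "\<lambda>g. (hd g, tl g)" "\<lambda>p. fst p # snd p"])
      (auto simp: words_def length_Suc_conv)
  then show ?thesis by (simp add: sum.cartesian_product case_prod_unfold)
qed

lemma sum_words_append:
  "(\<Sum>g\<in>words r (a + b). H g) = (\<Sum>u\<in>words r a. \<Sum>v\<in>words r b. H (u @ v))"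
  for H :: "int list \<Rightarrow> 'b::comm_monoid_add"
proof (induction a arbitrary: H)
  case (Suc a)
  show ?case by (simp add: sum_words_Suc Suc.IH)
qed simp

lemma rot_inverse:
  assumes "x \<in> {0..<int r}"
  shows "(rot r x - 1) mod int r = x" "rot r ((x - 1) mod int r) = x"
  using assms by (simp_all add: rot_def mod_diff_left_eq mod_add_left_eq)

lemma rot_range: "r > 0 \<Longrightarrow> rot r x \<in> {0..<int r}"
  by (simp add: rot_def)

lemma bij_rot: "bij_betw (rot r) {0..<int r} {0..<int r}" if "r > 0"
  using that rot_inverse rot_range
  by (intro bij_betw_byWitness[where f' = "\<lambda>x. (x - 1) mod int r"]) auto

lemma bij_map_rot: "bij_betw (map (rot r)) (words r n) (words r n)" if "r > 0"
proof -
  let ?s = "\<lambda>x. (x - 1) mod int r"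
  have i: "map ?s (map (rot r) g) = g" "map (rot r) (map ?s g) = g" if "g \<in> words r n" for g
  proof -
    have "x \<in> {0..<int r}" if "x \<in> set g" for x
      using that \<open>g \<in> words r n\<close> by (auto simp: words_def)
    then show "map ?s (map (rot r) g) = g" "map (rot r) (map ?s g) = g"
      unfolding map_map by (auto intro!: map_idI simp: rot_inverse simp del: atLeastLessThan_iff)
  qed
  show ?thesis
  proof (rule bij_betw_byWitness[where f' = "map ?s"])
    show "map (rot r) ` words r n \<subseteq> words r n"
      using rot_range[OF that] by (auto simp: words_def)
    show "map ?s ` words r n \<subseteq> words r n"
      using that by (auto simp: words_def)
  qed (use i in blast)+
qed

text \<open>If the entries of \<open>u\<close> are \<open>r - 1\<close> distinct rows, only the missing row \<open>h\<close> contributes, and up to a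
constant the value is the sign of the resulting permutation: the orientation of the facet \<open>u\<close> of
the chessboard pseudomanifold.  All other words get weight zero, so sums may run over all words.\<close>

definition block_weight :: "nat \<Rightarrow> int list \<Rightarrow> int" where
  "block_weight r u = (\<Sum>h\<in>{0..<int r}. vand (u @ [h]))"

fun facet_weight :: "nat \<Rightarrow> nat \<Rightarrow> int list \<Rightarrow> int" where
  "facet_weight r 0 g = 1"
| "facet_weight r (Suc m) g = block_weight r (take (r - 1) g) * facet_weight r m (drop (r - 1) g)"

lemma facet_weight_nonzero_distinct:
  assumes "facet_weight r m g \<noteq> 0" "length g = m * (r - 1)" "r > 1"
    and "i < length g" "j < length g" "i \<noteq> j" "i div (r - 1) = j div (r - 1)"
  shows "g ! i \<noteq> g ! j"
  using assms(1,2,4-)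
proof (induction m arbitrary: g i j)
  case (Suc m)
  have d: "distinct (take (r - 1) g)"
  proof (rule ccontr)
    assume "\<not> distinct (take (r - 1) g)"
    then have "block_weight r (take (r - 1) g) = 0"
      unfolding block_weight_def by (intro sum.neutral ballI vand_not_distinct) simp
    then show False using Suc.prems(1) by simp
  qed
  have same: "x < r - 1" if "y < r - 1" "x div (r - 1) = y div (r - 1)" for x y
  proof -
    have "x div (r - 1) = 0" using that by simp
    then show ?thesis using assms(3) by (simp add: div_eq_0_iff)
  qed
  show ?case
  proof (cases "i < r - 1")
    case True
    then have "j < r - 1" using same[OF True] Suc.prems(6) by metis
    then show ?thesis
      using nth_eq_iff_index_eq[OF d, of i j] True Suc.prems(3-5) by simp
  next
    case False
    then have i: "r - 1 \<le> i" by simp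
    have j: "r - 1 \<le> j" using False same[OF _ Suc.prems(6)] by (meson not_less)
    have "drop (r - 1) g ! (i - (r - 1)) \<noteq> drop (r - 1) g ! (j - (r - 1))"
    proof (rule Suc.IH)
      show "facet_weight r m (drop (r - 1) g) \<noteq> 0" using Suc.prems(1) by auto
      show "length (drop (r - 1) g) = m * (r - 1)" using Suc.prems(2) by simp
      show "i - (r - 1) < length (drop (r - 1) g)" "j - (r - 1) < length (drop (r - 1) g)"
        using Suc.prems(3,4) i j by simp_all
      show "i - (r - 1) \<noteq> j - (r - 1)" using Suc.prems(5) i j by linarith
      have "i div (r - 1) = Suc ((i - (r - 1)) div (r - 1))"
        "j div (r - 1) = Suc ((j - (r - 1)) div (r - 1))"
        by (rule le_div_geq; use i j assms(3) in simp)+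
      then show "(i - (r - 1)) div (r - 1) = (j - (r - 1)) div (r - 1)"
        using Suc.prems(6) by linarith
    qed
    then show ?thesis using i j Suc.prems(3,4) by simp
  qed
qed simp

lemma block_weight_rot: "[block_weight r (map (rot r) u) = block_weight r u] (mod int r)" if "r > 0"
proof -
  have "block_weight r (map (rot r) u) = (\<Sum>h\<in>{0..<int r}. vand (map (rot r) (u @ [h])))"
    unfolding block_weight_def using sum.reindex_bij_betw[OF bij_rot[OF that], of "\<lambda>h. vand (map (rot r) u @ [h])"]
    by simp
  also have "[\<dots> = block_weight r u] (mod int r)"
    unfolding block_weight_def by (intro cong_sum vand_rot)
  finally show ?thesis .
qed

lemma facet_weight_rot: "[facet_weight r m (map (rot r) g) = facet_weight r m g] (mod int r)" if "r > 0"
proof (induction m arbitrary: g)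
  case (Suc m)
  show ?case
    unfolding facet_weight.simps take_map drop_map by (rule cong_mult[OF block_weight_rot[OF that] Suc])
qed simp

text \<open>The chessboard complex is an oriented pseudomanifold: the facets through a given codimension one
face cancel.  Here this is the antisymmetry of \<open>vand\<close> in the running entry and the missing row.\<close>

lemma sum_facet_weight_entry:
  assumes "length u + Suc (length v) = m * (r - 1)"
  shows "(\<Sum>x\<in>{0..<int r}. facet_weight r m (u @ x # v)) = 0"
  using assms
proof (induction m arbitrary: u v)
  case (Suc m)
  show ?case
  proof (cases "length u < r - 1")
    case True
    define v1 where "v1 = take (r - 1 - Suc (length u)) v"
    define R where "R = {0..<int r}"
    define S where "S = (\<Sum>x\<in>R. \<Sum>h\<in>R. vand (u @ x # v1 @ [h]))"
    have t: "take (r - 1) (u @ x # v) = u @ x # v1" for x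
      using True by (simp add: v1_def take_Cons')
    have d: "drop (r - 1) (u @ x # v) = drop (r - 1 - Suc (length u)) v" for x
      using True by (simp add: drop_Cons')
    have "S = (\<Sum>h\<in>R. \<Sum>x\<in>R. vand (u @ x # v1 @ [h]))"
      unfolding S_def by (rule sum.swap)
    also have "\<dots> = (\<Sum>h\<in>R. \<Sum>x\<in>R. - vand (u @ h # v1 @ [x]))"
      by (intro sum.cong refl vand_transpose[where ys = "[]"])
    also have "\<dots> = - S"
      by (simp add: S_def sum_negf)
    finally have "S = 0" by simp
    then show ?thesis
      unfolding facet_weight.simps t d block_weight_def R_def[symmetric] by (simp add: S_def flip: sum_distrib_right)
  next
    case False
    then have t: "take (r - 1) (u @ x # v) = take (r - 1) u"
      "drop (r - 1) (u @ x # v) = drop (r - 1) u @ x # v" for x by simp_all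
    have "(\<Sum>x\<in>{0..<int r}. facet_weight r m (drop (r - 1) u @ x # v)) = 0"
      by (rule Suc.IH) (use Suc.prems False in simp)
    then show ?thesis
      unfolding facet_weight.simps t by (simp flip: sum_distrib_left)
  qed
qed simp

lemma map_snd_enumerate: "map (\<lambda>(i, k). (i, h k)) (List.enumerate n g) = List.enumerate n (map h g)"
  by (induction g arbitrary: n) simp_all

lemma sum_facet_weight_cobd_inner:
  "(\<Sum>g\<in>words r (m * (r - 1)). facet_weight r m g * cobd \<eta> (List.enumerate 0 g)) = 0"
proof -
  let ?N = "m * (r - 1)"
  have "(\<Sum>g\<in>words r ?N. facet_weight r m g * \<eta> (drop_nth i (List.enumerate 0 g))) = 0" if i: "i < ?N" for i
  proof -
    have N: "?N = i + Suc (?N - Suc i)" using i by simp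
    have "(\<Sum>g\<in>words r ?N. facet_weight r m g * \<eta> (drop_nth i (List.enumerate 0 g))) =
      (\<Sum>u\<in>words r i. \<Sum>x\<in>{0..<int r}. \<Sum>v\<in>words r (?N - Suc i).
         facet_weight r m (u @ x # v) * \<eta> (drop_nth i (List.enumerate 0 (u @ x # v))))"
      by (subst N) (simp only: sum_words_append sum_words_Suc)
    also have "\<dots> = (\<Sum>u\<in>words r i. \<Sum>x\<in>{0..<int r}. \<Sum>v\<in>words r (?N - Suc i).
         facet_weight r m (u @ x # v) * \<eta> (List.enumerate 0 u @ List.enumerate (Suc i) v))"
    proof (intro sum.cong refl)
      fix u v x assume "u \<in> words r i"
      then have "length u = i" by (simp add: words_def)
      then have "drop_nth i (List.enumerate 0 (u @ x # v)) = List.enumerate 0 u @ List.enumerate (Suc i) v"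
        using drop_nth_append[of "List.enumerate 0 u" "(i, x)" "List.enumerate (Suc i) v"]
        by (simp add: enumerate_append_eq)
      then show "facet_weight r m (u @ x # v) * \<eta> (drop_nth i (List.enumerate 0 (u @ x # v))) =
          facet_weight r m (u @ x # v) * \<eta> (List.enumerate 0 u @ List.enumerate (Suc i) v)" by simp
    qed
    also have "\<dots> = (\<Sum>u\<in>words r i. \<Sum>v\<in>words r (?N - Suc i).
        (\<Sum>x\<in>{0..<int r}. facet_weight r m (u @ x # v)) * \<eta> (List.enumerate 0 u @ List.enumerate (Suc i) v))"
      by (subst sum.swap) (simp add: sum_distrib_right)
    also have "\<dots> = 0"
    proof (intro sum.neutral ballI)
      fix u v assume "u \<in> words r i" "v \<in> words r (?N - Suc i)"
      then have "(\<Sum>x\<in>{0..<int r}. facet_weight r m (u @ x # v)) = 0"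
        using i by (intro sum_facet_weight_entry) (simp add: words_def)
      then show "(\<Sum>x\<in>{0..<int r}. facet_weight r m (u @ x # v)) * \<eta> (List.enumerate 0 u @ List.enumerate (Suc i) v) = 0"
        by simp
    qed
    finally show ?thesis .
  qed
  note z = this
  have "(\<Sum>g\<in>words r ?N. facet_weight r m g * cobd \<eta> (List.enumerate 0 g)) =
      (\<Sum>g\<in>words r ?N. \<Sum>i<?N. (-1)^i * (facet_weight r m g * \<eta> (drop_nth i (List.enumerate 0 g))))"
    by (intro sum.cong refl) (simp add: cobd_def words_def sum_distrib_left mult_ac)
  also have "\<dots> = (\<Sum>i<?N. (-1)^i * (\<Sum>g\<in>words r ?N. facet_weight r m g * \<eta> (drop_nth i (List.enumerate 0 g))))"
    by (subst sum.swap) (simp add: sum_distrib_left)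
  also have "\<dots> = 0" by (rule sum.neutral) (use z in auto)
  finally show ?thesis .
qed

text \<open>The cyclic group acts freely on nonempty words, so a sum of an invariant function over all words
consists of orbits of size \<open>r\<close>.\<close>

lemma sum_words_invariant:
  assumes inv: "\<And>g. g \<in> words r (Suc n) \<Longrightarrow> [\<phi> (map (rot r) g) = \<phi> g] (mod int r)" and r: "r > 0"
  shows "[(\<Sum>g\<in>words r (Suc n). \<phi> g) = 0] (mod int r)"
proof -
  define \<psi> where "\<psi> x = (\<Sum>g\<in>words r n. \<phi> (x # g))" for x
  have step: "[\<psi> (rot r x) = \<psi> x] (mod int r)" if "x \<in> {0..<int r}" for x
  proof -
    have "\<psi> (rot r x) = (\<Sum>g\<in>words r n. \<phi> (map (rot r) (x # g)))"
      unfolding \<psi>_def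
      using sum.reindex_bij_betw[OF bij_map_rot[OF r, of n], of "\<lambda>g. \<phi> (rot r x # g)"] by simp
    also have "[\<dots> = \<psi> x] (mod int r)"
      unfolding \<psi>_def by (intro cong_sum inv) (use that in \<open>auto simp: words_def\<close>)
    finally show ?thesis .
  qed
  have const: "[\<psi> (int k) = \<psi> 0] (mod int r)" if "k < r" for k
    using that
  proof (induction k)
    case (Suc k)
    then have "rot r (int k) = int (Suc k)" by (simp add: rot_def)
    then show ?case using step[of "int k"] Suc by (auto intro: cong_trans)
  qed simp
  have "(\<Sum>g\<in>words r (Suc n). \<phi> g) = (\<Sum>x\<in>{0..<int r}. \<psi> x)"
    by (simp add: sum_words_Suc \<psi>_def)
  also have "[\<dots> = (\<Sum>x\<in>{0..<int r}. \<psi> 0)] (mod int r)"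
  proof (rule cong_sum)
    fix x assume "x \<in> {0..<int r}"
    then show "[\<psi> x = \<psi> 0] (mod int r)" using const[of "nat x"] by auto
  qed
  also have "(\<Sum>x\<in>{0..<int r}. \<psi> 0) = int r * \<psi> 0" by simp
  also have "[\<dots> = 0] (mod int r)" by (simp add: cong_0_iff)
  finally show ?thesis .
qed

text \<open>Append to every facet of the join of the chessboards one further vertex in row \<open>0\<close>.  The weighted
sum of these simplices becomes a cycle in the quotient by the rotations, modulo \<open>r\<close>: the faces that keep the last vertex
cancel exactly, and the remaining faces cancel modulo \<open>r\<close> against their rotations.\<close>

lemma sum_facet_weight_cobd:
  assumes r: "r > 1" and m: "m > 0"
    and inv: "\<And>g. g \<in> words r (m * (r - 1)) \<Longrightarrow> facet_weight r m g \<noteq> 0 \<Longrightarrow>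
      [\<eta> (List.enumerate 0 (map (rot r) g)) = \<eta> (List.enumerate 0 g)] (mod int r)"
  shows "[(\<Sum>g\<in>words r (m * (r - 1)). facet_weight r m g * cobd \<eta> (List.enumerate 0 (g @ [0]))) = 0] (mod int r)"
proof -
  let ?N = "m * (r - 1)"
  have "facet_weight r m g * cobd \<eta> (List.enumerate 0 (g @ [0])) =
      facet_weight r m g * cobd (\<lambda>f. \<eta> (f @ [(?N, 0)])) (List.enumerate 0 g) +
      (-1) ^ ?N * (facet_weight r m g * \<eta> (List.enumerate 0 g))" if "g \<in> words r ?N" for g
    using that by (simp add: words_def enumerate_append_eq cobd_append cobd_Cons algebra_simps)
  then have "(\<Sum>g\<in>words r ?N. facet_weight r m g * cobd \<eta> (List.enumerate 0 (g @ [0]))) =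
      (-1) ^ ?N * (\<Sum>g\<in>words r ?N. facet_weight r m g * \<eta> (List.enumerate 0 g))"
    by (simp add: sum.distrib sum_facet_weight_cobd_inner sum_distrib_left del: One_nat_def)
  moreover have "[(\<Sum>g\<in>words r ?N. facet_weight r m g * \<eta> (List.enumerate 0 g)) = 0] (mod int r)"
  proof -
    obtain n where N: "?N = Suc n" using r m by (cases ?N) auto
    show ?thesis
      unfolding N
    proof (rule sum_words_invariant)
      fix g assume "g \<in> words r (Suc n)"
      then have g: "g \<in> words r ?N" by (simp only: N)
      show "[facet_weight r m (map (rot r) g) * \<eta> (List.enumerate 0 (map (rot r) g)) =
          facet_weight r m g * \<eta> (List.enumerate 0 g)] (mod int r)"
      proof (cases "facet_weight r m g = 0")
        case True
        then have "[facet_weight r m (map (rot r) g) = 0] (mod int r)"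
          using facet_weight_rot[of r m g] r by simp
        then show ?thesis
          using True by (simp add: cong_0_iff)
      next
        case False
        then show ?thesis using g r by (intro cong_mult facet_weight_rot inv) auto
      qed
    qed (use r in simp)
  qed
  ultimately show ?thesis by (metis cong_scalar_left mult_zero_right)
qed

lemma set_distinct_full_word:
  assumes "distinct w" "length w = r" "set w \<subseteq> {0..<int r}"
  shows "set w = {0..<int r}"
  using assms by (intro card_subset_eq) (simp_all add: distinct_card)

lemma block_weight_times_vand:
  assumes u: "u \<in> words r (r - 1)" and y: "y \<in> {0..<int r}"
  shows "block_weight r u * vand (u @ [y]) = (vand (u @ [y]))\<^sup>2"
proof (cases "distinct (u @ [y])")
  case True
  have "length (u @ [y]) = r" "set (u @ [y]) \<subseteq> {0..<int r}"
    using u y by (simp_all add: words_def)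
  from set_distinct_full_word[OF True this] have S: "insert y (set u) = {0..<int r}" by simp
  have "vand (u @ [h]) = 0" if "h \<in> {0..<int r} - {y}" for h
  proof (rule vand_not_distinct)
    have "h \<in> set u" using that S by blast
    then show "\<not> distinct (u @ [h])" by simp
  qed
  then have "(\<Sum>h\<in>{0..<int r} - {y}. vand (u @ [h])) = 0" by (intro sum.neutral) blast
  then have "block_weight r u = vand (u @ [y])"
    unfolding block_weight_def by (simp add: sum.remove[OF _ y])
  then show ?thesis by (simp add: power2_eq_square)
qed (simp add: vand_not_distinct)

lemma not_dvd_vand:
  assumes "prime r" "distinct l" "set l \<subseteq> {0..<int r}"
  shows "\<not> int r dvd vand l"
  using assms(2,3)
proof (induction l)
  case Nil
  show ?case using assms(1) by (auto dest: prime_gt_1_nat)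
next
  case (Cons x l)
  have p: "prime (int r)" using assms(1) by simp
  have "\<not> int r dvd y - x" if "y \<in> set l" for y
  proof
    assume "int r dvd y - x"
    moreover have "y \<in> {0..<int r}" "x \<in> {0..<int r}" "y \<noteq> x" using Cons.prems that by auto
    then have "\<bar>y - x\<bar> < int r" "y - x \<noteq> 0" by auto
    ultimately show False using dvd_imp_le_int[of "y - x" "int r"] by simp
  qed
  then have "\<not> int r dvd (\<Prod>y\<leftarrow>l. y - x)"
    using not_prime_unit[of "int r"] p by (induction l) (auto simp: prime_dvd_mult_iff[OF p])
  then show ?case using Cons by (simp add: prime_dvd_mult_iff[OF p])
qed

text \<open>The contribution of a single block to the pairing of the cycle with \<open>theta\<close>.\<close>

definition block_sum :: "nat \<Rightarrow> int" where
  "block_sum r = fact (r - 1) * (vand [0..int r - 1])\<^sup>2"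

lemma block_sum_not_dvd: "prime r \<Longrightarrow> \<not> int r dvd block_sum r"
proof -
  assume r: "prime r"
  then have p: "prime (int r)" by simp
  have "\<not> int r dvd int (fact (r - 1))"
    unfolding int_dvd_int_iff using r prime_gt_0_nat[OF r] by (simp add: prime_dvd_fact_iff)
  moreover have "\<not> int r dvd vand [0..int r - 1]"
    by (rule not_dvd_vand[OF r]) auto
  ultimately show ?thesis
    by (simp add: block_sum_def prime_dvd_mult_iff[OF p] prime_dvd_power_iff[OF p])
qed

lemma sum_block_weight_vand:
  assumes y: "y \<in> {0..<int r}"
  shows "(\<Sum>u\<in>words r (r - 1). block_weight r u * vand (u @ [y])) = block_sum r"
proof -
  let ?A = "{0..<int r} - {y}"
  let ?D = "{u. length u = r - 1 \<and> distinct u \<and> set u \<subseteq> ?A}"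
  have "(\<Sum>u\<in>words r (r - 1). block_weight r u * vand (u @ [y])) = (\<Sum>u\<in>words r (r - 1). (vand (u @ [y]))\<^sup>2)"
    by (intro sum.cong refl block_weight_times_vand y)
  also have "\<dots> = (\<Sum>u\<in>?D. (vand (u @ [y]))\<^sup>2)"
  proof (rule sum.mono_neutral_right[OF finite_words])
    show "\<forall>u\<in>words r (r - 1) - ?D. (vand (u @ [y]))\<^sup>2 = 0"
    proof
      fix u assume "u \<in> words r (r - 1) - ?D"
      then have "\<not> distinct (u @ [y])" by (auto simp: words_def)
      then show "(vand (u @ [y]))\<^sup>2 = 0" by (simp add: vand_not_distinct)
    qed
    show "?D \<subseteq> words r (r - 1)" unfolding words_def by blast
  qed
  also have "\<dots> = (\<Sum>u\<in>?D. (vand [0..int r - 1])\<^sup>2)"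
  proof (intro sum.cong refl vand_square_mset)
    fix u assume u: "u \<in> ?D"
    then have d: "distinct (u @ [y])" by auto
    have "length (u @ [y]) = r" "set (u @ [y]) \<subseteq> {0..<int r}"
      using u y by auto
    from set_distinct_full_word[OF d this] have "set (u @ [y]) = {0..<int r}" .
    also have "\<dots> = set [0..int r - 1]" unfolding set_upto by force
    finally have "set (u @ [y]) = set [0..int r - 1]" .
    then show "mset (u @ [y]) = mset [0..int r - 1]"
      using d set_eq_iff_mset_eq_distinct distinct_upto by blast
  qed
  also have "card ?D = fact (r - 1)"
  proof -
    have A: "card ?A = r - 1" "finite ?A" using y by simp_all
    have "card ?D = \<Prod>{card ?A - (r - 1) + 1..card ?A}"
      by (rule card_lists_distinct_length_eq) (simp_all only: A order_refl)
    also have "\<dots> = fact (r - 1)" unfolding A(1) by (simp add: fact_prod)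
    finally show ?thesis .
  qed
  then have "(\<Sum>u\<in>?D. (vand [0..int r - 1])\<^sup>2) = block_sum r"
    by (simp add: block_sum_def)
  finally show ?thesis .
qed

text \<open>The pairing of the cycle with the cocycle.  In each window only the words whose missing row is
the first entry \<open>y\<close> of the next block survive, and for these weight and value of \<open>vand\<close> agree.  Since the
result does not depend on \<open>y\<close>, the blocks can be summed one after another.\<close>

lemma sum_facet_weight_theta:
  assumes "r > 1" "x \<in> {0..<int r}"
  shows "(\<Sum>g\<in>words r (m * (r - 1)). facet_weight r m g * theta r m (g @ [x])) = block_sum r ^ m"
proof (induction m)
  case (Suc m)
  let ?W = "words r (m * (r - 1))"
  have t: "facet_weight r (Suc m) (u @ g) * theta r (Suc m) ((u @ g) @ [x]) =
      (block_weight r u * vand (u @ [hd (g @ [x])])) * (facet_weight r m g * theta r m (g @ [x]))"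
    if "u \<in> words r (r - 1)" for u g
  proof -
    have "take r ((u @ g) @ [x]) = u @ [hd (g @ [x])]"
      using that assms(1) by (cases g) (auto simp: words_def take_Cons')
    then show ?thesis using that by (simp add: words_def)
  qed
  have "(\<Sum>g\<in>words r (Suc m * (r - 1)). facet_weight r (Suc m) g * theta r (Suc m) (g @ [x])) =
      (\<Sum>u\<in>words r (r - 1). \<Sum>g\<in>?W. facet_weight r (Suc m) (u @ g) * theta r (Suc m) ((u @ g) @ [x]))"
    by (simp only: mult_Suc sum_words_append)
  also have "\<dots> = (\<Sum>u\<in>words r (r - 1). \<Sum>g\<in>?W.
       (block_weight r u * vand (u @ [hd (g @ [x])])) * (facet_weight r m g * theta r m (g @ [x])))"
    by (intro sum.cong refl t)
  also have "\<dots> = (\<Sum>g\<in>?W. (\<Sum>u\<in>words r (r - 1). block_weight r u * vand (u @ [hd (g @ [x])])) *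
       (facet_weight r m g * theta r m (g @ [x])))"
    by (subst sum.swap) (simp add: sum_distrib_right)
  also have "\<dots> = (\<Sum>g\<in>?W. block_sum r * (facet_weight r m g * theta r m (g @ [x])))"
  proof (intro sum.cong refl arg_cong2[where f = "(*)"] sum_block_weight_vand)
    fix g assume "g \<in> ?W"
    then show "hd (g @ [x]) \<in> {0..<int r}" using assms(2) by (cases g) (auto simp: words_def)
  qed
  also have "\<dots> = block_sum r ^ Suc m"
    unfolding sum_distrib_left[symmetric] Suc.IH by simp
  finally show ?case .
qed simp

section \<open>Equivariant chain maps and the degree\<close>

definition rotv :: "nat \<Rightarrow> nat \<times> int \<Rightarrow> nat \<times> int" where
  "rotv r v = (fst v, rot r (snd v))"

text \<open>A facet of the join of \<open>m\<close> chessboards and \<open>r\<close> points: column \<open>i\<close> carries a rook in row \<open>T i\<close>, and rooks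
in the same block of columns do not attack each other.  The column \<open>m (r - 1)\<close> forms a block of its own.\<close>

definition admissible :: "nat \<Rightarrow> nat \<Rightarrow> (nat \<Rightarrow> int) \<Rightarrow> bool" where
  "admissible r m T \<longleftrightarrow> (\<forall>i\<le>m * (r - 1). T i \<in> {0..<int r}) \<and>
     (\<forall>i\<le>m * (r - 1). \<forall>j\<le>m * (r - 1). i \<noteq> j \<longrightarrow> i div (r - 1) = j div (r - 1) \<longrightarrow> T i \<noteq> T j)"

definition face :: "nat \<Rightarrow> nat \<Rightarrow> (nat \<Rightarrow> int) \<Rightarrow> (nat \<times> int) list \<Rightarrow> bool" where
  "face r m T l \<longleftrightarrow> admissible r m T \<and> length l \<le> Suc (m * (r - 1)) \<and> (\<forall>v\<in>set l. fst v \<le> m * (r - 1) \<and> snd v = T (fst v))"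

lemma enumerate_conv_map: "List.enumerate 0 g = map (\<lambda>i. (i, g ! i)) [0..<length g]"
  by (rule nth_equalityI) (simp_all add: nth_enumerate_eq)

lemma admissible_word:
  assumes g: "g \<in> words r (m * (r - 1))" and c: "facet_weight r m g \<noteq> 0" and r: "r > 1"
  shows "admissible r m (\<lambda>i. (g @ [0]) ! i)"
proof -
  let ?N = "m * (r - 1)"
  have len: "length g = ?N" and S: "set g \<subseteq> {0..<int r}" using g by (auto simp: words_def)
  have "(g @ [0]) ! i \<in> {0..<int r}" if "i \<le> ?N" for i
  proof (cases "i < ?N")
    case True
    then have "g ! i \<in> set g" using len by simp
    then show ?thesis using S True len by (simp only: nth_append if_True subset_iff)
  next
    case False
    then show ?thesis using that len r by (simp add: nth_append)
  qed
  moreover have less: "i < ?N" if "i \<le> ?N" "j \<le> ?N" "i \<noteq> j" "i div (r - 1) = j div (r - 1)" for i j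
  proof (rule ccontr)
    assume "\<not> i < ?N"
    then have i: "i = ?N" and "j < ?N" using that by simp_all
    then have "j div (r - 1) < m" using r by (simp add: less_mult_imp_div_less)
    then show False using that(4) i r by simp
  qed
  then have "(g @ [0]) ! i \<noteq> (g @ [0]) ! j"
    if "i \<le> ?N" "j \<le> ?N" "i \<noteq> j" "i div (r - 1) = j div (r - 1)" for i j
  proof -
    have "i < length g" "j < length g" using less[OF that] less[of j i] that len by simp_all
    then show ?thesis
      using facet_weight_nonzero_distinct[OF c len r _ _ that(3,4)] by (simp add: nth_append)
  qed
  ultimately show ?thesis unfolding admissible_def by blast
qed

text \<open>The homological core.  Forgetting the columns is one equivariant chain map from the complex to
lists of rows; \<open>P\<close> is dual to another one.  They are equivariantly homotopic, so the cocycle \<open>theta\<close> has the same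
pairing, modulo \<open>r\<close>, with the image of the fundamental cycle under both.  For the first map the pairing
is \<open>block_sum r ^ m\<close>, which \<open>r\<close> does not divide; hence \<open>P\<close> cannot annihilate \<open>theta\<close>.\<close>

theorem equivariant_chain_op_top_degree:
  assumes r: "prime r" and m: "m > 0" and P: "chain_op P"
    and equiv: "\<And>T l \<eta>. face r m T l \<Longrightarrow> P \<eta> (map (rotv r) l) = P (\<lambda>f. \<eta> (map (rot r) f)) l"
  shows "\<exists>T. admissible r m T \<and> P (theta r m) (map (\<lambda>i. (i, T i)) [0..<Suc (m * (r - 1))]) \<noteq> 0"
proof (rule ccontr)
  assume contr: "\<not> ?thesis"
  have r1: "r > 1" using r by (rule prime_gt_1_nat)
  let ?W = "words r (m * (r - 1))" and ?\<theta> = "theta r m"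
  define Q :: "(int list \<Rightarrow> int) \<Rightarrow> (nat \<times> int) list \<Rightarrow> int" where "Q \<eta> l = \<eta> (map snd l)" for \<eta> l
  have Q: "chain_op Q" unfolding Q_def[abs_def] by (rule chain_op_map)
  define D where "D = homot Q P snd ?\<theta>"
  \<comment> \<open>The cocycle is one only modulo \<open>r\<close>, so the homotopy formula has an error divisible by \<open>r\<close>.\<close>
  have hom: "[?\<theta> (map snd l) - P ?\<theta> l = cobd D l] (mod int r)" for l
  proof -
    have "homot Q P snd (\<lambda>_. 0) l = 0"
      using homot_scale[OF Q P, of snd 0 ?\<theta> l] by simp
    then have "[homot Q P snd (cobd ?\<theta>) l = 0] (mod int r)"
      using homot_cong_mod[OF Q P, of "cobd ?\<theta>" "\<lambda>_. 0" "int r" snd l] cobd_theta[OF r1, of m]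
      by simp
    then have "[homot Q P snd (cobd ?\<theta>) l + cobd D l = 0 + cobd D l] (mod int r)"
      by (rule cong_add) simp
    then show ?thesis
      using homot_is_homotopy[OF Q P, of snd ?\<theta> l] by (simp add: D_def Q_def)
  qed
  have inv: "[D (List.enumerate 0 (map (rot r) g)) = D (List.enumerate 0 g)] (mod int r)"
    if g: "g \<in> ?W" and c: "facet_weight r m g \<noteq> 0" for g
  proof -
    let ?l = "List.enumerate 0 g"
    let ?face = "face r m (\<lambda>i. (g @ [0]) ! i)"
    have "List.enumerate 0 (map (rot r) g) = map (rotv r) ?l"
      by (simp add: rotv_def case_prod_unfold flip: map_snd_enumerate)
    moreover have "homot Q P snd ?\<theta> (map (rotv r) ?l) = homot Q P snd (\<lambda>f. ?\<theta> (map (rot r) f)) ?l"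
    proof (rule homot_map[OF Q P, where L = ?face])
      show "?face ?l"
      proof -
        have "length g = m * (r - 1)" using g by (simp add: words_def)
        then have "fst v \<le> m * (r - 1) \<and> snd v = (g @ [0]) ! fst v" if "v \<in> set ?l" for v
          using that by (auto simp: enumerate_conv_map nth_append)
        then show ?thesis
          using admissible_word[OF g c r1] \<open>length g = m * (r - 1)\<close> by (simp add: face_def)
      qed
      show "?face (drop_nth i l)" if "?face l" "i < length l" for l i
        using that set_drop_nth[of i l] unfolding face_def by (auto simp: length_drop_nth)
      show "Q \<eta> (map (rotv r) l) = Q (\<lambda>f. \<eta> (map (rot r) f)) l" for \<eta> l
        by (simp add: Q_def rotv_def comp_def)
      show "P \<eta> (map (rotv r) l) = P (\<lambda>f. \<eta> (map (rot r) f)) l" if "?face l" for \<eta> l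
        using that by (rule equiv)
      show "snd (rotv r x) = rot r (snd x)" for x
        by (simp add: rotv_def)
    qed
    moreover have "[homot Q P snd (\<lambda>f. ?\<theta> (map (rot r) f)) ?l = homot Q P snd ?\<theta> ?l] (mod int r)"
      by (rule homot_cong_mod[OF Q P theta_rot])
    ultimately show ?thesis by (simp add: D_def)
  qed
  have "block_sum r ^ m = (\<Sum>g\<in>?W. facet_weight r m g * ?\<theta> (g @ [0]))"
    using sum_facet_weight_theta[of r 0 m] r1 by simp
  also have "[\<dots> = (\<Sum>g\<in>?W. facet_weight r m g * cobd D (List.enumerate 0 (g @ [0])))] (mod int r)"
  proof (rule cong_sum)
    fix g assume g: "g \<in> ?W"
    show "[facet_weight r m g * ?\<theta> (g @ [0]) = facet_weight r m g * cobd D (List.enumerate 0 (g @ [0]))] (mod int r)"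
    proof (cases "facet_weight r m g = 0")
      case False
      have "List.enumerate 0 (g @ [0]) = map (\<lambda>i. (i, (g @ [0]) ! i)) [0..<Suc (m * (r - 1))]"
        using g by (simp only: enumerate_conv_map length_append_singleton words_def mem_Collect_eq)
      then have "P ?\<theta> (List.enumerate 0 (g @ [0])) = 0"
        using contr admissible_word[OF g False r1] by metis
      moreover have "map snd (List.enumerate 0 (g @ [0])) = g @ [0]" by simp
      ultimately have "[?\<theta> (g @ [0]) = cobd D (List.enumerate 0 (g @ [0]))] (mod int r)"
        using hom[of "List.enumerate 0 (g @ [0])"] by (simp only: diff_0_right)
      then show ?thesis by (rule cong_scalar_left)
    qed simp
  qed
  also have "[(\<Sum>g\<in>?W. facet_weight r m g * cobd D (List.enumerate 0 (g @ [0]))) = 0] (mod int r)"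
    by (rule sum_facet_weight_cobd[OF r1 m inv])
  finally have "int r dvd block_sum r ^ m" by (simp add: cong_0_iff)
  then have "int r dvd block_sum r" using r by (meson prime_dvd_power prime_nat_int_transfer)
  then show False using block_sum_not_dvd[OF r] by contradiction
qed

section \<open>Barycentric subdivision\<close>

type_synonym point = "nat \<times> int \<Rightarrow> real"

text \<open>The points of the closed simplex spanned by the facet \<open>T\<close>, as matrices of barycentric
coordinates indexed by column and row.\<close>

definition realization :: "nat \<Rightarrow> nat \<Rightarrow> (nat \<Rightarrow> int) \<Rightarrow> point set" where
  "realization r m T = {X. (\<forall>v. 0 \<le> X v) \<and> (\<forall>i k. X (i, k) \<noteq> 0 \<longrightarrow> i \<le> m * (r - 1) \<and> k = T i) \<and>
     (\<Sum>i\<le>m * (r - 1). X (i, T i)) = 1}"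

definition bary :: "point list \<Rightarrow> point" where
  "bary l = (\<lambda>v. (\<Sum>X\<leftarrow>l. X v) / length l)"

definition unit_point :: "nat \<times> int \<Rightarrow> point" where
  "unit_point v = (\<lambda>w. if w = v then 1 else 0)"

definition rot_point :: "nat \<Rightarrow> point \<Rightarrow> point" where
  "rot_point r X = (\<lambda>(i, k). if k \<in> {0..<int r} then X (i, (k - 1) mod int r) else 0)"

lemma bary_realization:
  assumes "l \<noteq> []" "set l \<subseteq> realization r m T"
  shows "bary l \<in> realization r m T"
proof -
  let ?N = "m * (r - 1)"
  have pos: "0 \<le> X v" and supp: "\<And>i k. X (i, k) \<noteq> 0 \<Longrightarrow> i \<le> ?N \<and> k = T i"
    and tot: "(\<Sum>i\<le>?N. X (i, T i)) = 1"
    if "X \<in> set l" for X v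
    using that assms(2) unfolding realization_def by blast+
  have "(\<Sum>i\<le>?N. \<Sum>X\<leftarrow>l. X (i, T i)) = length l"
    using tot
  proof (induction l)
    case (Cons X l)
    then show ?case by (simp add: sum.distrib del: sum.atMost_Suc)
  qed simp
  then have "(\<Sum>i\<le>?N. bary l (i, T i)) = 1"
    using assms(1) by (simp add: bary_def flip: sum_divide_distrib)
  moreover have "0 \<le> bary l v" for v
    using pos by (cases v) (auto simp: bary_def intro!: divide_nonneg_nonneg sum_list_nonneg)
  moreover have "i \<le> ?N \<and> k = T i" if "bary l (i, k) \<noteq> 0" for i k
  proof (rule ccontr)
    assume "\<not> ?thesis"
    then have "X (i, k) = 0" if "X \<in> set l" for X using supp[OF that] by blast
    then have "map (\<lambda>X. X (i, k)) l = map (\<lambda>X. 0) l" by (intro map_cong) auto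
    then have "(\<Sum>X\<leftarrow>l. X (i, k)) = 0" by (simp only: sum_list_0)
    then show False using \<open>bary l (i, k) \<noteq> 0\<close> by (simp add: bary_def)
  qed
  ultimately show ?thesis unfolding realization_def by blast
qed

lemma bary_rot: "bary (map (rot_point r) l) = rot_point r (bary l)"
  by (rule ext) (auto simp: bary_def rot_point_def comp_def split: prod.splits)

lemma rot_unit_point: "k \<in> {0..<int r} \<Longrightarrow> rot_point r (unit_point (i, k)) = unit_point (rotv r (i, k))"
proof (rule ext, clarify)
  fix i' k' assume k: "k \<in> {0..<int r}"
  then have "r > 0" by auto
  show "rot_point r (unit_point (i, k)) (i', k') = unit_point (rotv r (i, k)) (i', k')"
  proof (cases "k' \<in> {0..<int r}")
    case True
    have "(k' - 1) mod int r = k \<longleftrightarrow> k' = rot r k"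
      using rot_inverse[OF True] rot_inverse[OF k] by metis
    then show ?thesis using True by (auto simp: rot_point_def unit_point_def rotv_def)
  next
    case False
    then have "k' \<noteq> rot r k" using rot_range[OF \<open>r > 0\<close>, of k] by metis
    then show ?thesis using False by (auto simp: rot_point_def unit_point_def rotv_def)
  qed
qed

lemma abs_sum_list_le:
  fixes f :: "'a \<Rightarrow> real"
  shows "(\<And>x. x \<in> set l \<Longrightarrow> \<bar>f x\<bar> \<le> B) \<Longrightarrow> \<bar>\<Sum>x\<leftarrow>l. f x\<bar> \<le> real (length l) * B"
proof (induction l)
  case (Cons a l)
  then have "\<bar>f a\<bar> \<le> B" "\<bar>\<Sum>x\<leftarrow>l. f x\<bar> \<le> real (length l) * B" by simp_all
  moreover have "real (length (a # l)) * B = B + real (length l) * B" by (simp add: algebra_simps)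
  ultimately show ?case by simp
qed simp

lemma dist_average_le:
  fixes xs :: "real list"
  assumes x: "x \<in> set xs" and D: "\<And>y. y \<in> set xs \<Longrightarrow> \<bar>y - x\<bar> \<le> D" and n: "length xs \<le> n"
  shows "\<bar>sum_list xs / length xs - x\<bar> \<le> D * (real n - 1) / real n"
proof -
  obtain us vs where xs: "xs = us @ x # vs" using x by (meson split_list)
  let ?k = "real (length xs)"
  have k: "?k \<ge> 1" by (simp add: xs)
  have D0: "D \<ge> 0" using D[OF x] by simp
  have "\<bar>\<Sum>y\<leftarrow>us @ vs. y - x\<bar> \<le> real (length (us @ vs)) * D"
    by (rule abs_sum_list_le) (rule D, auto simp: xs)
  also have "\<dots> = D * (?k - 1)" by (simp add: xs)
  finally have "\<bar>\<Sum>y\<leftarrow>us @ vs. y - x\<bar> \<le> D * (?k - 1)" .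
  moreover have "(\<Sum>y\<leftarrow>us @ vs. y - x) = sum_list xs - ?k * x"
    by (simp add: xs sum_list_subtractf sum_list_triv algebra_simps)
  ultimately have "\<bar>sum_list xs - ?k * x\<bar> \<le> D * (?k - 1)" by simp
  moreover have "sum_list xs / ?k - x = (sum_list xs - ?k * x) / ?k"
    using k by (auto simp: diff_divide_distrib)
  ultimately have "\<bar>sum_list xs / ?k - x\<bar> \<le> D * ((?k - 1) / ?k)"
    using k by (simp add: divide_right_mono)
  also have "(?k - 1) / ?k \<le> (real n - 1) / real n"
  proof -
    have "1 / real n \<le> 1 / ?k" using n k by (intro frac_le) auto
    then show ?thesis using n k by (simp add: diff_divide_distrib)
  qed
  finally show ?thesis using D0 by (simp add: mult_left_mono)
qed

definition small :: "point set \<Rightarrow> real \<Rightarrow> nat \<Rightarrow> point list \<Rightarrow> bool" where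
  "small S D n l \<longleftrightarrow> set l \<subseteq> S \<and> length l \<le> n \<and> (\<forall>X\<in>set l. \<forall>Y\<in>set l. \<forall>v. \<bar>X v - Y v\<bar> \<le> D)"

lemma flag_members: "is_flag \<beta> l f \<Longrightarrow> X \<in> set f \<Longrightarrow> \<exists>l'. l' \<noteq> [] \<and> set l' \<subseteq> set l \<and> X = \<beta> l'"
proof (induction rule: is_flag.induct)
  case (is_flag_step i l f)
  show ?case
  proof (cases "X = \<beta> l")
    case True
    then show ?thesis using is_flag_step.hyps(1) by (intro exI[of _ l]) auto
  next
    case False
    then show ?thesis using is_flag_step set_drop_nth[of i l] by (auto intro: order_trans)
  qed
qed simp

lemma flag_length: "is_flag \<beta> l f \<Longrightarrow> length f = length l"
  by (induction rule: is_flag.induct) simp_all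

text \<open>Barycentric subdivision of a simplex with at most \<open>n\<close> vertices shrinks diameters by the factor
\<open>(n - 1) / n\<close>.  Distances are measured coordinatewise, which reduces the claim to averages of real numbers.\<close>

lemma bary_flag_diameter:
  assumes "is_flag bary l f" "length l \<le> n" and "\<And>X Y. X \<in> set l \<Longrightarrow> Y \<in> set l \<Longrightarrow> \<bar>X v - Y v\<bar> \<le> D"
    and "X \<in> set f" "Y \<in> set f" "D \<ge> 0"
  shows "\<bar>X v - Y v\<bar> \<le> D * (real n - 1) / real n"
  using assms
proof (induction arbitrary: X Y rule: is_flag.induct)
  case (is_flag_step i l f)
  let ?B = "D * (real n - 1) / real n"
  have l: "l \<noteq> []" using is_flag_step.hyps(1) by auto
  then have n: "n \<ge> 1" using is_flag_step.prems(1) by (cases l) auto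
  have B0: "?B \<ge> 0" using n is_flag_step.prems by simp
  have top: "\<bar>bary l v - Y v\<bar> \<le> ?B" if Y: "Y \<in> set f" for Y
  proof -
    obtain l' where l': "l' \<noteq> []" "set l' \<subseteq> set l" "Y = bary l'"
      using flag_members[OF is_flag_step.hyps(2) Y] set_drop_nth[of i l] by blast
    have d: "\<bar>bary l v - Z v\<bar> \<le> ?B" if "Z \<in> set l'" for Z
    proof -
      have "\<bar>sum_list (map (\<lambda>X. X v) l) / length (map (\<lambda>X. X v) l) - Z v\<bar> \<le> ?B"
        by (rule dist_average_le) (use that l' is_flag_step.prems in auto)
      then show ?thesis by (simp add: bary_def)
    qed
    have "\<bar>\<Sum>Z\<leftarrow>l'. bary l v - Z v\<bar> \<le> length l' * ?B"
      by (rule abs_sum_list_le) (rule d)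
    then have "\<bar>length l' * bary l v - (\<Sum>Z\<leftarrow>l'. Z v)\<bar> \<le> length l' * ?B"
      by (simp only: sum_list_subtractf sum_list_triv)
    moreover have "length l' * bary l v - (\<Sum>Z\<leftarrow>l'. Z v) = length l' * (bary l v - Y v)"
      using l' by (simp add: bary_def right_diff_distrib)
    ultimately have "real (length l') * \<bar>bary l v - Y v\<bar> \<le> real (length l') * ?B"
      by (simp only: abs_mult abs_of_nat)
    then show ?thesis by (rule mult_left_le_imp_le) (use l'(1) in simp)
  qed
  have rest: "\<bar>X v - Y v\<bar> \<le> ?B" if "X \<in> set f" "Y \<in> set f" for X Y
    using that set_drop_nth[of i l] is_flag_step.prems(1,2,5) is_flag_step.hyps(1)
    by (intro is_flag_step.IH) auto
  show ?case
    using is_flag_step.prems(3,4) top[of X] top[of Y] rest[of X Y] B0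
    by (auto simp: abs_minus_commute)
qed simp

lemma small_bary_flag:
  assumes "is_flag bary l f" "small (realization r m T) D n l" "D \<ge> 0"
  shows "small (realization r m T) (D * (real n - 1) / real n) n f"
  unfolding small_def
proof (intro conjI ballI allI subsetI)
  show "length f \<le> n" using assms(1,2) by (simp add: small_def flag_length)
  fix X assume X: "X \<in> set f"
  then obtain l' where l': "l' \<noteq> []" "set l' \<subseteq> set l" "X = bary l'"
    using flag_members[OF assms(1)] by blast
  moreover have "set l' \<subseteq> realization r m T" using l'(2) assms(2) unfolding small_def by blast
  ultimately show "X \<in> realization r m T" using bary_realization by blast
  fix Y v assume "Y \<in> set f"
  with X show "\<bar>X v - Y v\<bar> \<le> D * (real n - 1) / real n"
    using assms(2,3) unfolding small_def by (intro bary_flag_diameter[OF assms(1)]) blast+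
qed

text \<open>Only simplices of small diameter matter for the iterated subdivision of a cochain.  Hence
equivariance and vanishing of the final labelling have to be checked on small simplices only.\<close>

lemma subdiv_bary_pow_cong:
  assumes "small (realization r m T) D n l" "D \<ge> 0" "n > 0"
    and "\<And>f. small (realization r m T) (D * ((real n - 1) / real n) ^ j) n f \<Longrightarrow>
        length f = length l \<Longrightarrow> \<eta> f = \<eta>' f"
  shows "(subdiv bary ^^ j) \<eta> l = (subdiv bary ^^ j) \<eta>' l"
  using assms(1,2,4)
proof (induction j arbitrary: D l)
  case (Suc j)
  let ?c = "(real n - 1) / real n"
  have c: "0 \<le> ?c" using assms(3) by simp
  have "subdiv bary ((subdiv bary ^^ j) \<eta>) l = subdiv bary ((subdiv bary ^^ j) \<eta>') l"
  proof (rule subdiv_cong)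
    fix f assume f: "is_flag bary l f"
    show "(subdiv bary ^^ j) \<eta> f = (subdiv bary ^^ j) \<eta>' f"
    proof (rule Suc.IH)
      show "small (realization r m T) (D * ?c) n f"
        using small_bary_flag[OF f Suc.prems(1,2)] by (simp only: times_divide_eq_right)
      show "0 \<le> D * ?c" using c Suc.prems(2) by (rule mult_nonneg_nonneg[rotated])
      fix g assume "small (realization r m T) (D * ?c * ?c ^ j) n g" "length g = length f"
      then show "\<eta> g = \<eta>' g"
        using Suc.prems(3)[of g] flag_length[OF f] by (simp only: mult.assoc power_Suc)
    qed
  qed
  then show ?case by simp
qed simp

lemma subdiv_bary_pow_rot:
  "(subdiv bary ^^ j) \<eta> (map (rot_point r) l) = (subdiv bary ^^ j) (\<lambda>f. \<eta> (map (rot_point r) f)) l"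
proof (induction j arbitrary: l)
  case (Suc j)
  have "subdiv bary ((subdiv bary ^^ j) \<eta>) (map (rot_point r) l) =
      subdiv bary (\<lambda>f. (subdiv bary ^^ j) \<eta> (map (rot_point r) f)) l"
    by (rule subdiv_map) (rule bary_rot)
  also have "(\<lambda>f. (subdiv bary ^^ j) \<eta> (map (rot_point r) f)) =
      (subdiv bary ^^ j) (\<lambda>f. \<eta> (map (rot_point r) f))"
    using Suc.IH by blast
  finally show ?case by simp
qed simp

text \<open>Nonempty sets attached monotonically to the faces of a simplex cannot all be different along a full flag
if even the largest has fewer elements than the simplex has vertices.  This is where the
dimension of the target enters.\<close>

lemma flag_repeat:
  assumes "is_flag (\<lambda>l. g (U l)) l f" "l \<noteq> []" "card (U l) < length l"
    and mono: "\<And>l l'. set l' \<subseteq> set l \<Longrightarrow> U l' \<subseteq> U l"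
    and ne: "\<And>l'. l' \<noteq> [] \<Longrightarrow> set l' \<subseteq> set l \<Longrightarrow> U l' \<noteq> {}"
    and fin: "finite (U l)"
  shows "\<exists>us x ws. f = us @ x # x # ws"
  using assms(1-3) ne fin
proof (induction rule: is_flag.induct)
  case (is_flag_step i l f)
  let ?l = "drop_nth i l"
  have sub: "U ?l \<subseteq> U l" by (rule mono[OF set_drop_nth])
  have fin: "finite (U l)" "finite (U ?l)" using is_flag_step.prems(4) sub finite_subset by blast+
  have "card (U l) > 0" using is_flag_step.prems(1,3) fin by (simp add: card_gt_0_iff)
  then have "length l \<ge> 2" using is_flag_step.prems(2) by linarith
  then have ne: "?l \<noteq> []" using is_flag_step.hyps(1) length_drop_nth[of i l] by fastforce
  show ?case
  proof (cases "card (U ?l) < length ?l")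
    case True
    have "\<exists>us x ws. f = us @ x # x # ws"
    proof (rule is_flag_step.IH[OF ne True _ fin(2)])
      fix l' assume "l' \<noteq> []" "set l' \<subseteq> set ?l"
      then show "U l' \<noteq> {}" using is_flag_step.prems(3) set_drop_nth[of i l] by blast
    qed
    then show ?thesis by (metis append_Cons)
  next
    case False
    then have "card (U l) \<le> card (U ?l)"
      using is_flag_step.prems(2) is_flag_step.hyps(1) by simp
    then have "U ?l = U l" using card_seteq[OF fin(1) sub] by blast
    moreover obtain f' where "f = g (U ?l) # f'"
      using is_flag_step.hyps(2) ne by (cases rule: is_flag.cases) auto
    ultimately have "g (U l) # f = [] @ g (U l) # g (U l) # f'" by simp
    then show ?thesis by blast
  qed
qed simp

section \<open>Approximate zeros of equivariant maps\<close>

text \<open>The mean of a set of residues whose size is invertible modulo \<open>r\<close>: an equivariant choice of one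
residue for every nonempty proper subset.  It exists because \<open>r\<close> is prime.\<close>

definition mean :: "nat \<Rightarrow> int set \<Rightarrow> int" where
  "mean r S = (THE k. k \<in> {0..<int r} \<and> [int (card S) * k = \<Sum>S] (mod int r))"

lemma rot_cong: "[rot r x = x + 1] (mod int r)"
  by (simp add: rot_def)

lemma inj_on_rot: "inj_on (rot r) {0..<int r}"
  by (rule inj_on_inverseI[where g = "\<lambda>x. (x - 1) mod int r"]) (rule rot_inverse)

lemma mean_unique:
  assumes r: "prime r" and S: "S \<subseteq> {0..<int r}" "S \<noteq> {}" "S \<noteq> {0..<int r}"
  shows "\<exists>!k. k \<in> {0..<int r} \<and> [int (card S) * k = \<Sum>S] (mod int r)"
proof -
  have fin: "finite S" using S(1) finite_subset by blast
  have "card S < r" using psubset_card_mono[of "{0..<int r}" S] S by auto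
  moreover have "card S > 0" using S(2) fin by (simp add: card_gt_0_iff)
  ultimately have "\<not> r dvd card S" by (simp add: nat_dvd_not_less)
  then have "coprime (card S) r" using r prime_imp_coprime coprime_commute by metis
  then have c: "coprime (int (card S)) (int r)" by simp
  then obtain x where x: "[int (card S) * x = 1] (mod int r)" using cong_solve_coprime_int by blast
  have r0: "int r > 0" using prime_gt_0_nat[OF r] by simp
  show ?thesis
  proof (rule ex_ex1I)
    let ?k = "(x * \<Sum>S) mod int r"
    have "[int (card S) * ?k = (int (card S) * x) * \<Sum>S] (mod int r)"
      by (simp add: cong_def mod_mult_right_eq mult.assoc)
    also have "[(int (card S) * x) * \<Sum>S = 1 * \<Sum>S] (mod int r)"
      by (rule cong_scalar_right[OF x])
    finally show "\<exists>k. k \<in> {0..<int r} \<and> [int (card S) * k = \<Sum>S] (mod int r)"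
      using r0 by (intro exI[of _ ?k]) simp
  next
    fix k k' assume k: "k \<in> {0..<int r} \<and> [int (card S) * k = \<Sum>S] (mod int r)"
      "k' \<in> {0..<int r} \<and> [int (card S) * k' = \<Sum>S] (mod int r)"
    then have "[int (card S) * k = int (card S) * k'] (mod int r)"
      by (meson cong_sym cong_trans)
    then have "[k = k'] (mod int r)" using cong_mult_lcancel[OF c] by blast
    then show "k = k'" using k by (auto intro: cong_less_imp_eq_int)
  qed
qed

lemma mean_rot:
  assumes r: "prime r" and S: "S \<subseteq> {0..<int r}" "S \<noteq> {}" "S \<noteq> {0..<int r}"
  shows "mean r (rot r ` S) = rot r (mean r S)"
proof -
  have r0: "r > 0" using prime_gt_0_nat[OF r] .
  have inj: "inj_on (rot r) S" using inj_on_rot S(1) inj_on_subset by blast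
  have k: "mean r S \<in> {0..<int r}" "[int (card S) * mean r S = \<Sum>S] (mod int r)"
    using theI'[OF mean_unique[OF assms]] unfolding mean_def by blast+
  have c: "card (rot r ` S) = card S" by (rule card_image[OF inj])
  have "[\<Sum>(rot r ` S) = (\<Sum>x\<in>S. x + 1)] (mod int r)"
    unfolding sum.reindex[OF inj] by (simp, intro cong_sum rot_cong)
  also have "(\<Sum>x\<in>S. x + 1) = \<Sum>S + int (card S) * 1" by (simp add: sum.distrib)
  finally have s: "[\<Sum>(rot r ` S) = \<Sum>S + int (card S) * 1] (mod int r)" .
  have "[int (card S) * rot r (mean r S) = int (card S) * (mean r S + 1)] (mod int r)"
    by (rule cong_scalar_left[OF rot_cong])
  also have "int (card S) * (mean r S + 1) = int (card S) * mean r S + int (card S) * 1"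
    by (simp add: distrib_left)
  also have "[int (card S) * mean r S + int (card S) * 1 = \<Sum>S + int (card S) * 1] (mod int r)"
    by (rule cong_add[OF k(2)]) simp
  finally have m: "[int (card (rot r ` S)) * rot r (mean r S) = \<Sum>(rot r ` S)] (mod int r)"
    unfolding c using s by (meson cong_sym cong_trans)
  have "rot r ` S \<subseteq> {0..<int r}" "rot r ` S \<noteq> {}" using rot_range[OF r0] S(2) by blast+
  moreover have "rot r ` S \<noteq> {0..<int r}"
  proof
    assume "rot r ` S = {0..<int r}"
    then have "card S = card {0..<int r}" using c by simp
    then show False using S card_subset_eq[of "{0..<int r}" S] by simp
  qed
  ultimately show ?thesis
    unfolding mean_def[of r "rot r ` S"]
    by (rule the1_equality[OF mean_unique[OF r]]) (use m rot_range[OF r0] in blast)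
qed

definition level :: "nat \<Rightarrow> (nat \<times> int) set \<Rightarrow> int set" where
  "level b U = {k. (b, k) \<in> U}"

text \<open>A set of positions none of whose levels is full has a first level that is nonempty and proper;
its mean labels the set.\<close>

definition first_mean :: "nat \<Rightarrow> (nat \<times> int) set \<Rightarrow> int" where
  "first_mean r U = mean r (level (LEAST b. level b U \<noteq> {}) U)"

lemma level_rotv: "level b (rotv r ` U) = rot r ` level b U"
  by (force simp: level_def rotv_def)

lemma first_mean_rotv:
  assumes "prime r" "U \<noteq> {}" "\<And>b. level b U \<subset> {0..<int r}"
  shows "first_mean r (rotv r ` U) = rot r (first_mean r U)"
proof -
  have "\<exists>b. level b U \<noteq> {}" using assms(2) by (auto simp: level_def)
  then have "level (LEAST b. level b U \<noteq> {}) U \<noteq> {}" by (rule LeastI_ex)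
  then show ?thesis
    unfolding first_mean_def level_rotv image_is_empty
    using assms(1,3) by (intro mean_rot) auto
qed

text \<open>A set of pairs that misses a row in each of the \<open>m\<close> blocks has at most \<open>m (r - 1)\<close> elements, one
less than the number of vertices of a facet.\<close>

lemma card_levels:
  assumes "U \<subseteq> {..<m} \<times> UNIV" "\<And>b. level b U \<subset> {0..<int r}"
  shows "finite U" "card U \<le> m * (r - 1)"
proof -
  have U: "U = (SIGMA b:{..<m}. level b U)" using assms(1) by (auto simp: level_def)
  have fin: "finite (level b U)" for b using assms(2)[of b] finite_subset by blast
  show "finite U" by (subst U) (simp add: fin)
  have "card U = (\<Sum>b<m. card (level b U))" by (subst U) (simp add: fin)
  also have "\<dots> \<le> (\<Sum>b<m. r - 1)"
  proof (rule sum_mono)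
    fix b show "card (level b U) \<le> r - 1"
      using psubset_card_mono[OF _ assms(2)[of b]] by simp
  qed
  finally show "card U \<le> m * (r - 1)" by simp
qed

text \<open>Suppose that at every point some block of \<open>f\<close> has spread at least \<open>e\<close>.  Label a point by the set \<open>A\<close> of
all positions at which a block with large spread attains its maximum.  On a sufficiently fine
simplex no block can have all its rows among the labels of the vertices, since at one vertex a
row would be far below the maximum and at a nearby vertex equal to it.  So the label sets of the faces
of a fine simplex have means, which gives an equivariant chain map, and they have at most \<open>m (r - 1)\<close>
elements, so every flag repeats a label and \<open>theta\<close> is annihilated.  This contradicts
\<open>equivariant_chain_op_top_degree\<close>.\<close>

theorem equivariant_approximate_zero:
  fixes f :: "point \<Rightarrow> nat \<Rightarrow> int \<Rightarrow> real"
  assumes r: "prime r" and m: "m > 0"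
    and equiv: "\<And>X b k. b < m \<Longrightarrow> k \<in> {0..<int r} \<Longrightarrow> f (rot_point r X) b (rot r k) = f X b k"
    and ucont: "\<And>e. e > 0 \<Longrightarrow> \<exists>d>0. \<forall>T X Y b k. admissible r m T \<longrightarrow> X \<in> realization r m T \<longrightarrow>
      Y \<in> realization r m T \<longrightarrow> (\<forall>v. \<bar>X v - Y v\<bar> \<le> d) \<longrightarrow> b < m \<longrightarrow> k \<in> {0..<int r} \<longrightarrow>
      \<bar>f X b k - f Y b k\<bar> \<le> e"
    and e: "e > 0"
  shows "\<exists>T X. admissible r m T \<and> X \<in> realization r m T \<and>
    (\<forall>b<m. \<forall>k\<in>{0..<int r}. \<forall>k'\<in>{0..<int r}. f X b k < f X b k' + e)"
proof (rule ccontr)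
  assume contr: "\<not> ?thesis"
  define R where "R = {0..<int r}"
  define N where "N = m * (r - 1)"
  have r0: "r > 0" using prime_gt_0_nat[OF r] .
  have rotR: "rot r ` R = R" using bij_rot[OF r0] by (simp add: bij_betw_def R_def)
  define A where "A X = {(b, k). b < m \<and> k \<in> R \<and> (\<forall>k'\<in>R. f X b k' \<le> f X b k) \<and>
     (\<exists>k'\<in>R. f X b k' + e \<le> f X b k)}" for X
  define U where "U l = (\<Union>X\<in>set l. A X)" for l
  define lab where "lab l = first_mean r (U l)" for l
  \<comment> \<open>On sets of diameter \<open>d\<close> two values may move by \<open>e / 4\<close> each, which leaves half of the gap \<open>e\<close>.\<close>
  obtain d where d: "d > 0" and dist: "\<And>T X Y b k. admissible r m T \<Longrightarrow> X \<in> realization r m T \<Longrightarrow>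
      Y \<in> realization r m T \<Longrightarrow> (\<forall>v. \<bar>X v - Y v\<bar> \<le> d) \<Longrightarrow> b < m \<Longrightarrow> k \<in> R \<Longrightarrow>
      \<bar>f X b k - f Y b k\<bar> \<le> e / 4"
  proof -
    have "e / 4 > 0" using e by simp
    from ucont[OF this] show ?thesis unfolding R_def[symmetric] using that by meson
  qed
  have A_rot: "A (rot_point r X) = rotv r ` A X" for X
  proof -
    have eq: "f (rot_point r X) b (rot r k) = f X b k" if "b < m" "k \<in> R" for b k
      using equiv that by (simp add: R_def)
    have "(b, rot r k) \<in> A (rot_point r X) \<longleftrightarrow> (b, k) \<in> A X" if k: "k \<in> R" for b k
    proof (cases "b < m")
      case True
      have "(\<forall>k'\<in>R. f (rot_point r X) b k' \<le> f X b k) \<longleftrightarrow> (\<forall>k'\<in>rot r ` R. f (rot_point r X) b k' \<le> f X b k)"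
        by (simp only: rotR)
      moreover have "(\<exists>k'\<in>R. f (rot_point r X) b k' + e \<le> f X b k) \<longleftrightarrow>
          (\<exists>k'\<in>rot r ` R. f (rot_point r X) b k' + e \<le> f X b k)"
        by (simp only: rotR)
      moreover have "rot r k \<in> R" using rotR k by blast
      ultimately show ?thesis using True k eq by (simp add: A_def)
    qed (simp add: A_def)
    note iff = this
    show ?thesis
    proof (intro set_eqI iffI)
      fix v assume v: "v \<in> A (rot_point r X)"
      then have "snd v \<in> rot r ` R" unfolding rotR by (auto simp: A_def)
      then obtain k where k: "k \<in> R" "snd v = rot r k" by blast
      then have "v = rotv r (fst v, k)" by (simp add: rotv_def prod_eq_iff)
      moreover have "(fst v, k) \<in> A X" using iff[OF k(1), of "fst v"] v k(2) by (metis prod.collapse)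
      ultimately show "v \<in> rotv r ` A X" by blast
    next
      fix v assume "v \<in> rotv r ` A X"
      then obtain b k where bk: "(b, k) \<in> A X" "v = (b, rot r k)" by (auto simp: rotv_def)
      then have "k \<in> R" by (simp add: A_def)
      then show "v \<in> A (rot_point r X)" using iff bk by blast
    qed
  qed
  have U_rot: "U (map (rot_point r) l) = rotv r ` U l" for l
    by (auto simp: U_def A_rot)
  have A_ne: "A X \<noteq> {}" if adm: "admissible r m T" and X: "X \<in> realization r m T" for X T
  proof -
    obtain b k k' where b: "b < m" "k \<in> R" "k' \<in> R" "f X b k' + e \<le> f X b k"
      using contr adm X unfolding R_def by (meson not_less)
    have "finite R" "R \<noteq> {}" using b(2) by (auto simp: R_def)
    then obtain k0 where k0: "k0 \<in> R" "\<And>k. k \<in> R \<Longrightarrow> f X b k \<le> f X b k0"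
      using finite_has_maximal[of "f X b ` R"] Max_in[of "f X b ` R"] Max_ge[of "f X b ` R"] by fastforce
    have "f X b k' + e \<le> f X b k0" using b k0(2)[of k] by linarith
    then have "(b, k0) \<in> A X" using b k0 by (auto simp: A_def)
    then show ?thesis by blast
  qed
  have good: "U l \<noteq> {} \<and> U l \<subseteq> {..<m} \<times> UNIV \<and> (\<forall>b. level b (U l) \<subset> {0..<int r})"
    if adm: "admissible r m T" and l: "l \<noteq> []" "set l \<subseteq> realization r m T"
      and close: "\<And>X Y v. X \<in> set l \<Longrightarrow> Y \<in> set l \<Longrightarrow> \<bar>X v - Y v\<bar> \<le> d" for l T
  proof (intro conjI allI)
    show "U l \<noteq> {}" using l A_ne[OF adm] by (cases l) (auto simp: U_def)
    show "U l \<subseteq> {..<m} \<times> UNIV" by (auto simp: U_def A_def)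
    fix b
    have "level b (U l) \<noteq> R"
    proof
      assume full: "level b (U l) = R"
      have "0 \<in> R" using r0 by (simp add: R_def)
      then obtain X k where X: "X \<in> set l" "(b, k) \<in> A X"
        using full by (auto simp: level_def U_def)
      then obtain k' where b: "b < m" "k \<in> R" and k': "k' \<in> R" "f X b k' + e \<le> f X b k"
        by (auto simp: A_def)
      then obtain Y where Y: "Y \<in> set l" "(b, k') \<in> A Y"
        using full by (auto simp: level_def U_def)
      then have mono: "f Y b k \<le> f Y b k'" using b by (auto simp: A_def)
      have XY: "X \<in> realization r m T" "Y \<in> realization r m T" using X(1) Y(1) l(2) by auto
      have "\<forall>v. \<bar>X v - Y v\<bar> \<le> d" by (intro allI close X(1) Y(1))
      note D = dist[OF adm XY this b(1)]
      show False using D[OF b(2)] D[OF k'(1)] mono k'(2) e by linarith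
    qed
    moreover have "level b (U l) \<subseteq> R" by (auto simp: level_def U_def A_def)
    ultimately show "level b (U l) \<subset> {0..<int r}" unfolding R_def by blast
  qed
  \<comment> \<open>The labels rotate with the point where no level is full, which smallness guarantees.\<close>
  have lab_rot: "subdiv lab \<eta> (map (rot_point r) l) = subdiv lab (\<lambda>f. \<eta> (map (rot r) f)) l"
    if adm: "admissible r m T" and l: "small (realization r m T) d (Suc N) l" for l T \<eta>
  proof (rule subdiv_map)
    fix l' assume l': "l' \<noteq> []" "set l' \<subseteq> set l"
    have "U l' \<noteq> {} \<and> U l' \<subseteq> {..<m} \<times> UNIV \<and> (\<forall>b. level b (U l') \<subset> {0..<int r})"
      using l l' unfolding small_def by (intro good[OF adm]) blast+
    then show "lab (map (rot_point r) l') = rot r (lab l')"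
      unfolding lab_def U_rot using first_mean_rotv[OF r] by blast
  qed
  have lab_theta: "subdiv lab (theta r m) l = 0"
    if adm: "admissible r m T" and l: "small (realization r m T) d (Suc N) l" and len: "length l = Suc N"
    for l T
  proof -
    have g: "U l' \<noteq> {} \<and> U l' \<subseteq> {..<m} \<times> UNIV \<and> (\<forall>b. level b (U l') \<subset> {0..<int r})"
      if "l' \<noteq> []" "set l' \<subseteq> set l" for l'
    proof (rule good[OF adm that(1)])
      show "set l' \<subseteq> realization r m T" using l that(2) unfolding small_def by blast
      show "\<bar>X v - Y v\<bar> \<le> d" if "X \<in> set l'" "Y \<in> set l'" for X Y v
        using l that \<open>set l' \<subseteq> set l\<close> unfolding small_def by blast
    qed
    have ne: "l \<noteq> []" using len by auto
    have Ul: "finite (U l)" "card (U l) < length l"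
    proof -
      have lev: "U l \<subseteq> {..<m} \<times> UNIV" "\<And>b. level b (U l) \<subset> {0..<int r}"
        using g[OF ne order_refl] by auto
      show "finite (U l)" by (rule card_levels(1)[OF lev])
      have "card (U l) \<le> N" unfolding N_def by (rule card_levels(2)[OF lev])
      then show "card (U l) < length l" using len by simp
    qed
    have "theta r m f = 0" if flag: "is_flag lab l f" for f
    proof -
      have "is_flag (\<lambda>l. first_mean r (U l)) l f" using flag unfolding lab_def[abs_def] .
      then have "\<exists>us x ws. f = us @ x # x # ws"
      proof (rule flag_repeat[where U = U and g = "first_mean r", OF _ ne Ul(2) _ _ Ul(1)])
        show "U l1 \<subseteq> U l2" if "set l1 \<subseteq> set l2" for l1 l2
          unfolding U_def using that by blast
        show "U l' \<noteq> {}" if "l' \<noteq> []" "set l' \<subseteq> set l" for l'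
          by (rule conjunct1[OF g[OF that]])
      qed
      then obtain us x ws where f: "f = us @ x # x # ws" by blast
      show ?thesis unfolding f by (rule theta_repeat[OF prime_gt_1_nat[OF r]])
    qed
    then have "subdiv lab (theta r m) l = subdiv lab (\<lambda>f. 0 * theta r m f) l"
      by (intro subdiv_cong) (simp only: mult_zero_left)
    also have "\<dots> = 0" unfolding subdiv_scale by simp
    finally show ?thesis .
  qed
  \<comment> \<open>Subdivide until all simplices have diameter at most \<open>d\<close>.\<close>
  define c where "c = (real (Suc N) - 1) / real (Suc N)"
  have "0 \<le> c" "c < 1" by (simp_all add: c_def)
  then obtain j where j: "c ^ j \<le> d" using real_arch_pow_inv[of d c] d by (meson less_imp_le)
  define P where "P \<eta> l = (subdiv bary ^^ j) (subdiv lab \<eta>) (map unit_point l)"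
    for \<eta> :: "int list \<Rightarrow> int" and l :: "(nat \<times> int) list"
  have "chain_op (\<lambda>\<eta>. (subdiv bary ^^ j) (subdiv lab \<eta>))"
    by (rule chain_op_compose[OF chain_op_funpow[OF chain_op_subdiv] chain_op_subdiv])
  from chain_op_compose[OF chain_op_map[of unit_point] this] have P: "chain_op P"
    by (simp add: P_def[abs_def])
  have unit: "unit_point (i, T i) \<in> realization r m T" if "i \<le> N" for i T
  proof -
    have "unit_point (i, T i) (i', T i') = (if i' = i then 1 else 0)" for i'
      by (simp add: unit_point_def)
    then have sum: "(\<Sum>i'\<le>N. unit_point (i, T i) (i', T i')) = 1" using that by simp
    have "i' = i \<and> k = T i" if "unit_point (i, T i) (i', k) \<noteq> 0" for i' k
      using that by (simp add: unit_point_def split: if_splits)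
    moreover have "0 \<le> unit_point (i, T i) v" for v by (simp add: unit_point_def)
    ultimately show ?thesis
      unfolding realization_def N_def[symmetric] using that sum by blast
  qed
  have start: "small (realization r m T) 1 (Suc N) (map unit_point l)"
    if l: "face r m T l" for T l
    unfolding small_def
  proof (intro conjI ballI allI subsetI)
    show "length (map unit_point l) \<le> Suc N" using l by (simp add: face_def N_def)
    fix X assume "X \<in> set (map unit_point l)"
    then obtain i k where ik: "(i, k) \<in> set l" "X = unit_point (i, k)" by auto
    then have "i \<le> N" "k = T i"
      using l unfolding face_def N_def by fastforce+
    then show "X \<in> realization r m T" unfolding ik(2) by (simp only: unit)
    fix Y v assume "Y \<in> set (map unit_point l)"
    then obtain w where "Y = unit_point w" by auto
    then show "\<bar>X v - Y v\<bar> \<le> 1" unfolding ik(2) by (simp add: unit_point_def)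
  qed
  have small_mono: "small S d n l" if l: "small S (1 * c ^ j) n l" for S n and l :: "point list"
    unfolding small_def
  proof (intro conjI ballI allI)
    fix X Y v assume "X \<in> set l" "Y \<in> set l"
    then have "\<bar>X v - Y v\<bar> \<le> 1 * c ^ j" using l unfolding small_def by blast
    then show "\<bar>X v - Y v\<bar> \<le> d" using j by simp
  qed (use l in \<open>simp_all add: small_def\<close>)
  have cong: "(subdiv bary ^^ j) \<eta> (map unit_point l) = (subdiv bary ^^ j) \<eta>' (map unit_point l)"
    if l: "face r m T l" and eq: "\<And>f. small (realization r m T) d (Suc N) f \<Longrightarrow> length f = length l \<Longrightarrow> \<eta> f = \<eta>' f"
    for T l and \<eta> \<eta>' :: "point list \<Rightarrow> int"
  proof (rule subdiv_bary_pow_cong[OF start[OF l]])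
    fix f assume "small (realization r m T) (1 * ((real (Suc N) - 1) / real (Suc N)) ^ j) (Suc N) f"
      "length f = length (map unit_point l)"
    then show "\<eta> f = \<eta>' f" using small_mono eq by (simp only: c_def length_map)
  qed simp_all
  have "P \<eta> (map (rotv r) l) = P (\<lambda>f. \<eta> (map (rot r) f)) l" if l: "face r m T l" for T l \<eta>
  proof -
    have "unit_point (rotv r v) = rot_point r (unit_point v)" if "v \<in> set l" for v
    proof -
      have "snd v \<in> {0..<int r}" using l that by (auto simp: face_def admissible_def)
      then show ?thesis using rot_unit_point[of "snd v" r "fst v"] by simp
    qed
    then have "map unit_point (map (rotv r) l) = map (rot_point r) (map unit_point l)" by simp
    then have "P \<eta> (map (rotv r) l) =
        (subdiv bary ^^ j) (\<lambda>f. subdiv lab \<eta> (map (rot_point r) f)) (map unit_point l)"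
      by (simp only: P_def subdiv_bary_pow_rot)
    also have "\<dots> = P (\<lambda>f. \<eta> (map (rot r) f)) l"
      unfolding P_def
    proof (rule cong[OF l])
      have "admissible r m T" using l by (simp add: face_def)
      then show "subdiv lab \<eta> (map (rot_point r) f) = subdiv lab (\<lambda>f. \<eta> (map (rot r) f)) f"
        if "small (realization r m T) d (Suc N) f" for f
        using that by (rule lab_rot)
    qed
    finally show ?thesis .
  qed
  then obtain T where T: "admissible r m T"
    and nz: "P (theta r m) (map (\<lambda>i. (i, T i)) [0..<Suc N]) \<noteq> 0"
    using equivariant_chain_op_top_degree[OF r m P] unfolding N_def by metis
  let ?l = "map (\<lambda>i. (i, T i)) [0..<Suc N]"
  have "face r m T ?l" using T by (auto simp: face_def N_def simp del: upt_Suc)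
  then have "P (theta r m) ?l = (subdiv bary ^^ j) (\<lambda>f. 0 * subdiv lab (theta r m) f) (map unit_point ?l)"
    unfolding P_def
  proof (rule cong)
    fix f assume f: "small (realization r m T) d (Suc N) f" "length f = length ?l"
    then have "subdiv lab (theta r m) f = 0" by (intro lab_theta[OF T]) simp_all
    then show "subdiv lab (theta r m) f = 0 * subdiv lab (theta r m) f" by simp
  qed
  also have "\<dots> = 0"
    by (simp only: chain_op_scale[OF chain_op_funpow[OF chain_op_subdiv]])
  finally show False using nz by contradiction
qed

section \<open>Zeros of equivariant maps\<close>

lemma convergent_subsequence_finite:
  fixes x :: "nat \<Rightarrow> 'a \<Rightarrow> real"
  assumes "finite V" and "\<And>p v. x p v \<in> {0..1}"
  shows "\<exists>s::nat \<Rightarrow> nat. strict_mono s \<and> (\<forall>v\<in>V. \<exists>l. (\<lambda>p. x (s p) v) \<longlonglongrightarrow> l)"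
  using assms(1)
proof induction
  case empty
  show ?case by (intro exI[of _ id]) (simp add: strict_mono_def)
next
  case (insert v V)
  then obtain s :: "nat \<Rightarrow> nat" where s: "strict_mono s" and conv: "\<forall>v\<in>V. \<exists>l. (\<lambda>p. x (s p) v) \<longlonglongrightarrow> l"
    by blast
  have "seq_compact {0..1::real}" by (simp add: compact_imp_seq_compact)
  moreover have "\<forall>p. x (s p) v \<in> {0..1}" using assms(2) by blast
  ultimately obtain l s' where s': "strict_mono (s' :: nat \<Rightarrow> nat)" and l: "((\<lambda>p. x (s p) v) \<circ> s') \<longlonglongrightarrow> l"
    unfolding seq_compact_def by metis
  show ?case
  proof (intro exI[of _ "s \<circ> s'"] conjI ballI)
    show "strict_mono (s \<circ> s')" using s s' by (rule strict_mono_o)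
    fix w assume "w \<in> insert v V"
    then show "\<exists>l. (\<lambda>p. x ((s \<circ> s') p) w) \<longlonglongrightarrow> l"
    proof
      assume "w = v"
      then show ?thesis using l by (auto simp: comp_def)
    next
      assume "w \<in> V"
      then obtain l where "(\<lambda>p. x (s p) w) \<longlonglongrightarrow> l" using conv by blast
      from LIMSEQ_subseq_LIMSEQ[OF this s'] show ?thesis by (auto simp: comp_def)
    qed
  qed
qed

lemma realization_le_1:
  assumes "X \<in> realization r m T"
  shows "X v \<in> {0..1}"
proof -
  obtain i k where v: "v = (i, k)" by (cases v)
  have X: "\<And>v. 0 \<le> X v" "\<And>i k. X (i, k) \<noteq> 0 \<Longrightarrow> i \<le> m * (r - 1) \<and> k = T i"
    "(\<Sum>i\<le>m * (r - 1). X (i, T i)) = 1"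
    using assms unfolding realization_def by blast+
  have "X v \<le> 1"
  proof (cases "X v = 0")
    case False
    then have "i \<le> m * (r - 1)" "k = T i" using X(2) v by blast+
    then show ?thesis
      using member_le_sum[of i "{..m * (r - 1)}" "\<lambda>i. X (i, T i)"] X by (simp add: v)
  qed simp
  then show ?thesis using X(1)[of v] by simp
qed

lemma realization_cong:
  assumes "\<And>i. i \<le> m * (r - 1) \<Longrightarrow> T i = T' i"
  shows "realization r m T = realization r m T'" and "admissible r m T = admissible r m T'"
proof -
  have "(\<Sum>i\<le>m * (r - 1). X (i, T i)) = (\<Sum>i\<le>m * (r - 1). X (i, T' i))" for X :: point
    using assms by (intro sum.cong) auto
  then show "realization r m T = realization r m T'"
    unfolding realization_def using assms by (metis (no_types, lifting))
  show "admissible r m T = admissible r m T'"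
    unfolding admissible_def by (simp add: assms cong: imp_cong)
qed

text \<open>Approximate zeros accumulate at a zero: infinitely many of them lie in the same closed
simplex, where coordinatewise bounded sequences have convergent subsequences.\<close>

theorem equivariant_zero:
  fixes f :: "point \<Rightarrow> nat \<Rightarrow> int \<Rightarrow> real"
  assumes r: "prime r" and m: "m > 0"
    and equiv: "\<And>X b k. b < m \<Longrightarrow> k \<in> {0..<int r} \<Longrightarrow> f (rot_point r X) b (rot r k) = f X b k"
    and ucont: "\<And>e. e > 0 \<Longrightarrow> \<exists>d>0. \<forall>T X Y b k. admissible r m T \<longrightarrow> X \<in> realization r m T \<longrightarrow>
      Y \<in> realization r m T \<longrightarrow> (\<forall>v. \<bar>X v - Y v\<bar> \<le> d) \<longrightarrow> b < m \<longrightarrow> k \<in> {0..<int r} \<longrightarrow>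
      \<bar>f X b k - f Y b k\<bar> \<le> e"
  shows "\<exists>T X. admissible r m T \<and> X \<in> realization r m T \<and>
    (\<forall>b<m. \<forall>k\<in>{0..<int r}. \<forall>k'\<in>{0..<int r}. f X b k = f X b k')"
proof -
  let ?N = "m * (r - 1)" and ?R = "{0..<int r}"
  have "\<exists>T X. admissible r m T \<and> X \<in> realization r m T \<and>
      (\<forall>b<m. \<forall>k\<in>?R. \<forall>k'\<in>?R. f X b k < f X b k' + inverse (real (Suc p)))" for p
    by (rule equivariant_approximate_zero[OF r m equiv ucont]) simp_all
  then obtain T X where adm: "\<And>p. admissible r m (T p)" and X: "\<And>p. X p \<in> realization r m (T p)"
    and le: "\<And>p b k k'. b < m \<Longrightarrow> k \<in> ?R \<Longrightarrow> k' \<in> ?R \<Longrightarrow>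
        f (X p) b k < f (X p) b k' + inverse (real (Suc p))"
    by metis
  have "(\<lambda>p. restrict (T p) {..?N}) ` UNIV \<subseteq> {..?N} \<rightarrow>\<^sub>E ?R"
  proof (rule image_subsetI)
    fix p
    have "\<forall>i\<in>{..?N}. T p i \<in> ?R" using adm[of p] unfolding admissible_def by blast
    then show "restrict (T p) {..?N} \<in> {..?N} \<rightarrow>\<^sub>E ?R" by (simp only: restrict_PiE_iff)
  qed
  then have "finite ((\<lambda>p. restrict (T p) {..?N}) ` UNIV)"
    by (rule finite_subset) (simp add: finite_PiE)
  then obtain p0 where "infinite {p \<in> UNIV. restrict (T p) {..?N} = restrict (T p0) {..?N}}"
    using pigeonhole_infinite[of "UNIV :: nat set" "\<lambda>p. restrict (T p) {..?N}"] by auto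
  then obtain s1 :: "nat \<Rightarrow> nat" where s1: "strict_mono s1"
    and T_s1: "\<And>p. restrict (T (s1 p)) {..?N} = restrict (T p0) {..?N}"
    using infinite_enumerate by blast
  let ?T = "T p0"
  have same: "T (s1 p) i = ?T i" if "i \<le> ?N" for p i
    using fun_cong[OF T_s1[of p], of i] that by simp
  have X1: "X (s1 p) \<in> realization r m ?T" for p
  proof -
    have "realization r m (T (s1 p)) = realization r m ?T"
      by (rule realization_cong(1)) (rule same)
    then show ?thesis using X[of "s1 p"] by simp
  qed
  let ?V = "{..?N} \<times> ?R"
  obtain s2 :: "nat \<Rightarrow> nat" where s2: "strict_mono s2"
    and conv: "\<forall>v\<in>?V. \<exists>l. (\<lambda>p. X (s1 (s2 p)) v) \<longlonglongrightarrow> l"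
    using convergent_subsequence_finite[of ?V "\<lambda>p. X (s1 p)"] realization_le_1[OF X1] by auto
  define Y where "Y p = X (s1 (s2 p))" for p
  have Y: "Y p \<in> realization r m ?T" for p using X1 by (simp add: Y_def)
  have T_R: "?T i \<in> ?R" if "i \<le> ?N" for i using adm that by (simp add: admissible_def)
  have Y0: "Y p (i, k) = 0" if "\<not> (i \<le> ?N \<and> k = ?T i)" for p i k
    using Y[of p] that unfolding realization_def by blast
  have "\<exists>l. (\<lambda>p. Y p v) \<longlonglongrightarrow> l" for v
  proof (cases "v \<in> ?V")
    case True
    then show ?thesis using conv unfolding Y_def by blast
  next
    case False
    have "Y p v = 0" for p
    proof (cases v)
      case (Pair i k)
      then show ?thesis using False T_R by (intro Y0[of i k, folded Pair]) auto
    qed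
    then show ?thesis by auto
  qed
  then obtain Z where Z: "\<And>v. (\<lambda>p. Y p v) \<longlonglongrightarrow> Z v" by metis
  have Z0: "Z (i, k) = 0" if "\<not> (i \<le> ?N \<and> k = ?T i)" for i k
    using Z[of "(i, k)"] Y0[OF that] LIMSEQ_unique[of "\<lambda>_. 0"] by auto
  have Z_in: "Z \<in> realization r m ?T"
  proof -
    have "0 \<le> Z v" for v
      by (rule LIMSEQ_le_const[OF Z]) (use realization_le_1[OF Y] in auto)
    moreover have "(\<Sum>i\<le>?N. Z (i, ?T i)) = 1"
    proof -
      have "(\<lambda>p. \<Sum>i\<le>?N. Y p (i, ?T i)) \<longlonglongrightarrow> (\<Sum>i\<le>?N. Z (i, ?T i))"
        by (intro tendsto_sum Z)
      moreover have "(\<lambda>p. \<Sum>i\<le>?N. Y p (i, ?T i)) = (\<lambda>p. 1)"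
        using Y unfolding realization_def by blast
      ultimately show ?thesis using LIMSEQ_unique tendsto_const by metis
    qed
    ultimately show ?thesis unfolding realization_def using Z0 by blast
  qed
  have f_le: "f Z b k \<le> f Z b k'" if b: "b < m" and k: "k \<in> ?R" "k' \<in> ?R" for b k k'
  proof (rule field_le_epsilon)
    fix e :: real assume e: "e > 0"
    then have e3: "e / 3 > 0" by simp
    from ucont[OF this] obtain d where d: "d > 0" and dist: "\<And>T X Y b k. admissible r m T \<Longrightarrow>
        X \<in> realization r m T \<Longrightarrow> Y \<in> realization r m T \<Longrightarrow> (\<forall>v. \<bar>X v - Y v\<bar> \<le> d) \<Longrightarrow> b < m \<Longrightarrow>
        k \<in> ?R \<Longrightarrow> \<bar>f X b k - f Y b k\<bar> \<le> e / 3"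
      by meson
    have "\<forall>\<^sub>F p in sequentially. \<bar>Y p v - Z v\<bar> < d" for v
      using tendstoD[OF Z d, of v] by (simp add: dist_real_def)
    then have "\<forall>\<^sub>F p in sequentially. \<forall>i\<in>{..?N}. \<bar>Y p (i, ?T i) - Z (i, ?T i)\<bar> < d"
      by (intro eventually_ball_finite) auto
    moreover have "\<forall>\<^sub>F p in sequentially. inverse (real (Suc p)) < e / 3"
      using LIMSEQ_inverse_real_of_nat e3 by (rule order_tendstoD)
    ultimately have "\<forall>\<^sub>F p in sequentially. (\<forall>i\<in>{..?N}. \<bar>Y p (i, ?T i) - Z (i, ?T i)\<bar> < d) \<and>
        inverse (real (Suc p)) < e / 3"
      by (rule eventually_conj)
    then obtain p where p: "\<forall>i\<in>{..?N}. \<bar>Y p (i, ?T i) - Z (i, ?T i)\<bar> < d" "inverse (real (Suc p)) < e / 3"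
      using eventually_happens' sequentially_bot by blast
    have close: "\<forall>v. \<bar>Y p v - Z v\<bar> \<le> d"
    proof
      fix v :: "nat \<times> int"
      obtain i k where v: "v = (i, k)" by (cases v)
      show "\<bar>Y p v - Z v\<bar> \<le> d"
      proof (cases "i \<le> ?N \<and> k = ?T i")
        case True
        then show ?thesis using p(1) v by (auto intro: less_imp_le)
      next
        case False
        then show ?thesis using Y0[OF False] Z0[OF False] d v by simp
      qed
    qed
    have "p \<le> s1 (s2 p)"
      using seq_suble[OF strict_mono_o[OF s1 s2], of p] by simp
    then have "inverse (real (Suc (s1 (s2 p)))) \<le> inverse (real (Suc p))"
      by (intro le_imp_inverse_le) simp_all
    then have "f (Y p) b k \<le> f (Y p) b k' + e / 3"
      using le[OF b k, of "s1 (s2 p)"] p(2) unfolding Y_def by linarith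
    moreover note D = dist[OF adm Y Z_in close b]
    have "f Z b k \<le> f Z b k' + e"
      using D[OF k(1)] D[OF k(2)] calculation by linarith
    then show "f Z b k \<le> f Z b k' + e" .
  qed
  show ?thesis using adm Z_in f_le by (metis (no_types, lifting) order_antisym)
qed

section \<open>Equal splitting of continuous functions\<close>

lemma blocks_of_finite_set:
  assumes "finite A" "card A = p * s"
  obtains W :: "nat \<Rightarrow> 'a set" where "A = (\<Union>q<p. W q)" "\<And>q. finite (W q)" "\<And>q. card (W q) \<le> s"
proof -
  obtain h where h: "bij_betw h A {0..<card A}" using ex_bij_betw_finite_nat[OF assms(1)] by blast
  define W where "W q = {a \<in> A. h a div s = q}" for q
  have s: "s > 0" if "a \<in> A" for a
    using assms that by (cases s) (auto simp: card_gt_0_iff)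
  have "h a div s < p" if "a \<in> A" for a
    using h that assms(2) by (auto simp: bij_betw_def intro!: less_mult_imp_div_less)
  then have "A = (\<Union>q<p. W q)" by (auto simp: W_def)
  moreover have fin: "finite (W q)" for q using assms(1) by (simp add: W_def)
  moreover have "card (W q) \<le> s" for q
  proof -
    have "h ` W q \<subseteq> {q * s..<q * s + s}"
    proof
      fix y assume "y \<in> h ` W q"
      then obtain a where a: "a \<in> A" "h a div s = q" "y = h a" by (auto simp: W_def)
      then show "y \<in> {q * s..<q * s + s}"
        using dividend_less_div_times[OF s[OF a(1)], of y] by (auto simp: add.commute)
    qed
    moreover have "inj_on h (W q)"
      using h by (auto simp: bij_betw_def W_def intro: inj_on_subset)
    ultimately show ?thesis using card_inj_on_le[of h "W q" "{q * s..<q * s + s}"] by simp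
  qed
  ultimately show thesis by (rule that)
qed

lemma embed_classes_into_blocks:
  assumes C: "indexed_partition m C J" and card: "\<And>i. i \<in> {1..m} \<Longrightarrow> finite (C i) \<and> card (C i) \<le> s"
  obtains \<kappa> :: "'a \<Rightarrow> nat" where "inj_on \<kappa> J" "\<And>i j. i \<in> {1..m} \<Longrightarrow> j \<in> C i \<Longrightarrow> \<kappa> j div s = i - 1"
    "\<And>j. j \<in> J \<Longrightarrow> \<kappa> j < m * s"
proof -
  have J: "(\<Union>i\<in>{1..m}. C i) = J" and disj: "disjoint_family_on C {1..m}"
    using C by (auto simp: indexed_partition_def)
  have "\<exists>h. bij_betw h (C i) {0..<card (C i)}" if "i \<in> {1..m}" for i
    using card[OF that] ex_bij_betw_finite_nat by blast
  then obtain h where h: "\<And>i. i \<in> {1..m} \<Longrightarrow> bij_betw (h i) (C i) {0..<card (C i)}" by metis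
  define cl where "cl j = (THE i. i \<in> {1..m} \<and> j \<in> C i)" for j
  have cl: "cl j = i" if "i \<in> {1..m}" "j \<in> C i" for i j
    unfolding cl_def
  proof (rule the_equality)
    fix i' assume "i' \<in> {1..m} \<and> j \<in> C i'"
    then show "i' = i" using disj that unfolding disjoint_family_on_def by blast
  qed (use that in blast)
  define \<kappa> where "\<kappa> j = (cl j - 1) * s + h (cl j) j" for j
  have hs: "h i j < s" if "i \<in> {1..m}" "j \<in> C i" for i j
  proof -
    have "h i j \<in> {0..<card (C i)}" using h[OF that(1)] that(2) by (auto simp: bij_betw_def)
    then show ?thesis using card[OF that(1)] by simp
  qed
  have k: "\<kappa> j = (i - 1) * s + h i j" "\<kappa> j div s = i - 1" "\<kappa> j mod s = h i j"
    if "i \<in> {1..m}" "j \<in> C i" for i j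
    using hs[OF that] cl[OF that] by (simp_all add: \<kappa>_def)
  show thesis
  proof (rule that)
    show "\<kappa> j div s = i - 1" if "i \<in> {1..m}" "j \<in> C i" for i j using k(2)[OF that] .
    show "inj_on \<kappa> J"
    proof (rule inj_onI)
      fix j j' assume "j \<in> J" "j' \<in> J" and eq: "\<kappa> j = \<kappa> j'"
      then obtain i i' where i: "i \<in> {1..m}" "j \<in> C i" and i': "i' \<in> {1..m}" "j' \<in> C i'"
        using J by blast
      have "i - 1 = i' - 1" using k(2)[OF i] k(2)[OF i'] eq by simp
      then have same: "i' = i" using i(1) i'(1) by auto
      then have "h i j = h i j'" using k(3)[OF i] k(3)[OF i'] eq by simp
      then show "j = j'" using h[OF i(1)] i(2) i'(2) same by (auto simp: bij_betw_def dest: inj_onD)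
    qed
    fix j assume "j \<in> J"
    then obtain i where i: "i \<in> {1..m}" "j \<in> C i" using J by blast
    have "\<kappa> j < (i - 1) * s + s" using k(1)[OF i] hs[OF i] by simp
    also have "\<dots> = i * s" using i(1) by (cases i) auto
    also have "\<dots> \<le> m * s" using i(1) by (intro mult_right_mono) auto
    finally show "\<kappa> j < m * s" .
  qed
qed

text \<open>Cut \<open>[0,1]\<close> into \<open>n + 1\<close> pieces, give them to \<open>r\<close> recipients, and ask that all recipients get the
same total increment of \<open>D\<close> continuous functions.  The pieces are placed into distinct columns of
the chessboards so that the \<open>i\<close>-th class goes into the \<open>i\<close>-th block; admissibility then says that a
recipient gets at most one piece of each class.  A point of the complex gives the lengths of the pieces
by its barycentric coordinates and their recipients by its rows.

The columns without a piece must have length zero.  There are \<open>(m - D) (r - 1)\<close> of them.  They are divided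
into \<open>m - D\<close> groups of at most \<open>r - 1\<close>, and for each group the test map gets one further block, in
which row \<open>k\<close> receives the total length of the columns of the group assigned to \<open>k\<close>.  If these \<open>r\<close>
values agree they are zero, since \<open>r - 1\<close> columns cannot serve all \<open>r\<close> rows.  Together with the \<open>D\<close> given
functions this makes \<open>m\<close> blocks, as many as the complex allows.\<close>

theorem rainbow_splitting:
  fixes F :: "nat \<Rightarrow> real \<Rightarrow> real" and C :: "nat \<Rightarrow> nat set"
  assumes r: "prime r" and n: "n = (r - 1) * D"
    and cont: "\<And>b. b < D \<Longrightarrow> continuous_on {0..1} (F b)"
    and C: "indexed_partition m C {1..n + 1}" and cardC: "\<forall>i\<in>{1..m}. card (C i) \<le> r - 1"
  shows "\<exists>t T. cuts n t \<and> indexed_partition r T {1..n + 1} \<and>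
    (\<forall>i\<in>{1..m}. \<forall>k\<in>{1..r}. card (C i \<inter> T k) \<le> 1) \<and>
    (\<forall>b<D. \<forall>k\<in>{1..r}. \<forall>k'\<in>{1..r}.
       (\<Sum>j\<in>T k. F b (t j) - F b (t (j - 1))) = (\<Sum>j\<in>T k'. F b (t j) - F b (t (j - 1))))"
proof -
  let ?J = "{1..n + 1}" and ?N = "m * (r - 1)" and ?R = "{0..<int r}"
  have r1: "r > 1" using r by (rule prime_gt_1_nat)
  have J: "(\<Union>i\<in>{1..m}. C i) = ?J" using C by (simp add: indexed_partition_def)
  have finC: "finite (C i)" if "i \<in> {1..m}" for i
    using J that by (metis UN_upper finite_atLeastAtMost finite_subset)
  obtain \<kappa> where inj: "inj_on \<kappa> ?J" and block: "\<And>i j. i \<in> {1..m} \<Longrightarrow> j \<in> C i \<Longrightarrow> \<kappa> j div (r - 1) = i - 1"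
    and \<kappa>_less: "\<And>j. j \<in> ?J \<Longrightarrow> \<kappa> j < ?N"
    using embed_classes_into_blocks[OF C, of "r - 1"] finC cardC by metis
  have card\<kappa>: "card (\<kappa> ` ?J) = n + 1" unfolding card_image[OF inj] by simp
  have "card (\<kappa> ` ?J) \<le> card {..<?N}"
    by (rule card_mono) (use \<kappa>_less in auto)
  then have "n + 1 \<le> ?N" unfolding card\<kappa> by simp
  then have "D * (r - 1) < m * (r - 1)" using n by (metis Suc_eq_plus1 Suc_le_eq mult.commute)
  then have D: "D < m" by (rule mult_right_less_imp_less) simp
  define E where "E = {..?N} - \<kappa> ` ?J"
  have \<kappa>_sub: "\<kappa> ` ?J \<subseteq> {..?N}" using \<kappa>_less by (auto intro: less_imp_le)
  have "card E = Suc ?N - (n + 1)"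
    unfolding E_def by (subst card_Diff_subset[OF _ \<kappa>_sub]) (simp_all only: card\<kappa> card_atMost finite_imageI finite_atLeastAtMost)
  also have "\<dots> = (m - D) * (r - 1)" by (simp add: n diff_mult_distrib mult.commute)
  finally have "card E = (m - D) * (r - 1)" .
  then obtain W where W: "E = (\<Union>q<m - D. W q)" "\<And>q. finite (W q)" "\<And>q. card (W q) \<le> r - 1"
    using blocks_of_finite_set[of E "m - D" "r - 1"] by (auto simp: E_def)
  have W_le: "i \<le> ?N" if "i \<in> W q" "q < m - D" for i q
    using W(1) that unfolding E_def by auto

  define width where "width X i = (\<Sum>k\<in>?R. X (i, k))" for X :: point and i
  define cut where "cut X j = (\<Sum>a\<in>{1..j}. width X (\<kappa> a))" for X j
  define inc where "inc b X j = F b (cut X j) - F b (cut X (j - 1))" for b X j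
  \<comment> \<open>The row in which a column has its mass is the recipient of the piece; a piece of
    length zero has no recipient, but also no increment.\<close>
  define f where "f X b k = (if b < D then (\<Sum>j\<in>?J. if 0 < X (\<kappa> j, k) then inc b X j else 0)
      else (\<Sum>i\<in>W (b - D). X (i, k)))" for X :: point and b k

  have width_rot: "width (rot_point r X) i = width X i" for X i
  proof -
    have "width (rot_point r X) i = (\<Sum>k\<in>?R. rot_point r X (i, rot r k))"
      unfolding width_def using r1 by (intro sum.reindex_bij_betw[symmetric] bij_rot) simp
    also have "\<dots> = width X i"
      unfolding width_def using rot_inverse rot_range[of r] r1 by (intro sum.cong) (auto simp: rot_point_def)
    finally show ?thesis .
  qed
  have point_rot: "rot_point r X (i, rot r k) = X (i, k)" if "k \<in> ?R" for X i k
    using rot_inverse(1)[OF that] rot_range[of r k] r1 by (simp add: rot_point_def)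
  have equiv: "f (rot_point r X) b (rot r k) = f X b k" if "k \<in> ?R" for X b k
    unfolding f_def inc_def cut_def width_rot point_rot[OF that] ..

  have width: "width X i = X (i, T i)"
    if "admissible r m T" "X \<in> realization r m T" "i \<le> ?N" for X T i
  proof -
    have "T i \<in> ?R" using that by (simp add: admissible_def)
    moreover have "X (i, k) = 0" if "k \<noteq> T i" for k
      using \<open>X \<in> realization r m T\<close> that unfolding realization_def by blast
    ultimately show ?thesis
      unfolding width_def by (subst sum.remove[of _ "T i"]) (auto intro!: sum.neutral)
  qed
  have X_nonneg: "0 \<le> X v" if "X \<in> realization r m T" for X T v
    using realization_le_1[OF that] by simp
  have cut_le: "cut X j \<in> {0..1}"
    if adm: "admissible r m T" and X: "X \<in> realization r m T" and j: "j \<le> n + 1" for X T j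
  proof -
    have sub: "{1..j} \<subseteq> ?J" using j by auto
    have w: "width X (\<kappa> a) = X (\<kappa> a, T (\<kappa> a))" if "a \<in> {1..j}" for a
      using width[OF adm X] \<kappa>_less[of a] that sub by (simp add: subset_iff less_imp_le)
    have "cut X j = (\<Sum>i\<in>\<kappa> ` {1..j}. X (i, T i))"
      unfolding cut_def using inj_on_subset[OF inj sub] w by (simp add: sum.reindex)
    moreover have "(\<Sum>i\<in>\<kappa> ` {1..j}. X (i, T i)) \<le> (\<Sum>i\<le>?N. X (i, T i))"
    proof (rule sum_mono2)
      show "\<kappa> ` {1..j} \<subseteq> {..?N}" using \<kappa>_sub sub by blast
    qed (use X_nonneg[OF X] in simp_all)
    moreover have "(\<Sum>i\<le>?N. X (i, T i)) = 1" using X unfolding realization_def by blast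
    ultimately show ?thesis using X_nonneg[OF X] by (auto intro: sum_nonneg)
  qed
  have f_real: "f X b k = (\<Sum>j\<in>{j \<in> ?J. T (\<kappa> j) = k}. inc b X j)"
    if adm: "admissible r m T" and X: "X \<in> realization r m T" and b: "b < D" for X T b k
  proof -
    have "(if 0 < X (\<kappa> j, k) then inc b X j else 0) = (if T (\<kappa> j) = k then inc b X j else 0)"
      if j: "j \<in> ?J" for j
    proof (cases "0 < X (\<kappa> j, k)")
      case True
      then have "k = T (\<kappa> j)" using X unfolding realization_def by fastforce
      then show ?thesis using True by simp
    next
      case False
      then have zero: "X (\<kappa> j, k) = 0" using X_nonneg[OF X, of "(\<kappa> j, k)"] by simp
      have "inc b X j = 0" if "T (\<kappa> j) = k"
      proof -
        have "width X (\<kappa> j) = 0"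
          using width[OF adm X, of "\<kappa> j"] \<kappa>_less[OF j] zero that by simp
        moreover have "{1..j} = insert j {1..j - 1}" "j \<notin> {1..j - 1}" using j by auto
        ultimately show ?thesis by (simp add: inc_def cut_def)
      qed
      then show ?thesis using False by simp
    qed
    then have "f X b k = (\<Sum>j\<in>?J. if T (\<kappa> j) = k then inc b X j else 0)"
      unfolding f_def if_P[OF b] by (intro sum.cong refl)
    also have "\<dots> = (\<Sum>j\<in>{j \<in> ?J. T (\<kappa> j) = k}. inc b X j)"
      by (rule sum.inter_filter[symmetric]) simp
    finally show ?thesis .
  qed

  have ucont: "\<exists>d>0. \<forall>T X Y b k. admissible r m T \<longrightarrow> X \<in> realization r m T \<longrightarrow>
      Y \<in> realization r m T \<longrightarrow> (\<forall>v. \<bar>X v - Y v\<bar> \<le> d) \<longrightarrow> b < m \<longrightarrow> k \<in> ?R \<longrightarrow>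
      \<bar>f X b k - f Y b k\<bar> \<le> e" if e: "e > 0" for e
  proof -
    define h where "h = e / (2 * (real n + 1))"
    have h: "h > 0" using e by (simp add: h_def)
    have "\<exists>d>0. \<forall>x\<in>{0..1}. \<forall>y\<in>{0..1}. \<bar>x - y\<bar> < d \<longrightarrow> \<bar>F b x - F b y\<bar> < h" if "b < D" for b
    proof -
      have "uniformly_continuous_on {0..1} (F b)"
        using cont[OF that] by (rule compact_uniformly_continuous) simp
      then show ?thesis using h unfolding uniformly_continuous_on_def dist_real_def by meson
    qed
    then obtain ds where ds: "\<And>b. b < D \<Longrightarrow> ds b > 0"
      "\<And>b x y. b < D \<Longrightarrow> x \<in> {0..1} \<Longrightarrow> y \<in> {0..1} \<Longrightarrow> \<bar>x - y\<bar> < ds b \<Longrightarrow> \<bar>F b x - F b y\<bar> < h"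
      by metis
    define d0 where "d0 = Min (insert 1 (ds ` {..<D}))"
    have d0: "d0 > 0" "\<And>b. b < D \<Longrightarrow> d0 \<le> ds b"
      using ds(1) by (auto simp: d0_def)
    define d where "d = min (d0 / (2 * (real n + 1))) (e / real r)"
    have d: "d > 0" using d0 e r1 by (simp add: d_def)
    have d_n: "(real n + 1) * d < d0"
    proof -
      have "(real n + 1) * d \<le> (real n + 1) * (d0 / (2 * (real n + 1)))"
        by (intro mult_left_mono) (simp_all add: d_def)
      also have "\<dots> = d0 / 2" by (simp add: field_simps)
      finally show ?thesis using d0(1) by simp
    qed
    have d_r: "(real r - 1) * d \<le> e"
    proof -
      have "(real r - 1) * d \<le> real r * (e / real r)"
        using d r1 by (intro mult_mono) (auto simp: d_def)
      then show ?thesis using r1 by simp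
    qed
    have "\<bar>f X b k - f Y b k\<bar> \<le> e"
      if adm: "admissible r m T" and X: "X \<in> realization r m T" and Y: "Y \<in> realization r m T"
        and close: "\<forall>v. \<bar>X v - Y v\<bar> \<le> d" and b: "b < m" for T X Y b k
    proof (cases "b < D")
      case True
      have cut_close: "\<bar>cut X j - cut Y j\<bar> < ds b" if j: "j \<le> n + 1" for j
      proof -
        have "\<bar>width X (\<kappa> a) - width Y (\<kappa> a)\<bar> \<le> d" if "a \<in> {1..j}" for a
        proof -
          have "\<kappa> a \<le> ?N" using \<kappa>_less[of a] that j by simp
          then show ?thesis using width[OF adm X] width[OF adm Y] close by simp
        qed
        then have "\<bar>cut X j - cut Y j\<bar> \<le> (\<Sum>a\<in>{1..j}. d)"
          unfolding cut_def sum_subtractf[symmetric] by (intro order_trans[OF sum_abs] sum_mono)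
        also have "\<dots> = real j * d" by simp
        also have "\<dots> \<le> (real n + 1) * d" using j d by (intro mult_right_mono) auto
        finally show ?thesis using d_n d0(2)[OF True] by linarith
      qed
      have F_close: "\<bar>F b (cut X j) - F b (cut Y j)\<bar> < h" if "j \<le> n + 1" for j
        using ds(2)[OF True cut_le[OF adm X that] cut_le[OF adm Y that] cut_close[OF that]] .
      let ?S = "{j \<in> ?J. T (\<kappa> j) = k}"
      have "\<bar>inc b X j - inc b Y j\<bar> \<le> 2 * h" if "j \<in> ?S" for j
      proof -
        have "j \<le> n + 1" "j - 1 \<le> n + 1" using that by auto
        then show ?thesis using F_close[of j] F_close[of "j - 1"] unfolding inc_def by linarith
      qed
      then have "\<bar>f X b k - f Y b k\<bar> \<le> (\<Sum>j\<in>?S. 2 * h)"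
        unfolding f_real[OF adm X True] f_real[OF adm Y True] sum_subtractf[symmetric]
        by (intro order_trans[OF sum_abs] sum_mono)
      also have "\<dots> \<le> (real n + 1) * (2 * h)"
      proof -
        have "card ?S \<le> card ?J" by (rule card_mono) auto
        then have "real (card ?S) \<le> real n + 1" by simp
        then show ?thesis using h by (simp add: mult_right_mono)
      qed
      also have "\<dots> = e" by (simp add: h_def field_simps)
      finally show ?thesis .
    next
      case False
      have "\<bar>f X b k - f Y b k\<bar> \<le> (\<Sum>i\<in>W (b - D). d)"
        using False close unfolding f_def by (simp only: if_False sum_subtractf[symmetric])
          (intro order_trans[OF sum_abs] sum_mono, simp)
      also have "\<dots> \<le> (real r - 1) * d"
        using W(3)[of "b - D"] r1 d by (simp add: mult_right_mono of_nat_diff flip: of_nat_le_iff)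
      finally show ?thesis using d_r by linarith
    qed
    then show ?thesis using d by blast
  qed

  obtain T X where adm: "admissible r m T" and X: "X \<in> realization r m T"
    and zero: "\<And>b k k'. b < m \<Longrightarrow> k \<in> ?R \<Longrightarrow> k' \<in> ?R \<Longrightarrow> f X b k = f X b k'"
    using equivariant_zero[OF r _ equiv ucont] D by (metis gr_zeroI not_less_zero)

  have dummy: "X (i, T i) = 0" if i: "i \<in> E" for i
  proof -
    obtain q where q: "q < m - D" "i \<in> W q" using W(1) i by blast
    have f: "f X (D + q) k = (\<Sum>i\<in>W q. X (i, k))" for k by (simp add: f_def)
    have "\<not> ?R \<subseteq> T ` W q"
    proof
      assume "?R \<subseteq> T ` W q"
      then have "card ?R \<le> card (T ` W q)" using W(2) by (intro card_mono) auto
      also have "\<dots> \<le> card (W q)" using W(2) by (rule card_image_le)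
      finally show False using W(3)[of q] r1 by simp
    qed
    then obtain k where k: "k \<in> ?R" "k \<notin> T ` W q" by blast
    have "X (i, k) = 0" if "i \<in> W q" for i
      using X k(2) that unfolding realization_def by blast
    then have "f X (D + q) k = 0" unfolding f by (intro sum.neutral) blast
    moreover have "i \<le> ?N" using W_le q by blast
    then have "T i \<in> ?R" using adm by (simp add: admissible_def)
    ultimately have "f X (D + q) (T i) = 0" using zero[of "D + q" "T i" k] q(1) k(1) by simp
    then show ?thesis
      unfolding f using q(2) W(2) X_nonneg[OF X] by (simp add: sum_nonneg_eq_0_iff)
  qed
  have w: "width X (\<kappa> a) = X (\<kappa> a, T (\<kappa> a))" if "a \<in> ?J" for a
    using width[OF adm X] \<kappa>_less[OF that] by simp
  have total: "cut X (n + 1) = 1"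
  proof -
    have "cut X (n + 1) = (\<Sum>i\<in>\<kappa> ` ?J. X (i, T i))"
      unfolding cut_def using inj w by (simp add: sum.reindex)
    also have "\<dots> = (\<Sum>i\<le>?N. X (i, T i))"
      by (rule sum.mono_neutral_left) (use \<kappa>_sub dummy in \<open>auto simp: E_def\<close>)
    also have "\<dots> = 1" using X unfolding realization_def by blast
    finally show ?thesis .
  qed
  define P where "P k = {j \<in> ?J. T (\<kappa> j) = int k - 1}" for k
  show ?thesis
  proof (intro exI[of _ "cut X"] exI[of _ P] conjI ballI allI impI)
    show "cuts n (cut X)"
      unfolding cuts_def
    proof (intro conjI allI impI)
      show "cut X 0 = 0" by (simp add: cut_def)
      show "cut X (n + 1) = 1" by (rule total)
      fix j assume "j \<le> n"
      then have "0 \<le> width X (\<kappa> (Suc j))" using w[of "Suc j"] X_nonneg[OF X] by simp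
      then show "cut X j \<le> cut X (j + 1)" by (simp add: cut_def)
    qed
    show "indexed_partition r P ?J"
      unfolding indexed_partition_def
    proof
      show "disjoint_family_on P {1..r}" by (auto simp: disjoint_family_on_def P_def)
      show "(\<Union>k\<in>{1..r}. P k) = ?J"
      proof (intro equalityI subsetI)
        fix j assume j: "j \<in> ?J"
        then have "\<kappa> j \<le> ?N" using \<kappa>_less by (simp add: less_imp_le)
        then have "T (\<kappa> j) \<in> ?R" using adm unfolding admissible_def by blast
        then have "nat (T (\<kappa> j) + 1) \<in> {1..r}" "j \<in> P (nat (T (\<kappa> j) + 1))"
          using j by (auto simp: P_def)
        then show "j \<in> (\<Union>k\<in>{1..r}. P k)" by blast
      qed (auto simp: P_def)
    qed
    fix i k assume i: "i \<in> {1..m}"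
    have "j = j'" if "j \<in> C i \<inter> P k" "j' \<in> C i \<inter> P k" for j j'
    proof (rule ccontr)
      assume "j \<noteq> j'"
      have jJ: "j \<in> ?J" "j' \<in> ?J" using that by (auto simp: P_def)
      then have "\<kappa> j \<noteq> \<kappa> j'" using inj \<open>j \<noteq> j'\<close> by (auto dest: inj_onD)
      moreover have "\<kappa> j div (r - 1) = \<kappa> j' div (r - 1)" using block[OF i] that by simp
      moreover have "\<kappa> j \<le> ?N" "\<kappa> j' \<le> ?N" using \<kappa>_less jJ by (simp_all add: less_imp_le)
      ultimately have "T (\<kappa> j) \<noteq> T (\<kappa> j')" using adm unfolding admissible_def by blast
      then show False using that by (simp add: P_def)
    qed
    moreover have "finite (C i \<inter> P k)" using finC[OF i] by blast
    ultimately show "card (C i \<inter> P k) \<le> 1" by (simp add: card_le_Suc0_iff_eq)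
  next
    fix b k k' assume b: "b < D" and k: "k \<in> {1..r}" "k' \<in> {1..r}"
    have "f X b (int k - 1) = (\<Sum>j\<in>P k. F b (cut X j) - F b (cut X (j - 1)))" for k
      unfolding f_real[OF adm X b] P_def inc_def ..
    moreover have "f X b (int k - 1) = f X b (int k' - 1)"
      using k b D by (intro zero) auto
    ultimately show "(\<Sum>j\<in>P k. F b (cut X j) - F b (cut X (j - 1))) =
        (\<Sum>j\<in>P k'. F b (cut X j) - F b (cut X (j - 1)))" by simp
  qed
qed

section \<open>Arc length\<close>

text \<open>Inscribed polygons are given by lists of parameters that may repeat.  Such lists can be
concatenated and refined without side conditions, and repetitions do not change the sums
(\<open>inscribed_sums_eq\<close>).\<close>

fun polygon_length :: "(real \<Rightarrow> 'a::real_normed_vector) \<Rightarrow> real list \<Rightarrow> real" where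
  "polygon_length \<gamma> (x # y # xs) = norm (\<gamma> y - \<gamma> x) + polygon_length \<gamma> (y # xs)"
| "polygon_length \<gamma> _ = 0"

lemma polygon_length_Cons:
  "polygon_length \<gamma> (x # xs) = (if xs = [] then 0 else norm (\<gamma> (hd xs) - \<gamma> x)) + polygon_length \<gamma> xs"
  by (cases xs) auto

lemma polygon_length_append_join:
  "polygon_length \<gamma> (xs @ b # ys) = polygon_length \<gamma> (xs @ [b]) + polygon_length \<gamma> (b # ys)"
  by (induction xs) (auto simp: polygon_length_Cons hd_append)

lemma polygon_length_append_ge:
  "polygon_length \<gamma> xs + polygon_length \<gamma> ys \<le> polygon_length \<gamma> (xs @ ys)"
  by (induction xs) (auto simp: polygon_length_Cons)

lemma polygon_length_insert:
  "polygon_length \<gamma> (xs @ ys) \<le> polygon_length \<gamma> (xs @ b # ys)"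
proof (induction xs)
  case Nil
  show ?case by (simp add: polygon_length_Cons)
next
  case (Cons x xs)
  show ?case
  proof (cases "xs = []")
    case True
    show ?thesis
    proof (cases ys)
      case (Cons y ys')
      have "norm (\<gamma> y - \<gamma> x) \<le> norm (\<gamma> b - \<gamma> x) + norm (\<gamma> y - \<gamma> b)"
        using norm_triangle_ineq[of "\<gamma> b - \<gamma> x" "\<gamma> y - \<gamma> b"] by (simp add: algebra_simps)
      then show ?thesis using True Cons by simp
    qed (simp add: True)
  next
    case False
    then show ?thesis using Cons.IH by (auto simp: polygon_length_Cons)
  qed
qed

lemma polygon_length_map: "polygon_length \<gamma> (map \<phi> xs) = polygon_length (\<gamma> \<circ> \<phi>) xs"
  by (induction xs) (auto simp: polygon_length_Cons hd_map)

lemma polygon_length_cong: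
  "(\<And>x. x \<in> set xs \<Longrightarrow> \<gamma> x = \<gamma>' x) \<Longrightarrow> polygon_length \<gamma> xs = polygon_length \<gamma>' xs"
  by (induction xs) (auto simp: polygon_length_Cons)

lemma polygon_length_remdups_adj: "polygon_length \<gamma> (remdups_adj xs) = polygon_length \<gamma> xs"
proof (induction xs rule: remdups_adj.induct)
  case (3 x y xs)
  then show ?case by (auto simp: polygon_length_Cons[of _ x])
qed simp_all

lemma polygon_length_conv_sum:
  "polygon_length \<gamma> xs = (\<Sum>j\<in>{1..<length xs}. norm (\<gamma> (xs ! j) - \<gamma> (xs ! (j - 1))))"
proof (induction \<gamma> xs rule: polygon_length.induct)
  case (1 \<gamma> x y xs)
  have "(\<Sum>j\<in>{1..<length (x # y # xs)}. norm (\<gamma> ((x # y # xs) ! j) - \<gamma> ((x # y # xs) ! (j - 1)))) =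
      norm (\<gamma> y - \<gamma> x) +
      (\<Sum>j\<in>{Suc 1..<Suc (length (y # xs))}. norm (\<gamma> ((x # y # xs) ! j) - \<gamma> ((x # y # xs) ! (j - 1))))"
    by (subst sum.atLeast_Suc_lessThan) simp_all
  also have "(\<Sum>j\<in>{Suc 1..<Suc (length (y # xs))}. norm (\<gamma> ((x # y # xs) ! j) - \<gamma> ((x # y # xs) ! (j - 1))))
      = (\<Sum>j\<in>{1..<length (y # xs)}. norm (\<gamma> ((y # xs) ! j) - \<gamma> ((y # xs) ! (j - 1))))"
    by (subst sum.shift_bounds_Suc_ivl) (intro sum.cong, auto simp: nth_Cons')
  finally show ?case using 1 by simp
qed simp_all

lemma sorted_distinct_remdups_adj: "sorted xs \<Longrightarrow> distinct (remdups_adj xs)"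
proof (induction xs rule: remdups_adj.induct)
  case (3 x y xs)
  then show ?case by (cases "x = y") (auto dest: order_antisym)
qed simp_all

definition polygon_lengths :: "(real \<Rightarrow> 'a::real_normed_vector) \<Rightarrow> real \<Rightarrow> real \<Rightarrow> real set" where
  "polygon_lengths \<gamma> a b = {polygon_length \<gamma> xs | xs. sorted xs \<and> set xs \<subseteq> {a..b}}"

definition arc_length :: "(real \<Rightarrow> 'a::real_normed_vector) \<Rightarrow> real \<Rightarrow> real \<Rightarrow> real" where
  "arc_length \<gamma> a b = Sup (polygon_lengths \<gamma> a b)"

lemma inscribed_sums_eq: "inscribed_sums \<gamma> = polygon_lengths \<gamma> 0 1"
proof (intro set_eqI iffI)
  fix s assume "s \<in> inscribed_sums \<gamma>"
  then obtain n x where s: "s = (\<Sum>j\<in>{1..<n}. norm (\<gamma> (x (Suc j)) - \<gamma> (x j)))"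
    and mono: "strict_mono_on {1..n} x" and x: "x ` {1..n} \<subseteq> {0..1::real}"
    unfolding inscribed_sums_def by blast
  define xs where "xs = map x [1..<Suc n]"
  have nth: "xs ! j = x (Suc j)" if "j < n" for j
    using that by (simp add: xs_def del: upt_Suc)
  have len: "length xs = n" by (simp add: xs_def)
  have "s = polygon_length \<gamma> xs"
    unfolding s polygon_length_conv_sum len
  proof (rule sum.cong)
    fix j assume "j \<in> {1..<n}"
    then show "norm (\<gamma> (x (Suc j)) - \<gamma> (x j)) = norm (\<gamma> (xs ! j) - \<gamma> (xs ! (j - 1)))"
      using nth[of j] nth[of "j - 1"] by (simp add: Suc_diff_le less_imp_diff_less)
  qed simp
  moreover have "sorted xs"
    unfolding sorted_iff_nth_mono len
    using strict_mono_on_leD[OF mono] by (simp add: nth)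
  moreover have "set xs \<subseteq> {0..1}" using x by (auto simp: xs_def)
  ultimately show "s \<in> polygon_lengths \<gamma> 0 1" unfolding polygon_lengths_def by blast
next
  fix s assume "s \<in> polygon_lengths \<gamma> 0 1"
  then obtain ys where ys: "s = polygon_length \<gamma> ys" "sorted ys" "set ys \<subseteq> {0..1}"
    unfolding polygon_lengths_def by blast
  define xs where "xs = remdups_adj ys"
  have xs: "s = polygon_length \<gamma> xs" "sorted xs" "distinct xs" "set xs \<subseteq> {0..1}"
    using ys by (simp_all add: xs_def polygon_length_remdups_adj sorted_remdups_adj sorted_distinct_remdups_adj)
  define x where "x j = xs ! (j - 1)" for j
  have strict: "sorted_wrt (<) xs" using xs(2,3) by (simp add: strict_sorted_iff)
  have "strict_mono_on {1..length xs} x"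
  proof (rule strict_mono_onI)
    fix i j assume "i \<in> {1..length xs}" "j \<in> {1..length xs}" "i < j"
    then show "x i < x j"
      using sorted_wrt_nth_less[OF strict, of "i - 1" "j - 1"] by (simp add: x_def)
  qed
  moreover have "x ` {1..length xs} \<subseteq> {0..1}" using xs(4) by (auto simp: x_def subset_iff)
  moreover have "s = (\<Sum>j\<in>{1..<length xs}. norm (\<gamma> (x (Suc j)) - \<gamma> (x j)))"
    unfolding xs(1) polygon_length_conv_sum by (intro sum.cong refl) (simp add: x_def)
  ultimately show "s \<in> inscribed_sums \<gamma>" unfolding inscribed_sums_def by blast
qed

lemma curve_length_eq: "curve_length \<gamma> = arc_length \<gamma> 0 1"
  by (simp add: curve_length_def arc_length_def inscribed_sums_eq)

lemma rectifiable_iff: "rectifiable \<gamma> \<longleftrightarrow> bdd_above (polygon_lengths \<gamma> 0 1)"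
proof
  assume "rectifiable \<gamma>"
  then show "bdd_above (polygon_lengths \<gamma> 0 1)"
    unfolding rectifiable_def inscribed_sums_eq bdd_above_def by (meson less_imp_le)
next
  assume "bdd_above (polygon_lengths \<gamma> 0 1)"
  then obtain M where "\<forall>s\<in>polygon_lengths \<gamma> 0 1. s \<le> M" by (auto simp: bdd_above_def)
  then have "\<bar>M\<bar> + 1 > 0 \<and> (\<forall>s\<in>inscribed_sums \<gamma>. s < \<bar>M\<bar> + 1)"
    unfolding inscribed_sums_eq by fastforce
  then show "rectifiable \<gamma>" unfolding rectifiable_def by blast
qed

lemma zero_in_polygon_lengths: "0 \<in> polygon_lengths \<gamma> a b"
  unfolding polygon_lengths_def by (auto intro!: exI[of _ "[]"])

lemma polygon_lengths_mono: "a \<le> a' \<Longrightarrow> b' \<le> b \<Longrightarrow> polygon_lengths \<gamma> a' b' \<subseteq> polygon_lengths \<gamma> a b"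
  unfolding polygon_lengths_def by fastforce

lemma polygon_length_le_arc_length:
  "bdd_above (polygon_lengths \<gamma> a b) \<Longrightarrow> sorted xs \<Longrightarrow> set xs \<subseteq> {a..b} \<Longrightarrow>
    polygon_length \<gamma> xs \<le> arc_length \<gamma> a b"
  unfolding arc_length_def by (rule cSup_upper) (auto simp: polygon_lengths_def)

lemma arc_length_nonneg: "bdd_above (polygon_lengths \<gamma> a b) \<Longrightarrow> 0 \<le> arc_length \<gamma> a b"
  unfolding arc_length_def by (rule cSup_upper[OF zero_in_polygon_lengths])

lemma arc_length_least:
  "(\<And>xs. sorted xs \<Longrightarrow> set xs \<subseteq> {a..b} \<Longrightarrow> polygon_length \<gamma> xs \<le> M) \<Longrightarrow> arc_length \<gamma> a b \<le> M"
  unfolding arc_length_def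
proof (rule cSup_least)
  show "polygon_lengths \<gamma> a b \<noteq> {}" using zero_in_polygon_lengths by blast
qed (auto simp: polygon_lengths_def)

lemma polygon_length_split:
  assumes "sorted zs"
  shows "polygon_length \<gamma> zs \<le>
    polygon_length \<gamma> (filter (\<lambda>z. z \<le> b) zs @ [b]) + polygon_length \<gamma> (b # filter (\<lambda>z. b < z) zs)"
proof -
  have split: "filter (\<lambda>z. z \<le> b) zs @ filter (\<lambda>z. b < z) zs = zs"
    using assms
  proof (induction zs)
    case (Cons z zs)
    show ?case
    proof (cases "z \<le> b")
      case False
      then have "filter (\<lambda>z. z \<le> b) zs = []" "filter (\<lambda>z. b < z) zs = zs"
        using Cons.prems by (auto simp: filter_empty_conv filter_id_conv)
      then show ?thesis using False by simp
    qed (use Cons in auto)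
  qed simp
  have "polygon_length \<gamma> (filter (\<lambda>z. z \<le> b) zs @ filter (\<lambda>z. b < z) zs) \<le>
      polygon_length \<gamma> (filter (\<lambda>z. z \<le> b) zs @ b # filter (\<lambda>z. b < z) zs)"
    by (rule polygon_length_insert)
  then show ?thesis
    unfolding split
    using polygon_length_append_join[of \<gamma> "filter (\<lambda>z. z \<le> b) zs" b "filter (\<lambda>z. b < z) zs"]
    by linarith
qed

text \<open>Inserting \<open>b\<close> splits an inscribed polygon over \<open>[a, c]\<close> into two without shortening it, and
concatenating polygons over \<open>[a, b]\<close> and \<open>[b, c]\<close> gives one over \<open>[a, c]\<close> that is at least as long as both together.\<close>

lemma arc_length_add:
  assumes ab: "a \<le> b" "b \<le> c"
    and bdd: "bdd_above (polygon_lengths \<gamma> a b)" "bdd_above (polygon_lengths \<gamma> b c)"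
  shows "bdd_above (polygon_lengths \<gamma> a c)" (is ?bdd)
    and "arc_length \<gamma> a c = arc_length \<gamma> a b + arc_length \<gamma> b c"
proof -
  have upper: "polygon_length \<gamma> zs \<le> arc_length \<gamma> a b + arc_length \<gamma> b c"
    if zs: "sorted zs" "set zs \<subseteq> {a..c}" for zs
  proof -
    have "sorted (filter (\<lambda>z. z \<le> b) zs @ [b])" "sorted (b # filter (\<lambda>z. b < z) zs)"
      using zs(1) by (auto simp: sorted_append sorted_filter[of "\<lambda>x. x", simplified])
    then have "polygon_length \<gamma> (filter (\<lambda>z. z \<le> b) zs @ [b]) \<le> arc_length \<gamma> a b"
      "polygon_length \<gamma> (b # filter (\<lambda>z. b < z) zs) \<le> arc_length \<gamma> b c"
      using zs(2) ab by (intro polygon_length_le_arc_length bdd; fastforce)+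
    then show ?thesis using polygon_length_split[OF zs(1), of \<gamma> b] by linarith
  qed
  show bdd3: ?bdd
    unfolding bdd_above_def polygon_lengths_def using upper by blast
  have "arc_length \<gamma> a b \<le> arc_length \<gamma> a c - arc_length \<gamma> b c"
  proof (rule arc_length_least)
    fix xs assume xs: "sorted xs" "set xs \<subseteq> {a..b}"
    have "arc_length \<gamma> b c \<le> arc_length \<gamma> a c - polygon_length \<gamma> xs"
    proof (rule arc_length_least)
      fix ys assume ys: "sorted ys" "set ys \<subseteq> {b..c}"
      have "sorted (xs @ ys)" using xs ys by (fastforce simp: sorted_append)
      moreover have "set (xs @ ys) \<subseteq> {a..c}" using xs ys ab by fastforce
      ultimately have "polygon_length \<gamma> (xs @ ys) \<le> arc_length \<gamma> a c"
        by (rule polygon_length_le_arc_length[OF bdd3])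
      then show "polygon_length \<gamma> ys \<le> arc_length \<gamma> a c - polygon_length \<gamma> xs"
        using polygon_length_append_ge[of \<gamma> xs ys] by linarith
    qed
    then show "polygon_length \<gamma> xs \<le> arc_length \<gamma> a c - arc_length \<gamma> b c" by linarith
  qed
  moreover have "arc_length \<gamma> a c \<le> arc_length \<gamma> a b + arc_length \<gamma> b c"
    by (rule arc_length_least) (rule upper)
  ultimately show "arc_length \<gamma> a c = arc_length \<gamma> a b + arc_length \<gamma> b c" by linarith
qed

text \<open>Monotone maps send sorted lists to sorted lists, and \<open>\<psi>\<close> lifts every list of parameters back along \<open>\<phi>\<close>.
Constant \<open>\<phi>\<close> are included, so that subpaths over degenerate intervals are covered.\<close>

lemma polygon_lengths_reparametrize:
  assumes "mono \<phi>" "mono \<psi>" "\<And>y. y \<in> {\<phi> a..\<phi> b} \<Longrightarrow> \<psi> y \<in> {a..b} \<and> \<phi> (\<psi> y) = y"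
  shows "polygon_lengths (\<gamma> \<circ> \<phi>) a b = polygon_lengths \<gamma> (\<phi> a) (\<phi> b)"
proof (intro set_eqI iffI)
  fix s assume "s \<in> polygon_lengths (\<gamma> \<circ> \<phi>) a b"
  then obtain xs where xs: "s = polygon_length (\<gamma> \<circ> \<phi>) xs" "sorted xs" "set xs \<subseteq> {a..b}"
    unfolding polygon_lengths_def by blast
  then have "s = polygon_length \<gamma> (map \<phi> xs)" "sorted (map \<phi> xs)" "set (map \<phi> xs) \<subseteq> {\<phi> a..\<phi> b}"
    using assms(1) by (auto simp: polygon_length_map sorted_iff_nth_mono monoD)
  then show "s \<in> polygon_lengths \<gamma> (\<phi> a) (\<phi> b)" unfolding polygon_lengths_def by blast
next
  fix s assume "s \<in> polygon_lengths \<gamma> (\<phi> a) (\<phi> b)"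
  then obtain ys where ys: "s = polygon_length \<gamma> ys" "sorted ys" "set ys \<subseteq> {\<phi> a..\<phi> b}"
    unfolding polygon_lengths_def by blast
  have "map \<phi> (map \<psi> ys) = ys" using ys(3) assms(3) by (auto intro!: map_idI simp: subset_iff)
  then have "s = polygon_length (\<gamma> \<circ> \<phi>) (map \<psi> ys)" by (simp add: ys(1) flip: polygon_length_map)
  moreover have "sorted (map \<psi> ys)" using ys(2) assms(2) by (auto simp: sorted_iff_nth_mono monoD)
  moreover have "set (map \<psi> ys) \<subseteq> {a..b}" using ys(3) assms(3) by (auto simp: subset_iff)
  ultimately show "s \<in> polygon_lengths (\<gamma> \<circ> \<phi>) a b" unfolding polygon_lengths_def by blast
qed

lemma polygon_lengths_cong:
  assumes "\<And>x. x \<in> {a..b} \<Longrightarrow> \<gamma> x = \<gamma>' x"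
  shows "polygon_lengths \<gamma> a b = polygon_lengths \<gamma>' a b"
proof -
  have "polygon_length \<gamma> xs = polygon_length \<gamma>' xs" if "set xs \<subseteq> {a..b}" for xs
    using that assms by (intro polygon_length_cong) blast
  then show ?thesis unfolding polygon_lengths_def by (metis (no_types, lifting))
qed

lemma polygon_lengths_subpath:
  assumes "a \<le> b"
  shows "polygon_lengths (subpath a b \<gamma>) 0 1 = polygon_lengths \<gamma> a b"
proof -
  \<comment> \<open>If \<open>a = b\<close>, then \<open>\<psi>\<close> is constantly \<open>0\<close>, because division by zero yields zero.\<close>
  let ?\<phi> = "\<lambda>x. (b - a) * x + a" and ?\<psi> = "\<lambda>y. (y - a) / (b - a)"
  have "subpath a b \<gamma> = \<gamma> \<circ> ?\<phi>" by (simp add: subpath_def comp_def)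
  moreover have "polygon_lengths (\<gamma> \<circ> ?\<phi>) 0 1 = polygon_lengths \<gamma> (?\<phi> 0) (?\<phi> 1)"
  proof (rule polygon_lengths_reparametrize)
    show "mono ?\<phi>" "mono ?\<psi>" using assms by (auto intro!: monoI mult_left_mono divide_right_mono)
    fix y assume "y \<in> {?\<phi> 0..?\<phi> 1}"
    then show "?\<psi> y \<in> {0..1} \<and> ?\<phi> (?\<psi> y) = y" by (auto simp: divide_le_eq_1)
  qed
  ultimately show ?thesis by simp
qed

lemma polygon_lengths_translate:
  "polygon_lengths ((\<lambda>y. v + y) \<circ> \<gamma>) a b = polygon_lengths \<gamma> a b"
proof -
  have "polygon_length ((\<lambda>y. v + y) \<circ> \<gamma>) xs = polygon_length \<gamma> xs" for xs
    by (induction xs) (auto simp: polygon_length_Cons)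
  then show ?thesis by (simp add: polygon_lengths_def)
qed

lemma curve_length_joinpaths:
  assumes "rectifiable p" "rectifiable q" "pathfinish p = pathstart q"
  shows "rectifiable (p +++ q)" and "curve_length (p +++ q) = curve_length p + curve_length q"
proof -
  let ?\<phi> = "\<lambda>x::real. 2 * x" and ?\<chi> = "\<lambda>x::real. 2 * x - 1"
  have "polygon_lengths (p +++ q) 0 (1/2) = polygon_lengths (p \<circ> ?\<phi>) 0 (1/2)"
    by (rule polygon_lengths_cong) (simp add: joinpaths_def)
  also have "\<dots> = polygon_lengths p (?\<phi> 0) (?\<phi> (1/2))"
    by (rule polygon_lengths_reparametrize[where \<psi> = "\<lambda>y. y / 2"]) (auto intro!: monoI)
  finally have p: "polygon_lengths (p +++ q) 0 (1/2) = polygon_lengths p 0 1" by simp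
  have "polygon_lengths (p +++ q) (1/2) 1 = polygon_lengths (q \<circ> ?\<chi>) (1/2) 1"
  proof (rule polygon_lengths_cong)
    fix x :: real assume "x \<in> {1/2..1}"
    then show "(p +++ q) x = (q \<circ> ?\<chi>) x"
    proof (cases "x = 1/2")
      case True
      show ?thesis unfolding True using assms(3)
        by (simp add: joinpaths_def pathfinish_def pathstart_def)
    qed (simp add: joinpaths_def)
  qed
  also have "\<dots> = polygon_lengths q (?\<chi> (1/2)) (?\<chi> 1)"
    by (rule polygon_lengths_reparametrize[where \<psi> = "\<lambda>y. (y + 1) / 2"])
      (auto intro!: monoI simp: field_simps)
  finally have q: "polygon_lengths (p +++ q) (1/2) 1 = polygon_lengths q 0 1" by simp
  have bdd: "bdd_above (polygon_lengths (p +++ q) 0 (1/2))" "bdd_above (polygon_lengths (p +++ q) (1/2) 1)"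
    using assms by (simp_all add: p q rectifiable_iff)
  have "(0::real) \<le> 1/2" "1/2 \<le> (1::real)" by simp_all
  note add = arc_length_add[OF this bdd]
  show "rectifiable (p +++ q)" using add(1) by (simp add: rectifiable_iff)
  show "curve_length (p +++ q) = curve_length p + curve_length q"
    using add(2) by (simp add: curve_length_eq arc_length_def p q)
qed

lemma polygon_length_close:
  fixes \<gamma> :: "real \<Rightarrow> 'a::real_normed_vector"
  assumes "\<And>x y. x \<in> set xs \<Longrightarrow> y \<in> set xs \<Longrightarrow> norm (\<gamma> y - \<gamma> x) \<le> h"
  shows "polygon_length \<gamma> xs \<le> real (length xs) * h"
  using assms
proof (induction xs)
  case (Cons x xs)
  have "0 \<le> h" using Cons.prems[of x x] by simp
  moreover have "norm (\<gamma> (hd xs) - \<gamma> x) \<le> h" if "xs \<noteq> []" using Cons.prems that by simp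
  moreover have "polygon_length \<gamma> xs \<le> real (length xs) * h" using Cons by simp
  ultimately show ?case by (auto simp: polygon_length_Cons algebra_simps)
qed simp

text \<open>Choose an inscribed polygon whose length is within \<open>e / 2\<close> of the total.  Insert \<open>s\<close> and \<open>t\<close> as
further vertices.  If \<open>s\<close> and \<open>t\<close> are close, the part between them contributes at most \<open>e / 2\<close> by uniform
continuity, as its number of vertices is bounded independently of \<open>s\<close> and \<open>t\<close>.  The parts before \<open>s\<close> and after \<open>t\<close> are
bounded by the arc lengths there, so little arc length is left between \<open>s\<close> and \<open>t\<close>.\<close>

lemma continuous_on_arc_length:
  assumes rect: "rectifiable \<gamma>" and cont: "continuous_on {0..1} \<gamma>"
  shows "continuous_on {0..1} (arc_length \<gamma> 0)"
proof -
  have bdd: "bdd_above (polygon_lengths \<gamma> a b)" if "0 \<le> a" "b \<le> 1" for a b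
    using rect polygon_lengths_mono[OF that] unfolding rectifiable_iff by (rule bdd_above_mono)
  have add: "arc_length \<gamma> a c = arc_length \<gamma> a b + arc_length \<gamma> b c"
    if "0 \<le> a" "a \<le> b" "b \<le> c" "c \<le> 1" for a b c
    using that by (intro arc_length_add(2) bdd) auto
  have ucont: "uniformly_continuous_on {0..1} \<gamma>"
    using cont by (rule compact_uniformly_continuous) simp
  have small: "\<exists>d>0. \<forall>s t. 0 \<le> s \<longrightarrow> s \<le> t \<longrightarrow> t \<le> 1 \<longrightarrow> t - s < d \<longrightarrow> arc_length \<gamma> s t < e"
    if e: "e > 0" for e
  proof -
    have "arc_length \<gamma> 0 1 - e / 2 < Sup (polygon_lengths \<gamma> 0 1)" using e by (simp add: arc_length_def)
    moreover have "polygon_lengths \<gamma> 0 1 \<noteq> {}" using zero_in_polygon_lengths by blast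
    ultimately obtain l where "l \<in> polygon_lengths \<gamma> 0 1" "arc_length \<gamma> 0 1 - e / 2 < l"
      using less_cSupD by meson
    then obtain xs where xs: "sorted xs" "set xs \<subseteq> {0..1}" "arc_length \<gamma> 0 1 - e / 2 < polygon_length \<gamma> xs"
      unfolding polygon_lengths_def by blast
    define h where "h = e / (2 * (length xs + 3))"
    have h: "h > 0" using e by (simp add: h_def)
    then obtain d where d: "d > 0" and close: "\<And>x y. x \<in> {0..1} \<Longrightarrow> y \<in> {0..1} \<Longrightarrow> dist y x < d \<Longrightarrow>
        dist (\<gamma> y) (\<gamma> x) < h"
      using ucont unfolding uniformly_continuous_on_def by meson
    have "arc_length \<gamma> s t < e" if st: "0 \<le> s" "s \<le> t" "t \<le> 1" "t - s < d" for s t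
    proof -
      define xs1 where "xs1 = filter (\<lambda>z. s < z) xs"
      define A where "A = filter (\<lambda>z. z \<le> s) xs @ [s]"
      define M where "M = filter (\<lambda>z. z \<le> t) (s # xs1) @ [t]"
      define B where "B = t # filter (\<lambda>z. t < z) (s # xs1)"
      have filt: "sorted (filter Q zs)" if "sorted zs" for Q and zs :: "real list"
        using sorted_filter[of "\<lambda>x. x" zs Q] that by simp
      have xs1: "sorted (s # xs1)" "set xs1 \<subseteq> {s..1}"
        using filt[OF xs(1), of "\<lambda>z. s < z"] xs(2) unfolding xs1_def by auto
      have A: "sorted A" "set A \<subseteq> {0..s}"
        using filt[OF xs(1), of "\<lambda>z. z \<le> s"] xs(2) st unfolding A_def by (auto simp: sorted_append)
      have B: "sorted B" "set B \<subseteq> {t..1}"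
        using filt[OF xs1(1), of "\<lambda>z. t < z"] xs1(2) st unfolding B_def by auto
      have M: "set M \<subseteq> {s..t}" using xs1(2) st unfolding M_def by auto
      have lenM: "length M \<le> length xs + 2"
        using length_filter_le[of "\<lambda>z. z \<le> t" "s # xs1"] length_filter_le[of "\<lambda>z. s < z" xs]
        unfolding M_def xs1_def by simp
      have "polygon_length \<gamma> xs \<le> polygon_length \<gamma> A + polygon_length \<gamma> (s # xs1)"
        using polygon_length_split[OF xs(1), of \<gamma> s] unfolding A_def xs1_def .
      moreover have "polygon_length \<gamma> (s # xs1) \<le> polygon_length \<gamma> M + polygon_length \<gamma> B"
        using polygon_length_split[OF xs1(1), of \<gamma> t] unfolding M_def B_def .
      moreover have "polygon_length \<gamma> A \<le> arc_length \<gamma> 0 s"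
        using st by (intro polygon_length_le_arc_length bdd A) simp_all
      moreover have "polygon_length \<gamma> B \<le> arc_length \<gamma> t 1"
        using st by (intro polygon_length_le_arc_length bdd B) simp_all
      moreover have "polygon_length \<gamma> M \<le> real (length M) * h"
      proof (rule polygon_length_close)
        fix x y assume "x \<in> set M" "y \<in> set M"
        then have "x \<in> {s..t}" "y \<in> {s..t}" using M by auto
        then have "x \<in> {0..1}" "y \<in> {0..1}" "dist y x < d" using st by (auto simp: dist_real_def)
        from close[OF this] show "norm (\<gamma> y - \<gamma> x) \<le> h" by (simp add: dist_norm)
      qed
      moreover have "real (length M) * h \<le> e / 2"
      proof -
        have "real (length M) * h \<le> (real (length xs) + 3) * h"
          using h lenM by (intro mult_right_mono) simp_all
        also have "\<dots> = e / 2" unfolding h_def by (simp add: field_simps)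
        finally show ?thesis .
      qed
      moreover have "arc_length \<gamma> 0 1 = arc_length \<gamma> 0 s + arc_length \<gamma> s t + arc_length \<gamma> t 1"
        using add[of 0 s 1] add[of s t 1] st by simp
      ultimately show ?thesis using xs(3) by linarith
    qed
    then show ?thesis using d by blast
  qed
  show ?thesis
    unfolding continuous_on_iff
  proof (intro ballI allI impI)
    fix x e :: real assume x: "x \<in> {0..1}" and e: "e > 0"
    obtain d where d: "d > 0" "\<And>s t. 0 \<le> s \<Longrightarrow> s \<le> t \<Longrightarrow> t \<le> 1 \<Longrightarrow> t - s < d \<Longrightarrow> arc_length \<gamma> s t < e"
      using small[OF e] by blast
    have "dist (arc_length \<gamma> 0 y) (arc_length \<gamma> 0 x) < e" if y: "y \<in> {0..1}" "dist y x < d" for y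
    proof -
      have *: "\<bar>arc_length \<gamma> 0 t - arc_length \<gamma> 0 s\<bar> < e" if "0 \<le> s" "s \<le> t" "t \<le> 1" "t - s < d" for s t
        using add[of 0 s t] d(2)[OF that] arc_length_nonneg[OF bdd, of s t] that by simp
      show ?thesis
        using *[of x y] *[of y x] x y by (cases "x \<le> y") (auto simp: dist_real_def abs_minus_commute)
    qed
    then show "\<exists>d>0. \<forall>y\<in>{0..1}. dist y x < d \<longrightarrow> dist (arc_length \<gamma> 0 y) (arc_length \<gamma> 0 x) < e"
      using d(1) by blast
  qed
qed

section \<open>Rearranging a loop\<close>

lemma curve_length_const_zero: "curve_length (\<lambda>_. 0 :: 'a::real_normed_vector) = 0"
proof -
  let ?z = "\<lambda>_. 0 :: 'a"
  have "polygon_length ?z xs = 0" for xs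
    by (induction xs) (auto simp: polygon_length_Cons)
  then have "polygon_lengths ?z 0 1 = {0}"
    using zero_in_polygon_lengths[of ?z 0 1] unfolding polygon_lengths_def by auto
  then show ?thesis by (simp add: curve_length_eq arc_length_def)
qed

text \<open>The translations are determined one after another by the requirement that every piece starts
where the preceding one ends.\<close>

lemma translate_and_concat:
  fixes p :: "nat \<Rightarrow> real \<Rightarrow> 'a::real_normed_vector"
  assumes "distinct js" "js \<noteq> []" "\<forall>j\<in>set js. path (p j) \<and> rectifiable (p j)"
  shows "\<exists>v \<delta>. \<delta> = concat_curves (map (\<lambda>j. (\<lambda>y. v j + y) \<circ> p j) js) \<and> path \<delta> \<and> rectifiable \<delta> \<and>
    pathstart \<delta> = a \<and> pathfinish \<delta> = a + (\<Sum>j\<in>set js. pathfinish (p j) - pathstart (p j)) \<and>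
    curve_length \<delta> = (\<Sum>j\<in>set js. curve_length (p j))"
  using assms
proof (induction js arbitrary: a)
  case (Cons j js)
  define q where "q = (\<lambda>y. (a - pathstart (p j)) + y) \<circ> p j"
  let ?b = "a + (pathfinish (p j) - pathstart (p j))"
  have p: "path (p j)" "rectifiable (p j)" using Cons.prems(3) by auto
  have q: "path q" "rectifiable q" "pathstart q = a" "pathfinish q = ?b" "curve_length q = curve_length (p j)"
    using p unfolding q_def
    by (simp_all add: path_translation_eq rectifiable_iff polygon_lengths_translate curve_length_eq
        arc_length_def pathstart_compose pathfinish_compose)
  show ?case
  proof (cases js)
    case Nil
    have c: "q = concat_curves (map (\<lambda>i. (\<lambda>y. (a - pathstart (p j)) + y) \<circ> p i) (j # js))"
      using Nil by (simp add: q_def)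
    show ?thesis
    proof (rule exI[of _ "\<lambda>_. a - pathstart (p j)"], rule exI[of _ q], intro conjI)
      show "q = concat_curves (map (\<lambda>i. (\<lambda>y. (a - pathstart (p j)) + y) \<circ> p i) (j # js))"
        by (rule c)
      show "pathfinish q = a + (\<Sum>j\<in>set (j # js). pathfinish (p j) - pathstart (p j))"
        unfolding q(4) Nil by simp
      show "curve_length q = (\<Sum>j\<in>set (j # js). curve_length (p j))"
        unfolding q(5) Nil by simp
    qed (fact q)+
  next
    case (Cons j' js')
    have js: "distinct js" "js \<noteq> []" "j \<notin> set js" using Cons.prems(1) Cons by auto
    have "\<forall>j\<in>set js. path (p j) \<and> rectifiable (p j)" using Cons.prems(3) by simp
    from Cons.IH[OF js(1,2) this, of ?b] obtain v \<delta> where v: "\<delta> = concat_curves (map (\<lambda>j. (\<lambda>y. v j + y) \<circ> p j) js)"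
      and \<delta>: "path \<delta>" "rectifiable \<delta>" "pathstart \<delta> = ?b"
        "pathfinish \<delta> = ?b + (\<Sum>j\<in>set js. pathfinish (p j) - pathstart (p j))"
        "curve_length \<delta> = (\<Sum>j\<in>set js. curve_length (p j))"
      by blast
    let ?v = "v(j := a - pathstart (p j))"
    have m: "map (\<lambda>i. (\<lambda>y. ?v i + y) \<circ> p i) js = map (\<lambda>i. (\<lambda>y. v i + y) \<circ> p i) js"
      using js(3) by (intro map_cong) auto
    have "concat_curves (q # ps) = q +++ concat_curves ps" if "ps \<noteq> []" for ps
      using that by (cases ps) simp_all
    moreover have "(\<lambda>y. ?v j + y) \<circ> p j = q" by (simp add: q_def)
    ultimately have c: "q +++ \<delta> = concat_curves (map (\<lambda>i. (\<lambda>y. ?v i + y) \<circ> p i) (j # js))"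
      using js(2) unfolding list.map m v by (simp only: map_is_Nil_conv not_False_eq_True)
    have j: "pathfinish q = pathstart \<delta>" using q(4) \<delta>(3) by simp
    show ?thesis
    proof (rule exI[of _ ?v], rule exI[of _ "q +++ \<delta>"], intro conjI)
      show "q +++ \<delta> = concat_curves (map (\<lambda>i. (\<lambda>y. ?v i + y) \<circ> p i) (j # js))" by (rule c)
      show "path (q +++ \<delta>)" by (rule path_join_imp[OF q(1) \<delta>(1) j])
      show "rectifiable (q +++ \<delta>)" by (rule curve_length_joinpaths(1)[OF q(2) \<delta>(2) j])
      show "pathstart (q +++ \<delta>) = a" using q(3) by simp
      show "pathfinish (q +++ \<delta>) = a + (\<Sum>j\<in>set (j # js). pathfinish (p j) - pathstart (p j))"
        using \<delta>(4) js(3) by (simp add: add.assoc)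
      show "curve_length (q +++ \<delta>) = (\<Sum>j\<in>set (j # js). curve_length (p j))"
        unfolding curve_length_joinpaths(2)[OF q(2) \<delta>(2) j] using q(5) \<delta>(5) js(3) by simp
    qed
  qed
qed simp

lemma cuts_mono:
  assumes "cuts n t" "i \<le> j" "j \<le> n + 1"
  shows "t i \<le> t j"
  using assms(2,3)
proof (induction rule: dec_induct)
  case (step k)
  then have "t k \<le> t (k + 1)" using assms(1) by (simp add: cuts_def)
  then show ?case using step by simp
qed simp

lemma cuts_range: "cuts n t \<Longrightarrow> j \<le> n + 1 \<Longrightarrow> t j \<in> {0..1}"
  using cuts_mono[of n t 0 j] cuts_mono[of n t j "n + 1"] by (simp add: cuts_def)

text \<open>The \<open>r\<close> equal sums add up to the total increment of \<open>g\<close>, which is zero.\<close>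

lemma equal_partition_sums:
  fixes g :: "nat \<Rightarrow> real"
  assumes T: "indexed_partition r T {1..n + 1}" and r: "r > 0"
    and eq: "\<And>k k'. k \<in> {1..r} \<Longrightarrow> k' \<in> {1..r} \<Longrightarrow>
      (\<Sum>j\<in>T k. g j - g (j - 1)) = (\<Sum>j\<in>T k'. g j - g (j - 1))"
    and closed: "g (n + 1) = g 0" and k: "k \<in> {1..r}"
  shows "(\<Sum>j\<in>T k. g j - g (j - 1)) = 0"
proof -
  have UN: "(\<Union>k\<in>{1..r}. T k) = {1..n + 1}" and disj: "disjoint_family_on T {1..r}"
    using T by (auto simp: indexed_partition_def)
  have fin: "finite (T k)" if "k \<in> {1..r}" for k
    using UN that by (metis UN_upper finite_atLeastAtMost finite_subset)
  have "(\<Sum>j\<in>{1..n + 1}. g j - g (j - 1)) = (\<Sum>k\<in>{1..r}. \<Sum>j\<in>T k. g j - g (j - 1))"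
    unfolding UN[symmetric]
    using disj fin by (intro sum.UNION_disjoint) (auto simp: disjoint_family_on_def)
  also have "\<dots> = (\<Sum>k'\<in>{1..r}. \<Sum>j\<in>T k. g j - g (j - 1))"
    by (intro sum.cong refl eq k)
  also have "\<dots> = real r * (\<Sum>j\<in>T k. g j - g (j - 1))" by simp
  finally have "real r * (\<Sum>j\<in>T k. g j - g (j - 1)) = (\<Sum>j\<in>{Suc 0..n + 1}. g j - g (j - 1))" by simp
  also have "\<dots> = g (n + 1) - g 0" by (rule sum_telescope'') simp
  finally show ?thesis using closed r by simp
qed

theorem corollary4p5:
  fixes \<gamma> :: "real \<Rightarrow> real ^ 'd"
    and r n m :: nat
    and C :: "nat \<Rightarrow> nat set"
  assumes "is_loop \<gamma>"
    and "rectifiable \<gamma>"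
    and "prime r"
    and "n = (r - 1) * (CARD('d) + 1)"
    and "indexed_partition m C {1..n + 1}"
    and "\<forall>i\<in>{1..m}. card (C i) \<le> r - 1"
  shows "\<exists>(t :: nat \<Rightarrow> real) (T :: nat \<Rightarrow> nat set) (\<delta> :: nat \<Rightarrow> real \<Rightarrow> real ^ 'd) (L :: real).
    cuts n t \<and>
    indexed_partition r T {1..n + 1} \<and>
    (\<forall>i\<in>{1..m}. \<forall>k\<in>{1..r}. card (C i \<inter> T k) \<le> 1) \<and>
    (\<forall>k\<in>{1..r}. translation_rearrangement \<gamma> t (T k) (\<delta> k) \<and> is_loop (\<delta> k) \<and>
      curve_length (\<delta> k) = L)"
proof -
  let ?d = "CARD('d)"
  have r0: "r > 0" using assms(3) by (rule prime_gt_0_nat)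
  have path: "path \<gamma>" and closed: "\<gamma> 1 = \<gamma> 0"
    using assms(1) by (simp_all add: is_loop_def pathfinish_def pathstart_def)
  then have cont: "continuous_on {0..1} \<gamma>" by (simp add: path_def)
  obtain h :: "nat \<Rightarrow> 'd" where h: "bij_betw h {0..<?d} UNIV"
    using ex_bij_betw_nat_finite[of "UNIV :: 'd set"] by auto
  \<comment> \<open>The last function makes the lengths agree; the coordinates make the pieces close up.\<close>
  define F where "F b x = (if b < ?d then \<gamma> x $ h b else arc_length \<gamma> 0 x)" for b x
  have cont_F: "continuous_on {0..1} (F b)" for b
  proof (cases "b < ?d")
    case True
    then show ?thesis
      using cont by (simp add: F_def[abs_def] continuous_on_component)
  next
    case False
    then show ?thesis
      using continuous_on_arc_length[OF assms(2) cont] by (simp add: F_def[abs_def])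
  qed
  obtain t T where t: "cuts n t" and T: "indexed_partition r T {1..n + 1}"
    and rainbow: "\<forall>i\<in>{1..m}. \<forall>k\<in>{1..r}. card (C i \<inter> T k) \<le> 1"
    and eq_all: "\<forall>b<?d + 1. \<forall>k\<in>{1..r}. \<forall>k'\<in>{1..r}.
       (\<Sum>j\<in>T k. F b (t j) - F b (t (j - 1))) = (\<Sum>j\<in>T k'. F b (t j) - F b (t (j - 1)))"
    using rainbow_splitting[where F = F, OF assms(3,4) cont_F assms(5,6)] by blast
  have eq: "(\<Sum>j\<in>T k. F b (t j) - F b (t (j - 1))) = (\<Sum>j\<in>T k'. F b (t j) - F b (t (j - 1)))"
    if "b < ?d + 1" "k \<in> {1..r}" "k' \<in> {1..r}" for b k k'
    using eq_all that by blast
  have T_sub: "T k \<subseteq> {1..n + 1}" if "k \<in> {1..r}" for k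
    using T that by (auto simp: indexed_partition_def)
  have bdd: "bdd_above (polygon_lengths \<gamma> a b)" if "0 \<le> a" "b \<le> 1" for a b
    using assms(2) polygon_lengths_mono[OF that] unfolding rectifiable_iff by (rule bdd_above_mono)
  let ?p = "curve_piece \<gamma> t"
  have piece: "path (?p j)" "rectifiable (?p j)" "pathstart (?p j) = \<gamma> (t (j - 1))" "pathfinish (?p j) = \<gamma> (t j)"
    "curve_length (?p j) = arc_length \<gamma> 0 (t j) - arc_length \<gamma> 0 (t (j - 1))"
    if "j \<in> {1..n + 1}" for j
  proof -
    have ts: "t (j - 1) \<in> {0..1}" "t j \<in> {0..1}" and le: "t (j - 1) \<le> t j"
      using that by (auto intro!: cuts_range[OF t, simplified] cuts_mono[OF t])
    show "path (?p j)" unfolding curve_piece_def by (rule path_subpath[OF path ts])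
    show "rectifiable (?p j)"
      using bdd ts unfolding curve_piece_def rectifiable_iff polygon_lengths_subpath[OF le] by simp
    show "pathstart (?p j) = \<gamma> (t (j - 1))" "pathfinish (?p j) = \<gamma> (t j)"
      by (simp_all add: curve_piece_def)
    have "curve_length (?p j) = arc_length \<gamma> (t (j - 1)) (t j)"
      unfolding curve_piece_def curve_length_eq arc_length_def polygon_lengths_subpath[OF le] ..
    moreover have "arc_length \<gamma> 0 (t j) = arc_length \<gamma> 0 (t (j - 1)) + arc_length \<gamma> (t (j - 1)) (t j)"
      using ts le by (intro arc_length_add(2) bdd) auto
    ultimately show "curve_length (?p j) = arc_length \<gamma> 0 (t j) - arc_length \<gamma> 0 (t (j - 1))" by simp
  qed
  have balanced: "(\<Sum>j\<in>T k. \<gamma> (t j) - \<gamma> (t (j - 1))) = 0" if k: "k \<in> {1..r}" for k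
  proof (rule vec_eq_iff[THEN iffD2], rule allI)
    fix i
    have "i \<in> h ` {0..<?d}" using h by (simp add: bij_betw_def)
    then obtain b where b: "b < ?d" "h b = i" by auto
    have "(\<Sum>j\<in>T k. F b (t j) - F b (t (j - 1))) = 0"
    proof (rule equal_partition_sums[OF T r0 eq _ k])
      show "F b (t (n + 1)) = F b (t 0)" using t b closed by (simp add: F_def cuts_def)
    qed (use b in auto)
    then show "(\<Sum>j\<in>T k. \<gamma> (t j) - \<gamma> (t (j - 1))) $ i = 0 $ i"
      using b by (simp add: F_def)
  qed
  define L where "L = (\<Sum>j\<in>T 1. arc_length \<gamma> 0 (t j) - arc_length \<gamma> 0 (t (j - 1)))"
  have L: "(\<Sum>j\<in>T k. curve_length (?p j)) = L" if k: "k \<in> {1..r}" for k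
  proof -
    have "(\<Sum>j\<in>T k. curve_length (?p j)) = (\<Sum>j\<in>T k. arc_length \<gamma> 0 (t j) - arc_length \<gamma> 0 (t (j - 1)))"
      using T_sub[OF k] piece(5) by (intro sum.cong) auto
    also have "\<dots> = L"
      using eq[of ?d k 1] k by (simp add: F_def L_def)
    finally show ?thesis .
  qed
  have "\<exists>\<delta>. translation_rearrangement \<gamma> t (T k) \<delta> \<and> is_loop \<delta> \<and> curve_length \<delta> = L"
    if k: "k \<in> {1..r}" for k
  proof (cases "T k = {}")
    case True
    have "translation_rearrangement \<gamma> t (T k) (\<lambda>_. 0)"
      unfolding translation_rearrangement_def True by (rule exI[of _ "[]"]) simp
    moreover have "is_loop (\<lambda>_. 0 :: real ^ 'd)"
      by (simp add: is_loop_def path_def pathfinish_def pathstart_def)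
    moreover have "curve_length (\<lambda>_. 0 :: real ^ 'd) = L"
      using L[OF k] by (simp add: True curve_length_const_zero)
    ultimately show ?thesis by blast
  next
    case False
    have "finite (T k)" using T_sub[OF k] finite_subset by blast
    then obtain js where js: "set js = T k" "distinct js" using finite_distinct_list by blast
    have ne: "js \<noteq> []" using False js by auto
    have "\<forall>j\<in>set js. path (?p j) \<and> rectifiable (?p j)"
      using piece(1,2) T_sub[OF k] js(1) by blast
    from translate_and_concat[where a = 0 and p = ?p, OF js(2) ne this]
    obtain v \<delta> where v: "\<delta> = concat_curves (map (\<lambda>j. (\<lambda>y. v j + y) \<circ> ?p j) js)"
      and \<delta>: "path \<delta>" "pathstart \<delta> = 0"
        "pathfinish \<delta> = 0 + (\<Sum>j\<in>set js. pathfinish (?p j) - pathstart (?p j))"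
        "curve_length \<delta> = (\<Sum>j\<in>set js. curve_length (?p j))"
      by (elim exE conjE) (rule that)
    have "(\<Sum>j\<in>set js. pathfinish (?p j) - pathstart (?p j)) = (\<Sum>j\<in>T k. \<gamma> (t j) - \<gamma> (t (j - 1)))"
      unfolding js(1)
    proof (rule sum.cong)
      fix j assume "j \<in> T k"
      then have "j \<in> {1..n + 1}" using T_sub[OF k] by blast
      then show "pathfinish (?p j) - pathstart (?p j) = \<gamma> (t j) - \<gamma> (t (j - 1))"
        by (simp only: piece(3,4))
    qed simp
    then have "pathfinish \<delta> = 0" unfolding \<delta>(3) balanced[OF k] by simp
    then have "is_loop \<delta>" using \<delta>(1,2) by (simp only: is_loop_def)
    moreover have "translation_rearrangement \<gamma> t (T k) \<delta>"
      unfolding translation_rearrangement_def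
      by (rule exI[of _ js], rule exI[of _ v]) (intro conjI js v)
    moreover have "curve_length \<delta> = L" using \<delta>(4) L[OF k] unfolding js(1) by (rule trans)
    ultimately show ?thesis by blast
  qed
  then have "\<forall>k\<in>{1..r}. \<exists>\<delta>. translation_rearrangement \<gamma> t (T k) \<delta> \<and> is_loop \<delta> \<and> curve_length \<delta> = L"
    by (rule ballI)
  from bchoice[OF this] obtain \<delta> where \<delta>: "\<forall>k\<in>{1..r}.
      translation_rearrangement \<gamma> t (T k) (\<delta> k) \<and> is_loop (\<delta> k) \<and> curve_length (\<delta> k) = L"
    by (rule exE)
  show ?thesis
    by (rule exI[of _ t], rule exI[of _ T], rule exI[of _ \<delta>], rule exI[of _ L])
      (intro conjI t T rainbow \<delta>)
qed

end
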